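(* There is an algorithm which, given a maximal weakly separated collection $W\subset2^{[n]}$, finds in polynomial time (in $n$) a maximal chord separated collection $C\subset2^{[n]}$ including $W$ (i.e. $W\subseteq C$).
   Context: $[n]=\{1,\ldots,n\}$; $A-B=\{a\in A: a\notin B\}$. For $A,B\subseteq[n]$, $A$ surrounds $B$ if there are no elements $i<j<k$ of $[n]$ with $i,k\in B-A$ and $j\in A-B$. $A,B$ are weakly separated if either $|A|\le|B|$ and $A$ surrounds $B$, or $|B|\le|A|$ and $B$ surrounds $A$ (or both). $A,B$ are chord separated if one of $A,B$ surrounds the other (equivalently, there are no $i<j<k<l$ in $[n]$ such that $i,k$ belong to one, and $j,l$ to the other, of $A-B$ and $B-A$). A collection $\mathcal F\subseteq2^{[n]}$ is weakly (chord) separated if any two of its members are. "Maximal" means inclusion-wise maximal in $2^{[n]}$ among collections of the given kind. (All maximal weakly separated collections have size $\frac12n(n+1)+1$ and all maximal chord separated ones have size $\binom n3+\binom n2+\binom n1+\binom n0$.) *)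

theory Defs
  imports Main "HOL-Computational_Algebra.Polynomial"
begin

section \<open>Weak and chord separation\<close>

text \<open>Below, \<open>{1..n}\<close> plays the role of $[n]$; collections are required to be subsets of
  \<open>Pow {1..n}\<close>, so the elements \<open>i, j, k\<close> in \<open>surrounds\<close> automatically lie in $[n]$.\<close>

definition surrounds :: "nat set \<Rightarrow> nat set \<Rightarrow> bool" where
  "surrounds A B \<longleftrightarrow>
     \<not> (\<exists>i j k. i < j \<and> j < k \<and> i \<in> B - A \<and> k \<in> B - A \<and> j \<in> A - B)"

definition weakly_separated :: "nat set \<Rightarrow> nat set \<Rightarrow> bool" where
  "weakly_separated A B \<longleftrightarrow>
     (card A \<le> card B \<and> surrounds A B) \<or> (card B \<le> card A \<and> surrounds B A)"

definition chord_separated :: "nat set \<Rightarrow> nat set \<Rightarrow> bool" where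
  "chord_separated A B \<longleftrightarrow> surrounds A B \<or> surrounds B A"

definition separated_collection ::
    "(nat set \<Rightarrow> nat set \<Rightarrow> bool) \<Rightarrow> nat \<Rightarrow> nat set set \<Rightarrow> bool" where
  "separated_collection sep n F \<longleftrightarrow> F \<subseteq> Pow {1..n} \<and> pairwise sep F"

definition maximal_separated_collection ::
    "(nat set \<Rightarrow> nat set \<Rightarrow> bool) \<Rightarrow> nat \<Rightarrow> nat set set \<Rightarrow> bool" where
  "maximal_separated_collection sep n F \<longleftrightarrow>
     separated_collection sep n F \<and>
     (\<forall>G. separated_collection sep n G \<and> F \<subseteq> G \<longrightarrow> G = F)"


section \<open>Algorithms and their running time\<close>

text \<open>Algorithms are programs of a random access machine, with structured control flow.
  The memory consists of arrays of natural numbers; \<open>s a i\<close> is the entry with index \<open>i\<close> of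
  array \<open>a\<close> in the state \<open>s\<close>.  A program is a finite object, so it can mention only finitely
  many arrays.  The only arithmetic operations are addition and truncated subtraction, each
  of which is charged one unit of time.  There is no multiplication, so \<open>t\<close> steps increase
  the bit length of the stored numbers by at most \<open>O(t)\<close>; hence polynomial time on this
  machine is the same as polynomial time on a Turing machine.\<close>

datatype expr =
    Const nat
  | Read nat expr
  | Add expr expr
  | Sub expr expr

datatype prog =
    Skip
  | Write nat expr expr
  | Seq prog prog
  | Cond expr prog prog
  | While expr prog

type_synonym state = "nat \<Rightarrow> nat \<Rightarrow> nat"

fun val :: "expr \<Rightarrow> state \<Rightarrow> nat" where
  "val (Const c) s = c"
| "val (Read a e) s = s a (val e s)"
| "val (Add e f) s = val e s + val f s"
| "val (Sub e f) s = val e s - val f s"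

fun expr_cost :: "expr \<Rightarrow> nat" where
  "expr_cost (Const c) = 1"
| "expr_cost (Read a e) = 1 + expr_cost e"
| "expr_cost (Add e f) = 1 + expr_cost e + expr_cost f"
| "expr_cost (Sub e f) = 1 + expr_cost e + expr_cost f"

text \<open>\<open>runs p s t s'\<close>: started in state \<open>s\<close>, the program \<open>p\<close> halts in state \<open>s'\<close> after
  exactly \<open>t\<close> time units.  A guard counts as true if its value is nonzero.\<close>

inductive runs :: "prog \<Rightarrow> state \<Rightarrow> nat \<Rightarrow> state \<Rightarrow> bool" where
  Skip: "runs Skip s 1 s"
| Write: "runs (Write a e f) s (1 + expr_cost e + expr_cost f)
            (s(a := (s a)(val e s := val f s)))"
| Seq: "runs p s t s' \<Longrightarrow> runs q s' u s'' \<Longrightarrow> runs (Seq p q) s (t + u) s''"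
| CondTrue: "val e s \<noteq> 0 \<Longrightarrow> runs p s t s' \<Longrightarrow> runs (Cond e p q) s (1 + expr_cost e + t) s'"
| CondFalse: "val e s = 0 \<Longrightarrow> runs q s t s' \<Longrightarrow> runs (Cond e p q) s (1 + expr_cost e + t) s'"
| WhileFalse: "val e s = 0 \<Longrightarrow> runs (While e p) s (1 + expr_cost e) s"
| WhileTrue: "val e s \<noteq> 0 \<Longrightarrow> runs p s t s' \<Longrightarrow> runs (While e p) s' u s'' \<Longrightarrow>
    runs (While e p) s (1 + expr_cost e + t + u) s''"

inductive_cases Skip_runsE: "runs Skip s t s'"
inductive_cases Write_runsE: "runs (Write a e f) s t s'"
inductive_cases Seq_runsE: "runs (Seq p q) s t s'"
inductive_cases Cond_runsE: "runs (Cond e p q) s t s'"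
inductive_cases While_runsE: "runs (While e p) s t s'"

lemma runs_deterministic:
  "runs p s t s' \<Longrightarrow> runs p s u s'' \<Longrightarrow> u = t \<and> s'' = s'"
proof (induction arbitrary: u s'' rule: runs.induct)
  case (Skip s)
  then show ?case by (rule Skip_runsE) simp
next
  case (Write a e f s)
  then show ?case by (rule Write_runsE) simp
next
  case (Seq p s t s' q v r)
  from Seq.prems obtain t1 t2 r1
    where "runs p s t1 r1" "runs q r1 t2 s''" "u = t1 + t2"
    by (rule Seq_runsE)
  with Seq.IH show ?case by metis
next
  case (CondTrue e s p t s' q)
  from CondTrue.prems obtain t1 where "runs p s t1 s''" "u = 1 + expr_cost e + t1"
    by (rule Cond_runsE) (use CondTrue.hyps in simp_all)
  with CondTrue.IH show ?case by metis
next
  case (CondFalse e s q t s' p)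
  from CondFalse.prems obtain t1 where "runs q s t1 s''" "u = 1 + expr_cost e + t1"
    by (rule Cond_runsE) (use CondFalse.hyps in simp_all)
  with CondFalse.IH show ?case by metis
next
  case (WhileFalse e s p)
  from WhileFalse.prems show ?case
    by (rule While_runsE) (use WhileFalse.hyps in simp_all)
next
  case (WhileTrue e s p t s' v r)
  from WhileTrue.prems obtain t1 t2 r1
    where "runs p s t1 r1" "runs (While e p) r1 t2 s''" "u = 1 + expr_cost e + t1 + t2"
    by (rule While_runsE) (use WhileTrue.hyps in simp_all)
  with WhileTrue.IH show ?case by metis
qed


section \<open>Representation of collections in memory\<close>

text \<open>A list of subsets of \<open>{1..n}\<close> is stored as \<open>n\<close>, followed by the number of subsets,
  followed by the 0/1 incidence vectors, of length \<open>n\<close> each, of the subsets.\<close>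

definition encode :: "nat \<Rightarrow> nat set list \<Rightarrow> nat list" where
  "encode n Xs = n # length Xs #
     concat (map (\<lambda>X. map (\<lambda>i. if i \<in> X then 1 else 0) [1..<Suc n]) Xs)"

text \<open>A collection has one representation for each order of its members, without repetition.\<close>

definition represents :: "nat \<Rightarrow> nat list \<Rightarrow> nat set set \<Rightarrow> bool" where
  "represents n xs F \<longleftrightarrow> (\<exists>Xs. distinct Xs \<and> set Xs = F \<and> xs = encode n Xs)"

text \<open>The input is placed at the beginning of array 0, all other memory being 0; the output
  is read off from the beginning of array 1.\<close>

definition input_state :: "nat list \<Rightarrow> state" where
  "input_state xs = (\<lambda>a i. if a = 0 \<and> i < length xs then xs ! i else 0)"

definition outputs :: "state \<Rightarrow> nat list \<Rightarrow> bool" where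
  "outputs s ys \<longleftrightarrow> (\<forall>i < length ys. s 1 i = ys ! i)"

end

theory Submission imports Defs begin

text \<open>
  Write \<open>Xi\<close>, \<open>Xij\<close> for \<open>X \<union> {i}\<close>, \<open>X \<union> {i, j}\<close>. For \<open>i < j < k\<close> outside \<open>X\<close>, if \<open>Xi, Xk, Xij, Xjk\<close> belong
  to a maximal weakly separated collection, then replacing \<open>Xik\<close> by \<open>Xj\<close> (lowering) or \<open>Xj\<close> by \<open>Xik\<close>
  (raising) gives another one. The algorithm applies lowering flips to \<open>W\<close> as long as possible, then,
  again from \<open>W\<close>, raising flips as long as possible, and returns all sets met. Each flip changes the sum of
  the cardinalities by one, and \<open>card W \<le> 1 + n\<^sup>2\<close>, so there are polynomially many flips.

  Consider the whole chain of lowering flips from the highest collection to the lowest one. If \<open>Y\<close> occurs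
  no later than \<open>Z\<close>, then \<open>Y, Z\<close> are chord separated, and weakly separated if \<open>card Y \<le> card Z\<close>: this is
  preserved by every flip, so the union of the chain is chord separated. If \<open>Z\<close> is chord separated from the
  union and not in it, then weak separation from the sets of size at most \<open>card Z\<close> persists along the
  chain down to its end, where the singletons force \<open>Z\<close> to be an interval. This needs that a collection
  without lowering flips consists of intervals. Otherwise let \<open>r\<close> be the largest size of a member that is
  not an interval. A walk through the strip between the levels \<open>r - 1\<close> and \<open>r\<close> of the tiling of the
  collection finds a flip; its steps are provided by a purely combinatorial fact on noncrossing sets: every
  edge \<open>S \<union> {a}\<close>, \<open>S \<union> {b}\<close> that is not on the boundary bounds a triangle on either side.\<close>

text \<open>The chain must pass through \<open>W\<close> because both of its ends are used. At the
  top, complements of members are intervals, so every member surrounds every set; this starts the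
  transfer of weak separation to \<open>Z\<close>. At the bottom, the singletons refute it.

  A flip is a square move in disguise. Extend all sets to a common size by elements above
  \<open>n\<close>: weak separation becomes noncrossing, and one of the new elements is the fourth
  corner of the square. Noncrossing is cyclic and invariant under complements, so triangles of both
  colours come from one lemma. The triangles are those of plabic tilings, but no tiling is built;
  pairwise noncrossing and maximality suffice.

  The obstacle to a triangle on the edge from \<open>a\<close> to \<open>b\<close> is a set that
  spans the edge: it contains both ends and drops nothing in between, so the point sought has to lie
  in it. Dually, sets that gain elements only between \<open>a\<close> and \<open>b\<close> obstruct
  triangles of the other colour. A comparison of the smallest sets of the two kinds decides which
  colour exists.\<close>

section \<open>Crossing chords\<close>

text \<open>For four distinct points of a circle, cut open to a line: the chords \<open>x y\<close> and \<open>m m'\<close> cross.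
  In this form, the invariance under rotations is a matter of propositional logic.\<close>

definition crosses :: "nat \<Rightarrow> nat \<Rightarrow> nat \<Rightarrow> nat \<Rightarrow> bool" where
  "crosses x y m m' \<longleftrightarrow> ((m < x) \<noteq> (m' < x)) \<noteq> ((m < y) \<noteq> (m' < y))"

definition noncrossing :: "nat set \<Rightarrow> nat set \<Rightarrow> bool" where
  "noncrossing A B \<longleftrightarrow> (\<forall>x\<in>A - B. \<forall>y\<in>A - B. \<forall>m\<in>B - A. \<forall>m'\<in>B - A. \<not> crosses x y m m')"

lemma noncrossingD:
  "noncrossing A B \<Longrightarrow> x \<in> A \<Longrightarrow> x \<notin> B \<Longrightarrow> y \<in> A \<Longrightarrow> y \<notin> B \<Longrightarrow> m \<in> B \<Longrightarrow> m \<notin> A \<Longrightarrow>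
    m' \<in> B \<Longrightarrow> m' \<notin> A \<Longrightarrow> crosses x y m m' \<Longrightarrow> False"
  unfolding noncrossing_def by blast

lemma noncrossingI:
  "(\<And>x y m m'. x \<in> A \<Longrightarrow> x \<notin> B \<Longrightarrow> y \<in> A \<Longrightarrow> y \<notin> B \<Longrightarrow> m \<in> B \<Longrightarrow> m \<notin> A \<Longrightarrow>
    m' \<in> B \<Longrightarrow> m' \<notin> A \<Longrightarrow> m < m' \<Longrightarrow> crosses x y m m' \<Longrightarrow> False) \<Longrightarrow> noncrossing A B"
proof -
  assume h: "\<And>x y m m'. x \<in> A \<Longrightarrow> x \<notin> B \<Longrightarrow> y \<in> A \<Longrightarrow> y \<notin> B \<Longrightarrow> m \<in> B \<Longrightarrow> m \<notin> A \<Longrightarrow>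
    m' \<in> B \<Longrightarrow> m' \<notin> A \<Longrightarrow> m < m' \<Longrightarrow> crosses x y m m' \<Longrightarrow> False"
  show ?thesis unfolding noncrossing_def
  proof (intro ballI notI)
    fix x y m m' assume d: "x \<in> A - B" "y \<in> A - B" "m \<in> B - A" "m' \<in> B - A" and c: "crosses x y m m'"
    have "m \<noteq> m'" "crosses x y m' m" using c unfolding crosses_def by auto
    then consider "m < m'" | "m' < m" by linarith
    then show False
      by cases (use h[of x y m m'] h[of x y m' m] d c \<open>crosses x y m' m\<close> in blast)+
  qed
qed

lemma crosses_alternating: "x < m \<Longrightarrow> m < y \<Longrightarrow> y < m' \<Longrightarrow> crosses x y m m'"
  unfolding crosses_def by auto

lemma crosses_alternating': "m < x \<Longrightarrow> x < m' \<Longrightarrow> m' < y \<Longrightarrow> crosses x y m m'"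
  unfolding crosses_def by auto

text \<open>The strict comparisons treat a shared end point as lying on one fixed side, so the
  formula is symmetric in the two chords only when they have no end point in common.\<close>

lemma crosses_sym: "crosses x y m m' = crosses m m' x y" if "x \<noteq> m" "x \<noteq> m'" "y \<noteq> m" "y \<noteq> m'"
  using that unfolding crosses_def by (metis linorder_less_linear order_less_asym)

lemma noncrossing_sym: "noncrossing A B = noncrossing B A"
proof -
  have "noncrossing B A" if h: "noncrossing A B" for A B
    unfolding noncrossing_def
  proof (intro ballI notI)
    fix x y m m' assume d: "x \<in> B - A" "y \<in> B - A" "m \<in> A - B" "m' \<in> A - B" and c: "crosses x y m m'"
    then have "x \<noteq> m" "x \<noteq> m'" "y \<noteq> m" "y \<noteq> m'" by auto
    with c have "crosses m m' x y" using crosses_sym by blast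
    with d h show False unfolding noncrossing_def by blast
  qed
  then show ?thesis by blast
qed

lemma noncrossing_Diff: "noncrossing A B \<Longrightarrow> noncrossing (A - D) (B - D)"
  unfolding noncrossing_def by blast

text \<open>If \<open>surrounds\<close> fails in both directions, there are two triples whose
  midpoints lie in different sets. The midpoints, together with one outer element of each triple,
  alternate.\<close>

lemma chord_separated_iff_noncrossing: "chord_separated A B \<longleftrightarrow> noncrossing A B"
proof
  assume h: "chord_separated A B"
  show "noncrossing A B"
  proof (rule noncrossingI)
    fix x y m m' assume d: "x \<in> A" "x \<notin> B" "y \<in> A" "y \<notin> B" "m \<in> B" "m \<notin> A" "m' \<in> B" "m' \<notin> A"
      and l: "m < m'" and c: "crosses x y m m'"
    have "x \<noteq> m" "x \<noteq> m'" "y \<noteq> m" "y \<noteq> m'" using d by auto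
    then have "(x < m \<and> m < y \<and> y < m') \<or> (y < m \<and> m < x \<and> x < m') \<or>
       (m < x \<and> x < m' \<and> m' < y) \<or> (m < y \<and> y < m' \<and> m' < x)"
      using c l unfolding crosses_def by linarith
    then show False using h d unfolding chord_separated_def surrounds_def by blast
  qed
next
  assume h: "noncrossing A B"
  show "chord_separated A B"
  proof (rule ccontr)
    assume "\<not> chord_separated A B"
    then obtain i j k i' j' k' where
      1: "i < j" "j < k" "i \<in> B - A" "k \<in> B - A" "j \<in> A - B" and
      2: "i' < j'" "j' < k'" "i' \<in> A - B" "k' \<in> A - B" "j' \<in> B - A"
      unfolding chord_separated_def surrounds_def by blast
    from 1 2 have "j \<noteq> j'" by auto
    then consider "j < j'" | "j' < j" by linarith
    then show False
    proof cases
      case 1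
      have "crosses j k' i j'" using 1 \<open>i<j\<close> \<open>j'<k'\<close> by (auto simp: crosses_def)
      then show False using h \<open>i \<in> B - A\<close> \<open>j \<in> A - B\<close> 2 unfolding noncrossing_def by blast
    next
      case 2
      have "crosses i' j j' k" using 2 \<open>i'<j'\<close> \<open>j<k\<close> by (auto simp: crosses_def)
      then show False using h 1 \<open>i' \<in> A - B\<close> \<open>j' \<in> B - A\<close> unfolding noncrossing_def by blast
    qed
  qed
qed

lemma card_Diff_swap:
  assumes "finite A" "finite B"
  shows "card (A - B) + card B = card (B - A) + card A"
proof -
  have "(A - B) \<inter> B = {}" "(B - A) \<inter> A = {}" by blast+
  then have "card (A - B) + card B = card (A \<union> B)" "card (B - A) + card A = card (A \<union> B)"
    using assms card_Un_disjoint[of "A - B" B] card_Un_disjoint[of "B - A" A] by (simp_all add: Un_commute)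
  then show ?thesis by simp
qed

section \<open>A point that is not blocked\<close>

definition blocks :: "nat set \<Rightarrow> nat \<Rightarrow> bool" where
  "blocks K c \<longleftrightarrow> c \<notin> K \<and> (\<exists>y\<in>K. \<exists>z\<in>K. y < c \<and> c < z)"

text \<open>In a counterexample with \<open>X\<close> of minimal size, the removal of a point \<open>i\<close> leaves some
  \<open>f i\<close> unblocked, so all sets that block \<open>f i\<close> have \<open>i\<close> as the only element on
  its side of \<open>f i\<close>. Hence orbits of \<open>f\<close> cannot leave the interval from \<open>i\<close> to \<open>f i\<close> on the side
  of \<open>i\<close>, and \<open>f\<close> has no cycles.\<close>

lemma unblocked_point:
  assumes "finite X" "X \<noteq> {}" "X \<subseteq> {a<..<b}"
    and "\<And>K. K \<in> F \<Longrightarrow> K \<subseteq> insert a (insert b X)"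
    and "\<And>K L. K \<in> F \<Longrightarrow> L \<in> F \<Longrightarrow> noncrossing K L"
    and "\<And>K. K \<in> F \<Longrightarrow> \<not> (a \<in> K \<and> b \<in> K)"
  shows "\<exists>c\<in>X. \<forall>K\<in>F. \<not> blocks K c"
  using assms
proof (induction "card X" arbitrary: X F rule: less_induct)
  case less
  note IH = less.hyps and fin = less.prems(1) and ne = less.prems(2) and Xab = less.prems(3)
    and FX = less.prems(4) and nc = less.prems(5) and nab = less.prems(6)
  show ?case
  proof (rule ccontr)
    assume "\<not> ?case"
    then have blk: "\<exists>K\<in>F. blocks K c" if "c \<in> X" for c using that by blast
    have ex: "\<exists>c\<in>X - {i}. \<forall>K\<in>F. \<not> blocks (K - {i}) c" if i: "i \<in> X" for i
    proof (cases "X = {i}")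
      case True
      \<comment> \<open>A set that blocks the only point of \<open>X\<close> would contain both
        \<open>a\<close> and \<open>b\<close>.\<close>
      obtain K where K: "K \<in> F" "blocks K i" using blk i by blast
      then obtain y z where "y \<in> K" "z \<in> K" "y < i" "i < z" unfolding blocks_def by blast
      moreover have "a < i" "i < b" using Xab i by auto
      ultimately have "y = a" "z = b" using FX[OF K(1)] True by auto
      with \<open>y \<in> K\<close> \<open>z \<in> K\<close> nab[OF K(1)] show ?thesis by blast
    next
      case False
      have "\<exists>c\<in>X - {i}. \<forall>K\<in>(\<lambda>K. K - {i}) ` F. \<not> blocks K c"
      proof (rule IH)
        show "card (X - {i}) < card X" using fin i by (rule card_Diff1_less)
        show "finite (X - {i})" using fin by simp
        show "X - {i} \<noteq> {}" using False i by blast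
        show "X - {i} \<subseteq> {a<..<b}" using Xab by blast
      next
        fix K assume "K \<in> (\<lambda>K. K - {i}) ` F"
        then show "K \<subseteq> insert a (insert b (X - {i}))" using FX by blast
      next
        fix K L assume "K \<in> (\<lambda>K. K - {i}) ` F" "L \<in> (\<lambda>K. K - {i}) ` F"
        then show "noncrossing K L" using nc noncrossing_Diff by blast
      next
        fix K assume "K \<in> (\<lambda>K. K - {i}) ` F"
        then show "\<not> (a \<in> K \<and> b \<in> K)" using nab by blast
      qed
      then show ?thesis by blast
    qed
    then obtain f where f: "\<And>i. i \<in> X \<Longrightarrow> f i \<in> X" "\<And>i. i \<in> X \<Longrightarrow> f i \<noteq> i"
      "\<And>i K. i \<in> X \<Longrightarrow> K \<in> F \<Longrightarrow> \<not> blocks (K - {i}) (f i)"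
      by (metis Diff_iff singletonI)
    have right: "\<exists>B\<in>F. i \<in> B \<and> f i \<notin> B \<and> (\<forall>y\<in>B. y < f i \<longrightarrow> y = i) \<and> (\<exists>z\<in>B. f i < z)"
      if i: "i \<in> X" "i < f i" for i
    proof -
      obtain B where B: "B \<in> F" "blocks B (f i)" using blk f(1) i by blast
      obtain y z where yz: "y \<in> B" "z \<in> B" "y < f i" "f i < z" "f i \<notin> B" using B unfolding blocks_def by blast
      have "\<forall>y\<in>B. y < f i \<longrightarrow> y = i" using f(3)[OF i(1) B(1)] yz i unfolding blocks_def by auto
      with yz show ?thesis using B(1) by blast
    qed
    have left: "\<exists>B\<in>F. i \<in> B \<and> f i \<notin> B \<and> (\<forall>z\<in>B. f i < z \<longrightarrow> z = i) \<and> (\<exists>y\<in>B. y < f i)"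
      if i: "i \<in> X" "f i < i" for i
    proof -
      obtain B where B: "B \<in> F" "blocks B (f i)" using blk f(1) i by blast
      obtain y z where yz: "y \<in> B" "z \<in> B" "y < f i" "f i < z" "f i \<notin> B" using B unfolding blocks_def by blast
      have "\<forall>z\<in>B. f i < z \<longrightarrow> z = i" using f(3)[OF i(1) B(1)] yz i unfolding blocks_def by auto
      with yz show ?thesis using B(1) by blast
    qed
    \<comment> \<open>Otherwise the blocking sets \<open>B\<close> of \<open>f i\<close> and
      \<open>D\<close> of \<open>f v\<close> alternate at \<open>y < i < v < z\<close>.\<close>
    have trap: "i < f v" if i: "i \<in> X" "i < f i" and v: "v \<in> X" "i < v" "v \<le> f i" "f v < v" for i v
    proof (rule ccontr)
      assume n: "\<not> i < f v"
      obtain B z where B: "B \<in> F" "i \<in> B" "f i \<notin> B" "\<forall>y\<in>B. y < f i \<longrightarrow> y = i" "z \<in> B" "f i < z"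
        using right i by blast
      obtain D y where D: "D \<in> F" "v \<in> D" "f v \<notin> D" "\<forall>z\<in>D. f v < z \<longrightarrow> z = v" "y \<in> D" "y < f v"
        using left v by blast
      have "i \<notin> D"
      proof
        assume "i \<in> D"
        with D(3) n have "f v < i" by (metis linorder_neqE_nat)
        with D(4) \<open>i \<in> D\<close> v(2) show False by auto
      qed
      moreover have "y \<notin> B"
      proof
        assume "y \<in> B"
        moreover have "y < f i" "y \<noteq> i" using D(6) n i by linarith+
        ultimately show False using B(4) by blast
      qed
      moreover have "v \<notin> B"
      proof
        assume "v \<in> B"
        with B(3) v have "v < f i" by (metis le_neq_implies_less)
        with B(4) \<open>v \<in> B\<close> v(2) show False by auto
      qed
      moreover have "z \<notin> D"
      proof
        assume "z \<in> D"
        moreover have "f v < z" "z \<noteq> v" using B(6) v by linarith+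
        ultimately show False using D(4) by blast
      qed
      ultimately show False
        using noncrossingD[OF nc[OF D(1) B(1)], of y v i z] B D n v crosses_alternating[of y i v z] by auto
    qed
    \<comment> \<open>A nonempty \<open>f\<close>-closed set \<open>K\<close> of least size is
      permuted by \<open>f\<close>. If \<open>i\<close> is the preimage of its maximum, then by
      \<open>trap\<close> the elements of \<open>K\<close> above \<open>i\<close> are closed as
      well, and there are fewer of them.\<close>
    define cl where "cl = (\<lambda>K. K \<subseteq> X \<and> K \<noteq> {} \<and> f ` K \<subseteq> K)"
    have "cl X" using ne f(1) unfolding cl_def by auto
    then obtain K where K: "cl K" and mn: "\<And>L. cl L \<Longrightarrow> card K \<le> card L"
      using ex_has_least_nat[of cl X card] by blast
    have finK: "finite K" using K fin unfolding cl_def by (meson finite_subset)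
    have "cl (f ` K)" using K unfolding cl_def by auto
    then have "card K \<le> card (f ` K)" by (rule mn)
    then have fK: "f ` K = K" using K finK unfolding cl_def by (simp add: card_seteq)
    define M where "M = Max K"
    have M: "M \<in> K" "\<And>v. v \<in> K \<Longrightarrow> v \<le> M" using finK K unfolding cl_def M_def by auto
    obtain i where i: "i \<in> K" "f i = M" using M(1) fK by (metis imageE)
    have iX: "i \<in> X" using i K unfolding cl_def by blast
    have iM: "i < M" using M(2)[OF i(1)] f(2)[OF iX] i(2) by linarith
    have "cl {v \<in> K. i < v}"
      unfolding cl_def
    proof (intro conjI)
      show "{v \<in> K. i < v} \<subseteq> X" using K unfolding cl_def by blast
      show "{v \<in> K. i < v} \<noteq> {}" using M(1) iM by blast
      show "f ` {v \<in> K. i < v} \<subseteq> {v \<in> K. i < v}"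
      proof
        fix w assume "w \<in> f ` {v \<in> K. i < v}"
        then obtain v where v: "w = f v" "v \<in> K" "i < v" by blast
        have "v \<in> X" using v K unfolding cl_def by blast
        have "f v \<in> K" using v fK by blast
        moreover have "i < f v"
        proof (cases "f v < v")
          case True
          then show ?thesis using trap[OF iX, of v] \<open>v \<in> X\<close> v M(2)[OF v(2)] iM i(2) by simp
        next
          case False
          then show ?thesis using v by linarith
        qed
        ultimately show "w \<in> {v \<in> K. i < v}" using v by blast
      qed
    qed
    then have "card K \<le> card {v \<in> K. i < v}" by (rule mn)
    moreover have "{v \<in> K. i < v} \<subset> K" using i by blast
    ultimately show False using finK psubset_card_mono by (metis not_less)
  qed
qed

text \<open>\<open>unblocked_point\<close> finds a point somewhere in \<open>X\<close>; here it has
  to lie in \<open>V0\<close>. The sets indexed by \<open>U0\<close> are seeds inside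
  \<open>V0\<close>. Their union is enlarged by parts of the sets through \<open>a\<close> or
  \<open>b\<close>, and \<open>small\<close> marks those indices for which the enlargement stays in
  \<open>V0\<close>; the \<open>base\<close> hypotheses provide smallness at the seeds, and
  \<open>small_up\<close> and \<open>small_down\<close> pass it on. The family is indexed because
  smallness is not a property of the set \<open>K i\<close> alone.\<close>

locale protected_family =
  fixes X :: "nat set" and a b :: nat and F :: "'i set" and K :: "'i \<Rightarrow> nat set"
    and U0 :: "'i set" and V0 :: "nat set" and small :: "'i \<Rightarrow> bool"
  assumes finX: "finite X" and Xab: "X \<subseteq> {a<..<b}" and V0X: "V0 \<subseteq> X"
    and KX: "i \<in> F \<Longrightarrow> K i \<subseteq> insert a (insert b X)"
    and nc: "i \<in> F \<Longrightarrow> j \<in> F \<Longrightarrow> noncrossing (K i) (K j)"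
    and nab: "i \<in> F \<Longrightarrow> \<not> (a \<in> K i \<and> b \<in> K i)"
    and U0F: "U0 \<subseteq> F" and U0ne: "U0 \<noteq> {}"
    and U0: "i \<in> U0 \<Longrightarrow> K i \<noteq> {} \<and> a \<notin> K i \<and> b \<notin> K i \<and> K i \<subseteq> V0"
    and U0step: "\<lbrakk>i \<in> U0; e \<in> F; a \<notin> K e; b \<notin> K e; e1 \<in> K e; e1 \<notin> K i; e2 \<in> K e; e2 \<notin> K i;
      q \<in> K i; q \<notin> K e; e1 < q; q < e2\<rbrakk> \<Longrightarrow> e \<in> U0"
    and base_up: "\<lbrakk>d \<in> F; a \<in> K d; i \<in> U0; q \<in> K i; q \<notin> K d; z \<in> K d; z \<notin> K i; q < z\<rbrakk> \<Longrightarrow> small d"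
    and base_down: "\<lbrakk>d \<in> F; b \<in> K d; i \<in> U0; q \<in> K i; q \<notin> K d; z \<in> K d; z \<notin> K i; z < q\<rbrakk> \<Longrightarrow> small d"
    and small_up: "\<lbrakk>d \<in> F; d' \<in> F; a \<in> K d; a \<in> K d'; p \<in> K d; p \<notin> K d'; q \<in> K d'; q \<notin> K d;
      z \<in> K d; z \<notin> K d'; p < q; q < z; small d'\<rbrakk> \<Longrightarrow> small d"
    and small_down: "\<lbrakk>d \<in> F; d' \<in> F; b \<in> K d; b \<in> K d'; p \<in> K d; p \<notin> K d'; q \<in> K d'; q \<notin> K d;
      z \<in> K d; z \<notin> K d'; q < p; z < q; small d'\<rbrakk> \<Longrightarrow> small d"
    and V0_up: "\<lbrakk>d \<in> F; a \<in> K d; small d; q \<in> V0; q \<notin> K d; z \<in> K d; q < z\<rbrakk> \<Longrightarrow> z \<in> V0"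
    and V0_down: "\<lbrakk>d \<in> F; b \<in> K d; small d; q \<in> V0; q \<notin> K d; z \<in> K d; z < q\<rbrakk> \<Longrightarrow> z \<in> V0"
begin

lemma V0_bounds: "q \<in> V0 \<Longrightarrow> a < q \<and> q < b"
  using V0X Xab by (meson greaterThanLessThan_iff subsetD)

lemma K_bounds: "i \<in> F \<Longrightarrow> x \<in> K i \<Longrightarrow> x = a \<or> x = b \<or> a < x \<and> x < b"
  using KX Xab by (meson greaterThanLessThan_iff insertE subsetD)

text \<open>No element of the limit may lie between two elements of a \<open>K e\<close> outside the
  limit without being in \<open>K e\<close>. The closure enforces this for the sets through
  \<open>a\<close> or \<open>b\<close>; for the remaining ones it has to be proved.\<close>

primrec V :: "nat \<Rightarrow> nat set" where
  "V 0 = (\<Union>i\<in>U0. K i)"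
| "V (Suc l) = V l \<union> {z. \<exists>q\<in>V l. \<exists>d\<in>F. q \<notin> K d \<and> z \<in> K d \<and> (a \<in> K d \<and> q < z \<or> b \<in> K d \<and> z < q)}"

lemma V_SucI: "\<lbrakk>q \<in> V l; d \<in> F; q \<notin> K d; z \<in> K d; a \<in> K d \<and> q < z \<or> b \<in> K d \<and> z < q\<rbrakk> \<Longrightarrow> z \<in> V (Suc l)"
  by auto

lemma V_SucE:
  assumes "q \<in> V (Suc l)" "q \<notin> V l"
  obtains (up) p d where "p \<in> V l" "d \<in> F" "p \<notin> K d" "q \<in> K d" "a \<in> K d" "p < q"
  | (down) p d where "p \<in> V l" "d \<in> F" "p \<notin> K d" "q \<in> K d" "b \<in> K d" "q < p"
  using assms by auto

text \<open>The claims support each other: a set that still adds points is small, so the next stage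
  remains in \<open>V0\<close>; and a set that adds points after the next stage inherits smallness
  from the set that brought in its starting point \<open>q\<close>.\<close>

lemma V_invariant:
  "V l \<subseteq> V0 \<and>
   (\<forall>q d z. q \<in> V l \<longrightarrow> d \<in> F \<longrightarrow> a \<in> K d \<longrightarrow> q \<notin> K d \<longrightarrow> z \<in> K d \<longrightarrow> q < z \<longrightarrow> z \<notin> V l \<longrightarrow> small d) \<and>
   (\<forall>q d z. q \<in> V l \<longrightarrow> d \<in> F \<longrightarrow> b \<in> K d \<longrightarrow> q \<notin> K d \<longrightarrow> z \<in> K d \<longrightarrow> z < q \<longrightarrow> z \<notin> V l \<longrightarrow> small d)"
proof (induction l)
  case 0
  have "V 0 \<subseteq> V0" using U0 by auto
  moreover have "small d" if "q \<in> V 0" "d \<in> F" "a \<in> K d" "q \<notin> K d" "z \<in> K d" "q < z" "z \<notin> V 0" for q d z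
    using that base_up by auto
  moreover have "small d" if "q \<in> V 0" "d \<in> F" "b \<in> K d" "q \<notin> K d" "z \<in> K d" "z < q" "z \<notin> V 0" for q d z
    using that base_down by auto
  ultimately show ?case by blast
next
  case (Suc l)
  then have sub: "V l \<subseteq> V0" 
    and up: "\<And>q d z. q \<in> V l \<Longrightarrow> d \<in> F \<Longrightarrow> a \<in> K d \<Longrightarrow> q \<notin> K d \<Longrightarrow> z \<in> K d \<Longrightarrow> q < z \<Longrightarrow> z \<notin> V l \<Longrightarrow> small d"
    and down: "\<And>q d z. q \<in> V l \<Longrightarrow> d \<in> F \<Longrightarrow> b \<in> K d \<Longrightarrow> q \<notin> K d \<Longrightarrow> z \<in> K d \<Longrightarrow> z < q \<Longrightarrow> z \<notin> V l \<Longrightarrow> small d"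
    by blast+
  have sub': "V (Suc l) \<subseteq> V0"
  proof
    fix q assume q: "q \<in> V (Suc l)"
    show "q \<in> V0"
    proof (cases "q \<in> V l")
      case True then show ?thesis using sub by blast
    next
      case False
      with q show ?thesis
      proof (cases rule: V_SucE)
        case (up p d)
        then show ?thesis using V0_up[of d p q] Suc.IH False sub by blast
      next
        case (down p d)
        then show ?thesis using V0_down[of d p q] Suc.IH False sub by blast
      qed
    qed
  qed
  have abX: "a < q \<and> q < b" if "q \<in> V (Suc l)" for q using V0_bounds[of q] sub' that by blast
  have "small d" if h: "q \<in> V (Suc l)" "d \<in> F" "a \<in> K d" "q \<notin> K d" "z \<in> K d" "q < z" "z \<notin> V (Suc l)" for q d z
  proof -
    have "q \<notin> V l" using h V_SucI[of q l d z] by blast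
    have nb: "b \<notin> K d" using h nab by blast
    have zb: "z < b" using K_bounds[OF h(2,5)] h(5) nb abX[OF h(1)] h(6) by auto
    from h(1) \<open>q \<notin> V l\<close> show ?thesis
    proof (cases rule: V_SucE)
      case (up p d')
      have "p \<in> K d" using V_SucI[of p l d z] up h less_trans[of p q z] by blast
      moreover have "z \<notin> K d'" using V_SucI[of p l d' z] up h less_trans[of p q z] by blast
      moreover have "small d'" using Suc.IH up \<open>q \<notin> V l\<close> by blast
      ultimately show ?thesis using small_up[of d d' p q z] up h by blast
    next
      \<comment> \<open>The direction cannot change: if \<open>q\<close> came in through a set with
        \<open>b\<close>, an extension by a set with \<open>a\<close> makes the two sets cross at
        \<open>a < q < p < b\<close>.\<close>
      case (down p d')
      have na: "a \<notin> K d'" using down nab by blast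
      have aq: "a < q" and pb: "p < b" using abX[OF h(1)] abX[of p] down by auto
      have "z \<in> K d'"
      proof (rule ccontr)
        assume "z \<notin> K d'"
        then show False
          using noncrossingD[OF nc[OF h(2) \<open>d' \<in> F\<close>], of a z q b] h na nb down aq zb
            crosses_alternating[of a q z b] by blast
      qed
      moreover have "p \<in> K d"
      proof (rule ccontr)
        assume p: "p \<notin> K d"
        show False
        proof (cases "z < p")
          case True
          then show False using V_SucI[of p l d' z] down h \<open>z \<in> K d'\<close> by blast
        next
          case False
          then have "p < z" using \<open>z \<in> K d'\<close> down by (metis linorder_neqE_nat)
          then show False using V_SucI[of p l d z] down h p by blast
        qed
      qed
      ultimately have False
        using noncrossingD[OF nc[OF h(2) \<open>d' \<in> F\<close>], of a p q b] h na nb down aq pb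
            crosses_alternating[of a q p b] by blast
      then show ?thesis ..
    qed
  qed
  moreover have "small d" if h: "q \<in> V (Suc l)" "d \<in> F" "b \<in> K d" "q \<notin> K d" "z \<in> K d" "z < q" "z \<notin> V (Suc l)" for q d z
  proof -
    have "q \<notin> V l" using h V_SucI[of q l d z] by blast
    have na: "a \<notin> K d" using h nab by blast
    have az: "a < z" using K_bounds[OF h(2,5)] h(5) na abX[OF h(1)] h(6) by auto
    from h(1) \<open>q \<notin> V l\<close> show ?thesis
    proof (cases rule: V_SucE)
      case (down p d')
      have "p \<in> K d" using V_SucI[of p l d z] down h less_trans[of z q p] by blast
      moreover have "z \<notin> K d'" using V_SucI[of p l d' z] down h less_trans[of z q p] by blast
      moreover have "small d'" using Suc.IH down \<open>q \<notin> V l\<close> by blast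
      ultimately show ?thesis using small_down[of d d' p q z] down h by blast
    next
      case (up p d')
      have nb: "b \<notin> K d'" using up nab by blast
      have qb: "q < b" and ap: "a < p" using abX[OF h(1)] abX[of p] up by auto
      have "z \<in> K d'"
      proof (rule ccontr)
        assume "z \<notin> K d'"
        then show False
          using noncrossingD[OF nc[OF \<open>d' \<in> F\<close> h(2)], of a q z b] h na nb up qb az
            crosses_alternating[of a z q b] by blast
      qed
      moreover have "p \<in> K d"
      proof (rule ccontr)
        assume p: "p \<notin> K d"
        show False
        proof (cases "p < z")
          case True
          then show False using V_SucI[of p l d' z] up h \<open>z \<in> K d'\<close> by blast
        next
          case False
          then have "z < p" using \<open>z \<in> K d'\<close> up by (metis linorder_neqE_nat)
          then show False using V_SucI[of p l d z] up h p by blast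
        qed
      qed
      ultimately have False
        using noncrossingD[OF nc[OF \<open>d' \<in> F\<close> h(2)], of a q p b] h na nb up qb ap
            crosses_alternating[of a p q b] by blast
      then show ?thesis ..
    qed
  qed
  ultimately show ?case using sub' by blast
qed

definition VV :: "nat set" where "VV = (\<Union>l. V l)"

lemma VV_up: "\<lbrakk>q \<in> VV; d \<in> F; q \<notin> K d; z \<in> K d; a \<in> K d; q < z\<rbrakk> \<Longrightarrow> z \<in> VV"
  unfolding VV_def using V_SucI by blast

lemma VV_down: "\<lbrakk>q \<in> VV; d \<in> F; q \<notin> K d; z \<in> K d; b \<in> K d; z < q\<rbrakk> \<Longrightarrow> z \<in> VV"
  unfolding VV_def using V_SucI by blast

lemma VV_sub: "VV \<subseteq> V0" unfolding VV_def using V_invariant by blast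

text \<open>Trace \<open>q\<close> back to the point \<open>p\<close> and the set \<open>K d\<close>
  that introduced it. If \<open>p\<close> is not in \<open>K e\<close>, then \<open>p\<close> is an
  earlier counterexample; if it is, then \<open>K d\<close> and \<open>K e\<close> cross. At stage
  0, \<open>U0step\<close> makes \<open>e\<close> a seed, so \<open>K e\<close> is contained in the
  limit.\<close>

lemma VV_inner:
  "\<lbrakk>q \<in> V l; e \<in> F; a \<notin> K e; b \<notin> K e; q \<notin> K e; e1 \<in> K e; e2 \<in> K e; e1 \<notin> VV; e2 \<notin> VV; e1 < q; q < e2\<rbrakk> \<Longrightarrow> False"
proof (induction l arbitrary: q)
  case 0
  then obtain i where i: "i \<in> U0" "q \<in> K i" by auto
  have V0: "j \<in> U0 \<Longrightarrow> K j \<subseteq> VV" for j unfolding VV_def using V.simps(1) by blast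
  have "e \<in> U0" using U0step[of i e e1 e2 q] i 0 V0[OF i(1)] by blast
  then show ?case using V0 0 by blast
next
  case (Suc l)
  show ?case
  proof (cases "q \<in> V l")
    case True then show ?thesis using Suc by blast
  next
    case False
    have q: "q \<in> VV" using Suc.prems(1) unfolding VV_def by blast
    have "a < q \<and> q < b" using q VV_sub V0_bounds by blast
    then have e12: "a < e1" "e2 < b"
      using K_bounds[OF Suc.prems(2,6)] K_bounds[OF Suc.prems(2,7)] Suc.prems by auto
    from Suc.prems(1) False show ?thesis
    proof (cases rule: V_SucE)
      case (up p d)
      have p: "p \<in> VV" using up unfolding VV_def by blast
      have pX: "a < p" using p VV_sub V0_bounds by blast
      have e2: "e2 \<notin> K d" using VV_up[OF p, of d e2] up Suc.prems less_trans[of p q e2] by blast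
      have e1: "e1 \<in> K d"
      proof (rule ccontr)
        assume "e1 \<notin> K d"
        then show False
          using noncrossingD[OF nc[OF \<open>d \<in> F\<close> \<open>e \<in> F\<close>], of a q e1 e2] e2 up Suc.prems e12
            crosses_alternating[of a e1 q e2] by blast
      qed
      then have "e1 < p" using VV_up[OF p, of d e1] up Suc.prems by (metis linorder_neqE_nat)
      show ?thesis
      proof (cases "p \<in> K e")
        case True
        then show False
          using noncrossingD[OF nc[OF \<open>d \<in> F\<close> \<open>e \<in> F\<close>], of a q p e2] e2 up Suc.prems pX
            crosses_alternating[of a p q e2] by blast
      next
        case False
        then show False using Suc.IH[of p] up Suc.prems \<open>e1 < p\<close> less_trans[of p q e2] by blast
      qed
    next
      case (down p d)
      have p: "p \<in> VV" using down unfolding VV_def by blast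
      have pX: "p < b" using p VV_sub V0_bounds by blast
      have e1: "e1 \<notin> K d" using VV_down[OF p, of d e1] down Suc.prems less_trans[of e1 q p] by blast
      have e2: "e2 \<in> K d"
      proof (rule ccontr)
        assume "e2 \<notin> K d"
        then show False
          using noncrossingD[OF nc[OF \<open>e \<in> F\<close> \<open>d \<in> F\<close>], of e1 e2 q b] e1 down Suc.prems e12
            crosses_alternating[of e1 q e2 b] by blast
      qed
      then have "p < e2" using VV_down[OF p, of d e2] down Suc.prems by (metis linorder_neqE_nat)
      show ?thesis
      proof (cases "p \<in> K e")
        case True
        then show False
          using noncrossingD[OF nc[OF \<open>e \<in> F\<close> \<open>d \<in> F\<close>], of e1 p q b] e1 down Suc.prems pX
            crosses_alternating[of e1 q p b] by blast
      next
        case False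
        then show False using Suc.IH[of p] down Suc.prems \<open>p < e2\<close> less_trans[of e1 q p] by blast
      qed
    qed
  qed
qed

text \<open>Enlarge the family by \<open>insert a VV\<close> and \<open>insert b VV\<close>, which
  cross nothing. A point outside \<open>VV\<close> has an element of \<open>VV\<close> on one side,
  so one of these two sets blocks it; the unblocked point therefore lies in
  \<open>VV\<close>.\<close>

lemma protected_point: "\<exists>c\<in>V0. \<forall>i\<in>F. \<not> blocks (K i) c"
proof -
  have VVX: "a < q" "q < b" "q \<in> X" if "q \<in> VV" for q using that VV_sub V0X V0_bounds by blast+
  have ab: "a < b" using U0 U0ne V0_bounds by (metis all_not_in_conv order.strict_trans subsetD)
  have VVne: "VV \<noteq> {}"
  proof -
    have "V 0 \<subseteq> VV" unfolding VV_def by blast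
    moreover have "V 0 \<noteq> {}" using U0 U0ne by auto
    ultimately show ?thesis by blast
  qed
  have inner: False if h: "e \<in> F" "q \<in> VV" "q \<notin> K e" "e1 \<in> K e" "e2 \<in> K e" "e1 \<notin> VV" "e2 \<notin> VV" "e1 < q" "q < e2" for q e e1 e2
  proof -
    obtain l where l: "q \<in> V l" using h unfolding VV_def by blast
    show False
      using VV_up[of q e e2] VV_down[of q e e1] VV_inner[OF l, of e e1 e2] h by blast
  qed
  have ncV: "noncrossing (insert w VV) (K e)" if e: "e \<in> F" and w: "w = a \<or> w = b" for e w
  proof (rule noncrossingI)
    fix x y m m' assume d: "x \<in> insert w VV" "x \<notin> K e" "y \<in> insert w VV" "y \<notin> K e" "m \<in> K e" "m \<notin> insert w VV"
      "m' \<in> K e" "m' \<notin> insert w VV" and l: "m < m'" and c: "crosses x y m m'"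
    have "x \<noteq> m" "x \<noteq> m'" "y \<noteq> m" "y \<noteq> m'" using d by auto
    then have or: "(m < x \<and> x < m') \<or> (m < y \<and> y < m')"
      using c l unfolding crosses_def by linarith
    have mab: "a \<le> m" "m' \<le> b" using K_bounds[OF e d(5)] K_bounds[OF e d(7)] ab by auto
    show False
    proof (cases "m < x \<and> x < m'")
      case True
      then have "x \<in> VV" using d w mab by auto
      then show False using inner[of e x m m'] e d True by blast
    next
      case False
      then have y: "m < y \<and> y < m'" using or by blast
      then have "y \<in> VV" using d w mab by auto
      then show False using inner[of e y m m'] e d y by blast
    qed
  qed
  define F' where "F' = insert (insert a VV) (insert (insert b VV) (K ` F))"
  have "\<exists>c\<in>X. \<forall>L\<in>F'. \<not> blocks L c"
  proof (rule unblocked_point[OF finX _ Xab])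
    show "X \<noteq> {}" using VVX VVne by blast
  next
    fix L assume "L \<in> F'"
    then show "L \<subseteq> insert a (insert b X)" using KX VVX unfolding F'_def by blast
  next
    fix L M assume "L \<in> F'" "M \<in> F'"
    moreover have "noncrossing (insert w VV) (insert w' VV)" for w w'
      unfolding noncrossing_def crosses_def by auto
    ultimately show "noncrossing L M" using ncV nc noncrossing_sym unfolding F'_def by blast
  next
    fix L assume "L \<in> F'"
    moreover have "a \<noteq> b" using ab by simp
    moreover have "a \<notin> VV" "b \<notin> VV" using VVX by blast+
    ultimately show "\<not> (a \<in> L \<and> b \<in> L)" using nab unfolding F'_def by blast
  qed
  then obtain c where c: "c \<in> X" "\<And>L. L \<in> F' \<Longrightarrow> \<not> blocks L c" by blast
  have "c \<in> VV"
  proof (rule ccontr)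
    assume n: "c \<notin> VV"
    obtain v where v: "v \<in> VV" using VVne by blast
    have cab: "a < c" "c < b" using c Xab by auto
    have "c \<noteq> v" using n v by blast
    then consider "v < c" | "c < v" by linarith
    then show False
    proof cases
      case 1
      then have "blocks (insert b VV) c" unfolding blocks_def using n v cab by blast
      then show False using c unfolding F'_def by blast
    next
      case 2
      then have "blocks (insert a VV) c" unfolding blocks_def using n v cab by blast
      then show False using c unfolding F'_def by blast
    qed
  qed
  then show ?thesis using VV_sub c unfolding F'_def by blast
qed

end

section \<open>Triangles on an edge\<close>

text \<open>For a fixed chord \<open>x y\<close>, crossing says that \<open>m\<close> and
  \<open>m'\<close> lie on different sides of it, and \<open>q\<close> lies on one of the
  sides.\<close>

lemma crosses_split: "crosses x y m m' \<Longrightarrow> crosses x y q m \<or> crosses x y q m'"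
  unfolding crosses_def by (cases "q < x"; cases "q < y"; cases "m < x"; cases "m < y"; simp)

lemma crosses_cases:
  assumes "x \<noteq> m" "x \<noteq> m'" "y \<noteq> m" "y \<noteq> m'" "m < m'" "crosses x y m m'"
  shows "(x < m \<and> m < y \<and> y < m') \<or> (y < m \<and> m < x \<and> x < m') \<or>
    (m < x \<and> x < m' \<and> m' < y) \<or> (m < y \<and> y < m' \<and> m' < x)"
proof -
  have "x < m \<or> (m < x \<and> x < m') \<or> m' < x" "y < m \<or> (m < y \<and> y < m') \<or> m' < y"
    using assms(1-4) by linarith+
  then show ?thesis using assms(5,6) unfolding crosses_def by (elim disjE) auto
qed

text \<open>The family is one level of a tiling, with \<open>insert a S\<close> and
  \<open>insert b S\<close> as an edge. The third vertex of a white triangle on it has the form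
  \<open>insert c S\<close>, that of a black triangle the form
  \<open>insert a (insert b S) - {q}\<close>.\<close>

locale edge_family =
  fixes C :: "nat set set" and S :: "nat set" and a b :: nat
  assumes ab: "a < b" and aS: "a \<notin> S" and bS: "b \<notin> S" and finS: "finite S"
    and finC: "B \<in> C \<Longrightarrow> finite B" and cardC: "B \<in> C \<Longrightarrow> card B = Suc (card S)"
    and ncC: "B \<in> C \<Longrightarrow> D \<in> C \<Longrightarrow> noncrossing B D"
    and SaC: "insert a S \<in> C" and SbC: "insert b S \<in> C"
begin

lemma card_outer: "B \<in> C \<Longrightarrow> card (B - S) = Suc (card (S - B))"
  using card_Diff_swap[of B S] finS finC cardC by fastforce

lemma card_outer_mono: "B \<in> C \<Longrightarrow> D \<in> C \<Longrightarrow> S - B \<subseteq> S - D \<Longrightarrow> card (B - S) \<le> card (D - S)"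
  using card_outer card_mono[of "S - D" "S - B"] finS by simp

lemma nca: "\<lbrakk>B \<in> C; x \<in> insert a S; x \<notin> B; y \<in> insert a S; y \<notin> B; m \<in> B; m \<notin> S; m \<noteq> a; m' \<in> B; m' \<notin> S; m' \<noteq> a;
    crosses x y m m'\<rbrakk> \<Longrightarrow> False"
  using noncrossingD[OF ncC[OF SaC], of B x y m m'] by blast

lemma ncb: "\<lbrakk>B \<in> C; x \<in> insert b S; x \<notin> B; y \<in> insert b S; y \<notin> B; m \<in> B; m \<notin> S; m \<noteq> b; m' \<in> B; m' \<notin> S; m' \<noteq> b;
    crosses x y m m'\<rbrakk> \<Longrightarrow> False"
  using noncrossingD[OF ncC[OF SbC], of B x y m m'] by blast

text \<open>The ends of the edge allow no crossing chord other than \<open>a b\<close>. If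
  \<open>a b\<close> crosses \<open>x y\<close>, then by size \<open>B\<close> has a third element
  \<open>q\<close> outside \<open>S\<close>, and \<open>x y\<close> is also crossed by
  \<open>q a\<close> or \<open>q b\<close>, which one end of the edge forbids.\<close>

lemma not_crosses_base:
  assumes B: "B \<in> C" and x: "x \<in> S" "x \<notin> B" and y: "y \<in> S" "y \<notin> B"
    and m: "m \<in> B" "m \<notin> S" and m': "m' \<in> B" "m' \<notin> S"
  shows "\<not> crosses x y m m'"
proof
  assume c: "crosses x y m m'"
  have "a = m \<or> a = m'" using nca[of B x y m m'] assms c by blast
  moreover have "b = m \<or> b = m'" using ncb[of B x y m m'] assms c by blast
  ultimately have ab': "(m = a \<and> m' = b) \<or> (m = b \<and> m' = a)" using ab by auto
  have "x \<noteq> y" using c unfolding crosses_def by auto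
  then have "card {x, y} = 2" by simp
  moreover have "card {x, y} \<le> card (S - B)" using x y finS by (intro card_mono) auto
  ultimately have "3 \<le> card (B - S)" using card_outer[OF B] by linarith
  moreover have "card (B - S) \<le> 2" if "B - S \<subseteq> {a, b}"
    using card_mono[OF _ that] ab by simp
  ultimately have "\<not> B - S \<subseteq> {a, b}" by fastforce
  then obtain q where q: "q \<in> B" "q \<notin> S" "q \<noteq> a" "q \<noteq> b" by blast
  have "crosses x y q a \<or> crosses x y q b" using crosses_split[OF c, of q] ab' by blast
  moreover have "a \<in> B" "b \<in> B" "a \<noteq> b" using ab' m m' ab by auto
  ultimately show False
    using nca[of B x y q b] ncb[of B x y q a] B x y q aS bS by blast
qed

section \<open>Pieces of the members of the family\<close>

definition conn :: "nat set \<Rightarrow> nat \<Rightarrow> nat \<Rightarrow> bool" where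
  "conn B x y \<longleftrightarrow> (\<forall>p\<in>S - B. (p < x) = (p < y))"

lemma not_connE:
  assumes "\<not> conn B x y" "x \<in> B" "y \<in> B" "x < y"
  obtains p where "p \<in> S" "p \<notin> B" "x < p" "p < y"
proof -
  obtain p where p: "p \<in> S" "p \<notin> B" "(p < x) \<noteq> (p < y)" using assms(1) unfolding conn_def by blast
  then have "p \<noteq> x" "p \<noteq> y" using assms by auto
  then have "x < p" "p < y" using p(3) assms(4) by linarith+
  then show ?thesis using that p by blast
qed

lemma connD: "conn B x y \<Longrightarrow> p \<in> S \<Longrightarrow> p \<notin> B \<Longrightarrow> x < p \<Longrightarrow> p < y \<Longrightarrow> False"
  unfolding conn_def by (metis DiffI order_less_asym)

text \<open>A piece of \<open>B\<close> is a set of consecutive elements of \<open>B - S\<close> in \<open>{a..b}\<close>, cut off by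
  the elements of \<open>S - B\<close>. The pieces of \<open>B\<close> determine which sets \<open>insert c S\<close> are crossed by \<open>B\<close>, and
  pieces of different sets do not cross on the line.\<close>

definition piece :: "nat set \<Rightarrow> nat set \<Rightarrow> bool" where
  "piece B K \<longleftrightarrow> B \<in> C \<and> K \<noteq> {} \<and>
     (\<forall>x\<in>K. K = {y. y \<in> B \<and> y \<notin> S \<and> a \<le> y \<and> y \<le> b \<and> conn B x y})"

lemma piece_sub: "piece B K \<Longrightarrow> x \<in> K \<Longrightarrow> x \<in> B \<and> x \<notin> S \<and> a \<le> x \<and> x \<le> b"
  unfolding piece_def by blast

lemma piece_conn: "piece B K \<Longrightarrow> x \<in> K \<Longrightarrow> y \<in> K \<Longrightarrow> conn B x y"
  unfolding piece_def by blast

lemma piece_in: "piece B K \<Longrightarrow> x \<in> K \<Longrightarrow> y \<in> B \<Longrightarrow> y \<notin> S \<Longrightarrow> a \<le> y \<Longrightarrow> y \<le> b \<Longrightarrow> conn B x y \<Longrightarrow> y \<in> K"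
  unfolding piece_def by blast

lemma piece_C: "piece B K \<Longrightarrow> B \<in> C" unfolding piece_def by blast

lemma piece_between:
  assumes K: "piece B K" and x: "x \<in> K" and z: "z \<in> K" and y: "x < y" "y < z" "y \<in> B" "y \<notin> S"
  shows "y \<in> K"
proof (rule piece_in[OF K x y(3,4)])
  show "a \<le> y" "y \<le> b" using piece_sub[OF K x] piece_sub[OF K z] y by linarith+
  have "(p < x) = (p < y)" if "p \<in> S - B" for p
  proof -
    have "(p < x) = (p < z)" using piece_conn[OF K x z] that unfolding conn_def by blast
    then show ?thesis using y by linarith
  qed
  then show "conn B x y" unfolding conn_def by blast
qed

lemma piece_of:
  assumes "B \<in> C" "y \<in> B" "y \<notin> S" "a \<le> y" "y \<le> b"
  shows "piece B {z. z \<in> B \<and> z \<notin> S \<and> a \<le> z \<and> z \<le> b \<and> conn B y z}"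
  using assms unfolding piece_def conn_def by auto

lemma piece_sep:
  assumes K: "piece B K" and x: "x \<in> K" and y: "y \<in> B" "y \<notin> S" "a \<le> y" "y \<le> b" "y \<notin> K"
  shows "x < y \<Longrightarrow> \<exists>p. p \<in> S \<and> p \<notin> B \<and> x < p \<and> p < y" "y < x \<Longrightarrow> \<exists>p. p \<in> S \<and> p \<notin> B \<and> y < p \<and> p < x"
proof -
  have n: "\<not> conn B x y" using piece_in[OF K x y(1-4)] y(5) by blast
  then have n': "\<not> conn B y x" unfolding conn_def by blast
  have xB: "x \<in> B" using piece_sub[OF K x] by blast
  show "x < y \<Longrightarrow> \<exists>p. p \<in> S \<and> p \<notin> B \<and> x < p \<and> p < y" using not_connE[OF n xB y(1)] by metis
  show "y < x \<Longrightarrow> \<exists>p. p \<in> S \<and> p \<notin> B \<and> y < p \<and> p < x" using not_connE[OF n' y(1) xB] by metis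
qed

text \<open>The inner points \<open>x2, x3\<close> distinguish \<open>B\<close> and \<open>D\<close>
  themselves. An outer point may belong to both sets and only to one of the pieces; then an element
  of \<open>S\<close> that cuts it off from the other piece belongs to one set only and takes its
  place.\<close>

lemma pieces_not_alternating:
  assumes K: "piece B K" and L: "piece D L"
    and x1: "x1 \<in> K" "x1 \<notin> L" and x2: "x2 \<in> L" "x2 \<notin> K" and x3: "x3 \<in> K" "x3 \<notin> L" and x4: "x4 \<in> L" "x4 \<notin> K"
    and l: "x1 < x2" "x2 < x3" "x3 < x4"
  shows False
proof -
  note s1 = piece_sub[OF K x1(1)] and s2 = piece_sub[OF L x2(1)] and s3 = piece_sub[OF K x3(1)] and s4 = piece_sub[OF L x4(1)]
  have nx2: "x2 \<notin> B" using piece_between[OF K x1(1) x3(1) l(1,2)] s2 x2 by blast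
  have nx3: "x3 \<notin> D" using piece_between[OF L x2(1) x4(1) l(2,3)] s3 x3 by blast
  have BD: "noncrossing B D" using ncC piece_C[OF K] piece_C[OF L] by blast
  obtain u where u: "u \<in> B" "u \<notin> D" "u < x2"
  proof (cases "x1 \<in> D")
    case True
    obtain p where p: "p \<in> S" "p \<notin> D" "x1 < p" "p < x2"
      using piece_sep(2)[OF L x2(1) True] s1 x1(2) l by blast
    have "p \<in> B"
      using connD[OF piece_conn[OF K x1(1) x3(1)], of p] p l by auto
    then show ?thesis using that p by blast
  next
    case False then show ?thesis using that s1 l by blast
  qed
  obtain w where w: "w \<in> D" "w \<notin> B" "x3 < w"
  proof (cases "x4 \<in> B")
    case True
    obtain p where p: "p \<in> S" "p \<notin> B" "x3 < p" "p < x4"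
      using piece_sep(1)[OF K x3(1) True] s4 x4(2) l by blast
    have "p \<in> D"
      using connD[OF piece_conn[OF L x2(1) x4(1)], of p] p l by auto
    then show ?thesis using that p by blast
  next
    case False then show ?thesis using that s4 l by blast
  qed
  show False
    using noncrossingD[OF BD, of u x3 x2 w] u w s3 nx3 s2 nx2 l crosses_alternating[of u x2 x3 w] by blast
qed

lemma pieces_noncrossing:
  assumes K: "piece B K" and L: "piece D L"
  shows "noncrossing K L"
proof (rule noncrossingI)
  fix x y m m' assume d: "x \<in> K" "x \<notin> L" "y \<in> K" "y \<notin> L" "m \<in> L" "m \<notin> K" "m' \<in> L" "m' \<notin> K"
      and l: "m < m'" and c: "crosses x y m m'"
  have "x \<noteq> m" "x \<noteq> m'" "y \<noteq> m" "y \<noteq> m'" using d by auto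
  note crosses_cases[OF this l c]
  then show False
    using pieces_not_alternating[OF K L, of x m y m'] pieces_not_alternating[OF K L, of y m x m']
      pieces_not_alternating[OF L K, of m x m' y] pieces_not_alternating[OF L K, of m y m' x] d by blast
qed

text \<open>By \<open>not_crosses_base\<close> the crossing chord is of the form \<open>c p\<close>.
  Moving \<open>c\<close> along the line keeps the crossing until an element of \<open>B - S\<close>
  is passed. Since \<open>c\<close> can reach neither \<open>a\<close> nor \<open>b\<close> in this
  way, nor an element of \<open>S - B\<close>, its nearest neighbours in \<open>B - S\<close> lie in
  \<open>{a..b}\<close> and are not cut off from each other: they belong to one piece, which blocks
  \<open>c\<close>.\<close>

lemma crossing_blocks:
  assumes B: "B \<in> C" and c: "a < c" "c < b" "c \<notin> S" and n: "\<not> noncrossing (insert c S) B"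
  shows "\<exists>K. piece B K \<and> blocks K c"
proof -
  obtain x y m m' where d: "x \<in> insert c S - B" "y \<in> insert c S - B" "m \<in> B - insert c S" "m' \<in> B - insert c S"
    and cr: "crosses x y m m'" using n unfolding noncrossing_def by blast
  have "x = c \<or> y = c" using not_crosses_base[OF B, of x y m m'] d cr by blast
  moreover have "x \<noteq> y" using cr unfolding crosses_def by auto
  moreover have "crosses y x m m'" using cr unfolding crosses_def by auto
  ultimately obtain p where p: "p \<in> S" "p \<notin> B" "c \<notin> B" "crosses c p m m'" using d cr by (metis DiffE insertE)
  define Q where "Q = B - S"
  have m: "m \<in> Q" "m' \<in> Q" using d unfolding Q_def by auto
  have finQ: "finite Q" using finC[OF B] unfolding Q_def by simp
  have cQ: "c \<notin> Q" using p unfolding Q_def by blast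
  have cr_cong: "crosses c p m m' = crosses w p m m'" if "\<forall>q\<in>Q. (q < c) = (q < w)" for w
    using that m unfolding crosses_def by blast
  have "\<exists>y\<in>Q. a \<le> y \<and> y < c"
  proof (rule ccontr)
    assume n: "\<not> ?thesis"
    have "\<forall>q\<in>Q. (q < c) = (q < a)" using n c(1) by (metis linorder_not_le order.strict_trans)
    then have "crosses a p m m'" using cr_cong p by blast
    moreover have "a \<notin> Q" using n c by auto
    then have "a \<notin> B" using aS unfolding Q_def by blast
    ultimately show False using nca[OF B, of a p m m'] p m \<open>a \<notin> Q\<close> unfolding Q_def by blast
  qed
  then have nl: "{y\<in>Q. a \<le> y \<and> y < c} \<noteq> {}" by blast
  have "\<exists>z\<in>Q. c < z \<and> z \<le> b"
  proof (rule ccontr)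
    assume n: "\<not> ?thesis"
    have "\<forall>q\<in>Q. (q < c) = (q < b)" using n c(2) cQ by (metis linorder_neqE_nat linorder_not_le order.strict_trans order.strict_implies_order)
    then have "crosses b p m m'" using cr_cong p by blast
    moreover have "b \<notin> Q" using n c by auto
    then have "b \<notin> B" using bS unfolding Q_def by blast
    ultimately show False using ncb[OF B, of b p m m'] p m \<open>b \<notin> Q\<close> unfolding Q_def by blast
  qed
  then have nr: "{z\<in>Q. c < z \<and> z \<le> b} \<noteq> {}" by blast
  define y where "y = Max {y\<in>Q. a \<le> y \<and> y < c}"
  define z where "z = Min {z\<in>Q. c < z \<and> z \<le> b}"
  have y: "y \<in> Q" "a \<le> y" "y < c" "\<And>q. q \<in> Q \<Longrightarrow> q < c \<Longrightarrow> a \<le> q \<Longrightarrow> q \<le> y"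
    using Max_in[OF _ nl] finQ unfolding y_def by auto
  have z: "z \<in> Q" "z \<le> b" "c < z" "\<And>q. q \<in> Q \<Longrightarrow> c < q \<Longrightarrow> q \<le> b \<Longrightarrow> z \<le> q"
    using Min_in[OF _ nr] finQ unfolding z_def by auto
  have "conn B y z"
  proof (rule ccontr)
    assume "\<not> conn B y z"
    then obtain p' where p': "p' \<in> S" "p' \<notin> B" "y < p'" "p' < z"
      using not_connE[of B y z] y z unfolding Q_def by (metis DiffD1 order.strict_trans)
    have "(q < c) = (q < p')" if "q \<in> Q" for q
    proof -
      have "q \<noteq> p'" "q \<noteq> c" using p' that cQ unfolding Q_def by auto
      moreover have "q < c \<Longrightarrow> q \<le> y" using y(2) y(4)[OF that] by linarith
      moreover have "c < q \<Longrightarrow> z \<le> q" using z(2) z(4)[OF that] by linarith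
      ultimately show ?thesis using p' y z by linarith
    qed
    then have "crosses p' p m m'" using cr_cong p by blast
    then show False using not_crosses_base[OF B, of p' p m m'] p p' m unfolding Q_def by blast
  qed
  moreover have "y \<le> b" "a \<le> z" using y z c by linarith+
  ultimately have "piece B {z. z \<in> B \<and> z \<notin> S \<and> a \<le> z \<and> z \<le> b \<and> conn B y z}"
    "z \<in> {z. z \<in> B \<and> z \<notin> S \<and> a \<le> z \<and> z \<le> b \<and> conn B y z}"
    "y \<in> {z. z \<in> B \<and> z \<notin> S \<and> a \<le> z \<and> z \<le> b \<and> conn B y z}"
    using piece_of[OF B, of y] y z unfolding Q_def conn_def by blast+
  then show ?thesis using p y z unfolding blocks_def by blast
qed

text \<open>Members of \<open>TT\<close> have a piece through both \<open>a\<close> and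
  \<open>b\<close>, which \<open>unblocked_point\<close> does not admit, so the point of a white
  triangle is sought inside all of them. Members of \<open>UU\<close> have this role for black
  triangles: complementation followed by a rotation exchanges the two classes, up to degenerate
  members.\<close>

definition TT :: "nat set set" where
  "TT = {B\<in>C. a \<in> B \<and> b \<in> B \<and> (\<forall>p\<in>S - B. p < a \<or> b < p)}"

definition UU :: "nat set set" where
  "UU = {B\<in>C. B - S \<subseteq> {a<..<b} \<and> S - B \<noteq> {}}"

lemma piece_TT: "piece B K \<Longrightarrow> a \<in> K \<Longrightarrow> b \<in> K \<Longrightarrow> B \<in> TT"
proof -
  assume K: "piece B K" and a: "a \<in> K" and b: "b \<in> K"
  have "p < a \<or> b < p" if p: "p \<in> S - B" for p
  proof -
    have "p \<noteq> a" "p \<noteq> b" using p aS bS by auto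
    then show ?thesis using connD[OF piece_conn[OF K a b], of p] p by force
  qed
  then show ?thesis unfolding TT_def using piece_C[OF K] piece_sub[OF K a] piece_sub[OF K b] by blast
qed

lemma UU_piece:
  assumes "B \<in> UU" shows "piece B (B - S)"
proof -
  have B: "B \<in> C" "B - S \<subseteq> {a<..<b}" using assms unfolding UU_def by auto
  have na: "a \<notin> B" using B aS by auto
  have c: "conn B x y" if "x \<in> B - S" "y \<in> B - S" for x y
    unfolding conn_def
  proof
    fix p assume p: "p \<in> S - B"
    show "(p < x) = (p < y)"
    proof (rule ccontr)
      assume n: "(p < x) \<noteq> (p < y)"
      have "a < x" "a < y" "p \<noteq> x" "p \<noteq> y" using that B p by auto
      then have "crosses a p x y" using n unfolding crosses_def by auto
      then show False using nca[OF B(1), of a p x y] na p that B \<open>a < x\<close> \<open>a < y\<close> by blast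
    qed
  qed
  have "B - S \<noteq> {}" using card_outer[OF B(1)] by (metis card.empty nat.distinct(1))
  then show ?thesis unfolding piece_def using B c by auto
qed

text \<open>If \<open>a\<close> or \<open>b\<close> were in \<open>B\<close>, elements of
  \<open>S\<close> cutting it off from the piece would produce a forbidden crossing. An element
  \<open>q\<close> of \<open>B - S\<close> outside \<open>{a..b}\<close> is excluded too: the chord
  from \<open>q\<close> to a point of the piece separates \<open>a\<close> from \<open>b\<close>, so
  it is crossed by \<open>a p\<close> or \<open>b p\<close> for any \<open>p\<close> in
  \<open>S - B\<close>.\<close>

lemma inner_piece_UU:
  assumes K: "piece B K" "a \<notin> K" "b \<notin> K" and ne: "S - B \<noteq> {}"
  shows "B \<in> UU" "K = B - S"
proof -
  have B: "B \<in> C" using piece_C K by blast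
  obtain x where x: "x \<in> K" using K unfolding piece_def by blast
  have xB: "x \<in> B" "x \<notin> S" "a < x" "x < b"
    using piece_sub[OF K(1) x] K x le_neq_implies_less by blast+
  have na: "a \<notin> B"
  proof
    assume a: "a \<in> B"
    obtain p where p: "p \<in> S" "p \<notin> B" "a < p" "p < x"
      using piece_sep(2)[OF K(1) x a aS] ab K xB by auto
    have b: "b \<in> B"
      using ncb[OF B, of p b a x] p xB a aS crosses_alternating'[of a p x b] by (metis ab insertCI order_less_irrefl)
    obtain p' where p': "p' \<in> S" "p' \<notin> B" "x < p'" "p' < b"
      using piece_sep(1)[OF K(1) x b bS] ab K xB by auto
    show False using not_crosses_base[OF B, of p p' a x] p p' xB a aS crosses_alternating'[of a p x p'] by blast
  qed
  have nb: "b \<notin> B"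
  proof
    assume b: "b \<in> B"
    obtain p' where p': "p' \<in> S" "p' \<notin> B" "x < p'" "p' < b"
      using piece_sep(1)[OF K(1) x b bS] ab K xB by auto
    show False
      using nca[OF B, of a p' x b] p' xB na b bS crosses_alternating[of a x p' b] ab by (metis insertCI order_less_irrefl)
  qed
  obtain p where p: "p \<in> S" "p \<notin> B" using ne by blast
  have "q \<in> {a<..<b}" if q: "q \<in> B - S" for q
  proof (rule ccontr)
    assume "q \<notin> {a<..<b}"
    moreover have "q \<noteq> a" "q \<noteq> b" using na nb q by auto
    ultimately have "q < a \<or> b < q" by auto
    then have "crosses a p x q \<or> crosses b p x q" using xB ab unfolding crosses_def by auto
    then show False
      using nca[OF B, of a p x q] ncb[OF B, of b p x q] p xB na nb q \<open>q \<noteq> a\<close> \<open>q \<noteq> b\<close> by blast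
  qed
  then show U: "B \<in> UU" unfolding UU_def using B ne by blast
  show "K = B - S"
  proof
    show "K \<subseteq> B - S" using piece_sub[OF K(1)] by blast
    have ux: "x \<in> B - S" using xB by blast
    show "B - S \<subseteq> K"
    proof
      fix y assume y: "y \<in> B - S"
      show "y \<in> K" using piece_in[OF K(1) x, of y] piece_conn[OF UU_piece[OF U] ux y] piece_sub[OF UU_piece[OF U] y] y by blast
    qed
  qed
qed

text \<open>Witnesses against both alternatives form a chord \<open>q p\<close> of \<open>U\<close>
  that crosses the chord \<open>a b\<close> of \<open>T\<close>.\<close>

lemma TT_or_UU:
  assumes "T \<in> TT" "U \<in> UU"
  shows "U - S \<subseteq> T \<or> S - T \<subseteq> S - U"
proof (rule ccontr)
  assume "\<not> ?thesis"
  then obtain q p where q: "q \<in> U" "q \<notin> S" "q \<notin> T" and p: "p \<in> S" "p \<notin> T" "p \<in> U" by blast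
  have ab': "a \<in> T" "b \<in> T" "a \<notin> U" "b \<notin> U" "a < q" "q < b" "p < a \<or> b < p" "T \<in> C" "U \<in> C"
    using assms q p aS bS unfolding TT_def UU_def by auto
  then have "crosses q p a b" unfolding crosses_def by auto
  then show False using noncrossingD[OF ncC[of U T], of q p a b] ab' q p by blast
qed

text \<open>An element of \<open>S\<close> that \<open>D\<close> drops but \<open>E\<close> keeps
  lies outside the gap from \<open>y\<close> to \<open>z\<close>, and together with \<open>q\<close>
  it is a chord of \<open>E\<close> across \<open>y z\<close>. This inclusion is what passes
  smallness from one member to another.\<close>

lemma inner_sub:
  assumes "D \<in> C" "E \<in> C" "y \<in> D" "y \<notin> E" "z \<in> D" "z \<notin> E" "q \<in> E" "q \<notin> D" "y < q" "q < z"
    and P: "\<And>p. p \<in> S \<Longrightarrow> p \<notin> D \<Longrightarrow> y < p \<Longrightarrow> p < z \<Longrightarrow> False"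
  shows "S - D \<subseteq> S - E"
proof
  fix p assume p: "p \<in> S - D"
  show "p \<in> S - E"
  proof (rule ccontr)
    assume "p \<notin> S - E"
    with p have pE: "p \<in> E" by blast
    have "p \<noteq> y" "p \<noteq> z" using p assms by auto
    then have "p < y \<or> z < p" using P[of p] p by force
    then have "crosses q p y z" using assms unfolding crosses_def by auto
    then show False using noncrossingD[OF ncC[of E D], of q p y z] assms p pE by blast
  qed
qed

text \<open>The point is sought in the part \<open>V0\<close> of the gap that lies in all members of
  \<open>TT\<close>. If \<open>TT\<close> is empty, this is the whole gap. Otherwise a least member
  \<open>U\<close> of \<open>UU\<close> is smaller than every \<open>T\<close>, so \<open>U\<close>
  cannot drop all that \<open>T\<close> drops, and by \<open>TT_or_UU\<close> its new elements lie
  in \<open>T\<close>. The least members of \<open>UU\<close> are therefore seeds inside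
  \<open>V0\<close>.\<close>

lemma white_triangle:
  assumes h: "(TT = {} \<and> {a<..<b} - S \<noteq> {}) \<or> (\<exists>U\<in>UU. \<forall>T\<in>TT. card (U - S) < card (T - S))"
  shows "\<exists>c. a < c \<and> c < b \<and> c \<notin> S \<and> (\<forall>B\<in>C. noncrossing (insert c S) B)"
proof -
  define X where "X = {a<..<b} - S"
  \<comment> \<open>Each piece is recorded with its set, since smallness depends on what the set
    drops from \<open>S\<close>.\<close>
  define F where "F = {(B, K). piece B K \<and> \<not> (a \<in> K \<and> b \<in> K)}"
  define V0 where "V0 = {x\<in>X. \<forall>T\<in>TT. x \<in> T}"
  have finX: "finite X" and Xab: "X \<subseteq> {a<..<b}" unfolding X_def by auto
  have KX: "snd i \<subseteq> insert a (insert b X)" if "i \<in> F" for i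
  proof
    fix x assume "x \<in> snd i"
    then have "x \<notin> S" "a \<le> x" "x \<le> b" using that piece_sub unfolding F_def by auto
    then show "x \<in> insert a (insert b X)" unfolding X_def by auto
  qed
  have nc: "noncrossing (snd i) (snd j)" if "i \<in> F" "j \<in> F" for i j
    using that pieces_noncrossing unfolding F_def by auto
  have nab: "\<not> (a \<in> snd i \<and> b \<in> snd i)" if "i \<in> F" for i using that unfolding F_def by auto
  \<comment> \<open>The pieces left out of \<open>F\<close> contain both \<open>a\<close> and
    \<open>b\<close>; they belong to members of \<open>TT\<close>, which contain every point of
    \<open>V0\<close>, so they do not block it either.\<close>
  have fin: ?thesis if c: "c \<in> V0" "\<forall>i\<in>F. \<not> blocks (snd i) c" for c
  proof -
    have c': "a < c" "c < b" "c \<notin> S" using c unfolding V0_def X_def by auto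
    have "noncrossing (insert c S) B" if B: "B \<in> C" for B
    proof (rule ccontr)
      assume "\<not> ?thesis"
      then obtain K where K: "piece B K" "blocks K c" using crossing_blocks[OF B c'] by blast
      then have "a \<in> K \<and> b \<in> K" using c(2) unfolding F_def by auto
      moreover from this have "B \<in> TT" using piece_TT K by blast
      then have "c \<in> B" using c(1) unfolding V0_def by blast
      moreover have "c \<notin> K" using K unfolding blocks_def by blast
      ultimately show False using piece_between[OF K(1), of a b c] c' by blast
    qed
    then show ?thesis using c' by blast
  qed
  show ?thesis
  proof (cases "TT = {} \<and> X \<noteq> {}")
    case True
    have "\<exists>c\<in>X. \<forall>K\<in>snd ` F. \<not> blocks K c"
    proof (rule unblocked_point[OF finX _ Xab])
      show "X \<noteq> {}" using True by blast
    next
      fix K assume "K \<in> snd ` F"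
      then obtain i where "i \<in> F" "K = snd i" by blast
      then show "K \<subseteq> insert a (insert b X)" "\<not> (a \<in> K \<and> b \<in> K)" using KX nab by blast+
    next
      fix K L assume "K \<in> snd ` F" "L \<in> snd ` F"
      then obtain i j where "i \<in> F" "K = snd i" "j \<in> F" "L = snd j" by blast
      then show "noncrossing K L" using nc by blast
    qed
    then obtain c where c: "c \<in> X" "\<forall>i\<in>F. \<not> blocks (snd i) c" by blast
    have "c \<in> V0" using c(1) True unfolding V0_def by blast
    then show ?thesis using fin c(2) by blast
  next
    case False
    then obtain U1 where U1: "U1 \<in> UU" "\<forall>T\<in>TT. card (U1 - S) < card (T - S)" using h unfolding X_def by blast
    then obtain Um where Um: "Um \<in> UU" "\<forall>U\<in>UU. card (Um - S) \<le> card (U - S)"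
      using ex_has_least_nat[of "\<lambda>U. U \<in> UU" U1 "\<lambda>U. card (U - S)"] by blast
    define m where "m = card (Um - S)"
    have mT: "m < card (T - S)" if "T \<in> TT" for T using Um(2) U1 that unfolding m_def by fastforce
    define U0 where "U0 = {(B, B - S) | B. B \<in> UU \<and> card (B - S) = m}"
    \<comment> \<open>A small set does not drop everything that some member of \<open>TT\<close>
      drops. This passes to sets that drop less.\<close>
    define small where "small = (\<lambda>i :: nat set \<times> nat set. \<forall>T\<in>TT. \<not> S - T \<subseteq> S - fst i)"
    have UUD: "U \<in> C" "a \<notin> U" "b \<notin> U" if "U \<in> UU" for U using that aS bS unfolding UU_def by auto
    have TC: "T \<in> TT \<Longrightarrow> T \<in> C" for T unfolding TT_def by blast
    have smallU: "small (U, L)" if "U \<in> UU" "card (U - S) = m" for U L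
      unfolding small_def
    proof (intro ballI notI)
      fix T assume T: "T \<in> TT" "S - T \<subseteq> S - fst (U, L)"
      then have "card (T - S) \<le> card (U - S)" using card_outer_mono[OF TC[OF T(1)] UUD(1)[OF that(1)]] by simp
      then show False using mT[OF T(1)] that by simp
    qed
    have subU: "U - S \<subseteq> T" if "U \<in> UU" "card (U - S) = m" "T \<in> TT" for U T
      using smallU[OF that(1,2)] TT_or_UU[OF that(3,1)] that(3) unfolding small_def by auto
    have small_mono: "small (D, L)" if "S - D \<subseteq> S - E" "small (E, L')" for D E L L'
      using that unfolding small_def by auto
    interpret protected_family X a b F snd U0 V0 small
    proof
      show "finite X" "X \<subseteq> {a<..<b}" "V0 \<subseteq> X" using finX Xab unfolding V0_def by auto
      show "snd i \<subseteq> insert a (insert b X)" if "i \<in> F" for i using KX that .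
      show "noncrossing (snd i) (snd j)" if "i \<in> F" "j \<in> F" for i j using nc that .
      show "\<not> (a \<in> snd i \<and> b \<in> snd i)" if "i \<in> F" for i using nab that .
      show "U0 \<subseteq> F" using UU_piece UUD unfolding U0_def F_def by blast
      show "U0 \<noteq> {}" unfolding U0_def m_def using Um by blast
    next
      fix i assume "i \<in> U0"
      then obtain U where U: "i = (U, U - S)" "U \<in> UU" "card (U - S) = m" unfolding U0_def by blast
      have "U - S \<noteq> {}" using UU_piece[OF U(2)] unfolding piece_def by blast
      moreover have "U - S \<subseteq> X" using U(2) unfolding UU_def X_def by blast
      ultimately show "snd i \<noteq> {} \<and> a \<notin> snd i \<and> b \<notin> snd i \<and> snd i \<subseteq> V0"
        using UUD[OF U(2)] subU[OF U(2,3)] unfolding V0_def U(1) snd_conv by blast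
    next
      fix i e e1 e2 q
      assume "i \<in> U0" and e: "e \<in> F" "a \<notin> snd e" "b \<notin> snd e" and
        e1: "e1 \<in> snd e" "e1 \<notin> snd i" and e2: "e2 \<in> snd e" "e2 \<notin> snd i" and q: "q \<in> snd i" "q \<notin> snd e" "e1 < q" "q < e2"
      then obtain U where U: "i = (U, U - S)" "U \<in> UU" "card (U - S) = m" unfolding U0_def by blast
      obtain E L where E: "e = (E, L)" "piece E L" using e unfolding F_def by blast
      have L: "e1 \<in> L" "e2 \<in> L" using E e1 e2 by auto
      note s1 = piece_sub[OF E(2) L(1)] and s2 = piece_sub[OF E(2) L(2)]
      have qE: "q \<notin> E" using piece_between[OF E(2) L q(3,4)] q U E by auto
      have sub: "S - E \<subseteq> S - U"
        using inner_sub[OF piece_C[OF E(2)] UUD(1)[OF U(2)], of e1 e2 q] s1 s2 e1 e2 q U qE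
          connD[OF piece_conn[OF E(2) L]] by auto
      have "S - E \<noteq> {}"
      proof
        assume "S - E = {}"
        then have "card (E - S) = 1" using card_outer[OF piece_C[OF E(2)]] by (simp only: card.empty One_nat_def)
        then obtain w where "E - S = {w}" by (meson card_1_singletonE)
        then have "e1 = w" "e2 = w" using s1 s2 by auto
        then show False using q by simp
      qed
      then have EU: "E \<in> UU" "L = E - S" using inner_piece_UU[OF E(2)] e E by auto
      have "card (E - S) \<le> card (U - S)" using card_outer_mono[OF piece_C[OF E(2)] UUD(1)[OF U(2)] sub] .
      then have "card (E - S) = m" using Um(2) EU U unfolding m_def by fastforce
      then show "e \<in> U0" unfolding U0_def using EU E by blast
    next
      fix d i q z
      assume d: "d \<in> F" "a \<in> snd d" and "i \<in> U0" and q: "q \<in> snd i" "q \<notin> snd d" and z: "z \<in> snd d" "z \<notin> snd i" "q < z"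
      then obtain U where U: "i = (U, U - S)" "U \<in> UU" "card (U - S) = m" unfolding U0_def by blast
      obtain D L where D: "d = (D, L)" "piece D L" using d unfolding F_def by blast
      have L: "a \<in> L" "z \<in> L" using D d z by auto
      note s = piece_sub[OF D(2) L(1)] piece_sub[OF D(2) L(2)]
      have aq: "a < q" using q U unfolding UU_def by auto
      have qD: "q \<notin> D" using piece_between[OF D(2) L aq z(3)] q U D by auto
      have "S - D \<subseteq> S - U"
        using inner_sub[OF piece_C[OF D(2)] UUD(1)[OF U(2)], of a z q] s z aq q U qD UUD(2)[OF U(2)]
          connD[OF piece_conn[OF D(2) L]] by auto
      then show "small d" using small_mono smallU[OF U(2,3)] D by blast
    next
      fix d i q z
      assume d: "d \<in> F" "b \<in> snd d" and "i \<in> U0" and q: "q \<in> snd i" "q \<notin> snd d" and z: "z \<in> snd d" "z \<notin> snd i" "z < q"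
      then obtain U where U: "i = (U, U - S)" "U \<in> UU" "card (U - S) = m" unfolding U0_def by blast
      obtain D L where D: "d = (D, L)" "piece D L" using d unfolding F_def by blast
      have L: "z \<in> L" "b \<in> L" using D d z by auto
      note s = piece_sub[OF D(2) L(1)] piece_sub[OF D(2) L(2)]
      have qb: "q < b" using q U unfolding UU_def by auto
      have qD: "q \<notin> D" using piece_between[OF D(2) L z(3) qb] q U D by auto
      have "S - D \<subseteq> S - U"
        using inner_sub[OF piece_C[OF D(2)] UUD(1)[OF U(2)], of z b q] s z qb q U qD UUD(3)[OF U(2)]
          connD[OF piece_conn[OF D(2) L]] by auto
      then show "small d" using small_mono smallU[OF U(2,3)] D by blast
    next
      fix d d' p q z
      assume d: "d \<in> F" "a \<in> snd d" and d': "d' \<in> F" "a \<in> snd d'" and p: "p \<in> snd d" "p \<notin> snd d'"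
        and q: "q \<in> snd d'" "q \<notin> snd d" and z: "z \<in> snd d" "z \<notin> snd d'" and l: "p < q" "q < z" and sm: "small d'"
      obtain D L where D: "d = (D, L)" "piece D L" using d unfolding F_def by blast
      obtain E M where E: "d' = (E, M)" "piece E M" using d' unfolding F_def by blast
      have L: "a \<in> L" "p \<in> L" "z \<in> L" using D d p z by auto
      have M: "a \<in> M" "q \<in> M" using E d' q by auto
      note s = piece_sub[OF D(2) L(1)] piece_sub[OF D(2) L(2)] piece_sub[OF D(2) L(3)] piece_sub[OF E(2) M(1)] piece_sub[OF E(2) M(2)]
      have ap: "a < p" using s p d' by (metis le_neq_implies_less)
      have pE: "p \<notin> E" using piece_between[OF E(2) M ap l(1)] p E s by auto
      have qD: "q \<notin> D" using piece_between[OF D(2) L(2,3) l] q D s by auto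
      have noP: "x \<in> S \<Longrightarrow> x \<notin> D \<Longrightarrow> p < x \<Longrightarrow> x < z \<Longrightarrow> False" for x
        using connD[OF piece_conn[OF D(2) L(2,3)]] by blast
      have "S - D \<subseteq> S - E"
      proof (cases "z \<in> E")
        case False
        then show ?thesis using inner_sub[OF piece_C[OF D(2)] piece_C[OF E(2)], of p z q] s pE qD l noP by blast
      next
        case True
        \<comment> \<open>Here \<open>z\<close> lies in \<open>E\<close>, but in a different piece
          than \<open>q\<close>. The element of \<open>S\<close> that cuts it off from
          \<open>q\<close> replaces it as the right end.\<close>
        obtain g where g: "g \<in> S" "g \<notin> E" "q < g" "g < z"
          using piece_sep(1)[OF E(2) M(2) True] s z E l by auto
        have gD: "g \<in> D" using noP[OF g(1)] g l by auto
        show ?thesis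
        proof (rule inner_sub[OF piece_C[OF D(2)] piece_C[OF E(2)], of p g q])
          show False if "x \<in> S" "x \<notin> D" "p < x" "x < g" for x using noP[of x] that g by auto
        qed (use s pE qD l g gD in blast)+
      qed
      then show "small d" using small_mono sm D E by blast
    next
      fix d d' p q z
      assume d: "d \<in> F" "b \<in> snd d" and d': "d' \<in> F" "b \<in> snd d'" and p: "p \<in> snd d" "p \<notin> snd d'"
        and q: "q \<in> snd d'" "q \<notin> snd d" and z: "z \<in> snd d" "z \<notin> snd d'" and l: "q < p" "z < q" and sm: "small d'"
      obtain D L where D: "d = (D, L)" "piece D L" using d unfolding F_def by blast
      obtain E M where E: "d' = (E, M)" "piece E M" using d' unfolding F_def by blast
      have L: "b \<in> L" "p \<in> L" "z \<in> L" using D d p z by auto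
      have M: "b \<in> M" "q \<in> M" using E d' q by auto
      note s = piece_sub[OF D(2) L(1)] piece_sub[OF D(2) L(2)] piece_sub[OF D(2) L(3)] piece_sub[OF E(2) M(1)] piece_sub[OF E(2) M(2)]
      have pb: "p < b" using s p d' by (metis le_neq_implies_less)
      have pE: "p \<notin> E" using piece_between[OF E(2) M(2,1) l(1) pb] p E s by auto
      have qD: "q \<notin> D" using piece_between[OF D(2) L(3,2) l(2,1)] q D s by auto
      have noP: "x \<in> S \<Longrightarrow> x \<notin> D \<Longrightarrow> z < x \<Longrightarrow> x < p \<Longrightarrow> False" for x
        using connD[OF piece_conn[OF D(2) L(3,2)]] by blast
      have "S - D \<subseteq> S - E"
      proof (cases "z \<in> E")
        case False
        then show ?thesis using inner_sub[OF piece_C[OF D(2)] piece_C[OF E(2)], of z p q] s pE qD l noP by blast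
      next
        case True
        obtain g where g: "g \<in> S" "g \<notin> E" "z < g" "g < q"
          using piece_sep(2)[OF E(2) M(2) True] s z E l by auto
        have gD: "g \<in> D" using noP[OF g(1)] g l by auto
        show ?thesis
        proof (rule inner_sub[OF piece_C[OF D(2)] piece_C[OF E(2)], of g p q])
          show False if "x \<in> S" "x \<notin> D" "g < x" "x < p" for x using noP[of x] that g by auto
        qed (use s pE qD l g gD in blast)+
      qed
      then show "small d" using small_mono sm D E by blast
    next
      fix d q z
      assume d: "d \<in> F" "a \<in> snd d" and sm: "small d" and q: "q \<in> V0" "q \<notin> snd d" and z: "z \<in> snd d" and l: "q < z"
      obtain D L where D: "d = (D, L)" "piece D L" using d unfolding F_def by blast
      have L: "a \<in> L" "z \<in> L" using D d z by auto
      have nb: "b \<notin> L" using d D nab by auto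
      note s = piece_sub[OF D(2) L(1)] piece_sub[OF D(2) L(2)]
      have qX: "a < q" "q < b" "q \<notin> S" using q unfolding V0_def X_def by auto
      have zb: "z < b" using s L nb by (metis le_neq_implies_less)
      have qD: "q \<notin> D" using piece_between[OF D(2) L qX(1) l] q D qX by auto
      \<comment> \<open>Smallness yields an element \<open>p\<close> of \<open>D\<close> that
        \<open>T\<close> drops; it lies outside \<open>{a..b}\<close>. Then \<open>z p\<close> would
        cross a chord \<open>q g\<close> of \<open>T\<close>, where \<open>g\<close> is either
        \<open>b\<close> or an element of \<open>S\<close> dropped by \<open>D\<close> between
        \<open>z\<close> and \<open>b\<close>.\<close>
      have "z \<in> T" if T: "T \<in> TT" for T
      proof (rule ccontr)
        assume zT: "z \<notin> T"
        have T': "b \<in> T" "T \<in> C" "q \<in> T" using T q unfolding TT_def V0_def by auto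
        obtain p where p: "p \<in> S" "p \<notin> T" "p \<in> D" using sm T D unfolding small_def by auto
        have po: "p < a \<or> b < p" using p T unfolding TT_def by blast
        obtain g where g: "g \<in> T" "g \<notin> D" "z < g" "g \<le> b"
        proof (cases "b \<in> D")
          case True
          obtain g where g: "g \<in> S" "g \<notin> D" "z < g" "g < b"
            using piece_sep(1)[OF D(2) L(2) True bS _ _ nb zb] ab by auto
          have "a < g" "g < b" using g s by auto
          then have "g \<in> T" using T g(1) unfolding TT_def by (metis (mono_tags, lifting) DiffI mem_Collect_eq order_less_asym)
          then show ?thesis using that g by simp
        next
          case False
          then show ?thesis using that T' zb by simp
        qed
        have "crosses q g z p" using po qX g l unfolding crosses_def by auto
        then show False using noncrossingD[OF ncC[of T D], of q g z p] T' piece_C[OF D(2)] qD g s zT p by blast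
      qed
      then show "z \<in> V0" unfolding V0_def X_def using s zb qX l by auto
    next
      fix d q z
      assume d: "d \<in> F" "b \<in> snd d" and sm: "small d" and q: "q \<in> V0" "q \<notin> snd d" and z: "z \<in> snd d" and l: "z < q"
      obtain D L where D: "d = (D, L)" "piece D L" using d unfolding F_def by blast
      have L: "b \<in> L" "z \<in> L" using D d z by auto
      have na: "a \<notin> L" using d D nab by auto
      note s = piece_sub[OF D(2) L(1)] piece_sub[OF D(2) L(2)]
      have qX: "a < q" "q < b" "q \<notin> S" using q unfolding V0_def X_def by auto
      have az: "a < z" using s L na by (metis le_neq_implies_less)
      have qD: "q \<notin> D" using piece_between[OF D(2) L(2,1) l qX(2)] q D qX by auto
      have "z \<in> T" if T: "T \<in> TT" for T
      proof (rule ccontr)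
        assume zT: "z \<notin> T"
        have T': "a \<in> T" "T \<in> C" "q \<in> T" using T q unfolding TT_def V0_def by auto
        obtain p where p: "p \<in> S" "p \<notin> T" "p \<in> D" using sm T D unfolding small_def by auto
        have po: "p < a \<or> b < p" using p T unfolding TT_def by blast
        obtain g where g: "g \<in> T" "g \<notin> D" "g < z" "a \<le> g"
        proof (cases "a \<in> D")
          case True
          obtain g where g: "g \<in> S" "g \<notin> D" "a < g" "g < z"
            using piece_sep(2)[OF D(2) L(2) True aS _ _ na az] ab by auto
          have "a < g" "g < b" using g s by auto
          then have "g \<in> T" using T g(1) unfolding TT_def by (metis (mono_tags, lifting) DiffI mem_Collect_eq order_less_asym)
          then show ?thesis using that g by simp
        next
          case False
          then show ?thesis using that T' az by simp
        qed
        have "crosses q g z p" using po qX g l unfolding crosses_def by auto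
        then show False using noncrossingD[OF ncC[of T D], of q g z p] T' piece_C[OF D(2)] qD g s zT p by blast
      qed
      then show "z \<in> V0" unfolding V0_def X_def using s az qX l by auto
    qed
    show ?thesis using protected_point fin by blast
  qed
qed

end

section \<open>Rotations and complements\<close>

definition turn :: "nat \<Rightarrow> nat \<Rightarrow> nat \<Rightarrow> nat" where
  "turn N b x = (if x < b then x + N else x)"

lemma inj_turn: "inj_on (turn N b) {..<N}"
  unfolding inj_on_def turn_def by auto

lemma turn_less: "m < N \<Longrightarrow> x < N \<Longrightarrow> m \<noteq> x \<Longrightarrow> (turn N b m < turn N b x) = ((m < x) \<noteq> ((m < b) \<noteq> (x < b)))"
  unfolding turn_def by auto

lemma crosses_turn:
  assumes "x < N" "y < N" "m < N" "m' < N" "x \<noteq> m" "x \<noteq> m'" "y \<noteq> m" "y \<noteq> m'"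
  shows "crosses (turn N b x) (turn N b y) (turn N b m) (turn N b m') = crosses x y m m'"
proof -
  have "(turn N b m < turn N b x) = ((m < x) \<noteq> ((m < b) \<noteq> (x < b)))"
    "(turn N b m' < turn N b x) = ((m' < x) \<noteq> ((m' < b) \<noteq> (x < b)))"
    "(turn N b m < turn N b y) = ((m < y) \<noteq> ((m < b) \<noteq> (y < b)))"
    "(turn N b m' < turn N b y) = ((m' < y) \<noteq> ((m' < b) \<noteq> (y < b)))"
    using assms turn_less by auto
  then show ?thesis unfolding crosses_def
    by (cases "m < b"; cases "m' < b"; cases "x < b"; cases "y < b"; simp)
qed

lemma noncrossing_turn:
  assumes A: "A \<subseteq> {..<N}" and B: "B \<subseteq> {..<N}"
  shows "noncrossing (turn N b ` A) (turn N b ` B) = noncrossing A B"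
proof -
  have "turn N b ` A - turn N b ` B = turn N b ` (A - B)" "turn N b ` B - turn N b ` A = turn N b ` (B - A)"
    using inj_on_image_set_diff[OF inj_turn] A B by (metis Diff_subset order_trans)+
  moreover have "crosses (turn N b x) (turn N b y) (turn N b m) (turn N b m') = crosses x y m m'"
    if "x \<in> A - B" "y \<in> A - B" "m \<in> B - A" "m' \<in> B - A" for x y m m'
    using that A B by (intro crosses_turn) auto
  ultimately show ?thesis unfolding noncrossing_def by simp
qed

lemma noncrossing_complement:
  assumes "A \<subseteq> G" "B \<subseteq> G"
  shows "noncrossing (G - A) (G - B) = noncrossing A B"
proof -
  have "(G - A) - (G - B) = B - A" "(G - B) - (G - A) = A - B" using assms by blast+
  then have "noncrossing (G - A) (G - B) = noncrossing B A" unfolding noncrossing_def by simp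
  then show ?thesis using noncrossing_sym by blast
qed

text \<open>Complements and a rotation that moves \<open>a\<close> behind \<open>b\<close> turn white triangles into black ones.\<close>

lemma (in edge_family) black_triangle:
  assumes N: "\<And>B. B \<in> C \<Longrightarrow> B \<subseteq> {..<N}"
    and h: "((\<forall>U\<in>C. \<not> U - S \<subseteq> {a<..<b}) \<and> (\<exists>q\<in>S. q < a \<or> b < q)) \<or>
      (\<exists>T\<in>TT. \<not> T - S \<subseteq> {a, b} \<and> (\<forall>U\<in>C. U - S \<subseteq> {a<..<b} \<longrightarrow> card (T - S) \<le> card (U - S)))"
  shows "\<exists>q\<in>S. (q < a \<or> b < q) \<and> (\<forall>B\<in>C. noncrossing (insert a (insert b S) - {q}) B)"
proof -
  define G where "G = {..<N}"
  define \<phi> where "\<phi> = turn N b"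
  define S' where "S' = \<phi> ` (G - insert a (insert b S))"
  define \<psi> where "\<psi> = (\<lambda>B. \<phi> ` (G - B))"
  have inj: "inj_on \<phi> G" unfolding \<phi>_def G_def by (rule inj_turn)
  have G: "a \<in> G" "b \<in> G" "S \<subseteq> G" using N[OF SaC] N[OF SbC] unfolding G_def by auto
  have abN: "a < N" "b < N" using G unfolding G_def by auto
  have NG: "B \<in> C \<Longrightarrow> B \<subseteq> G" for B using N unfolding G_def by blast
  have fG: "finite G" unfolding G_def by simp
  have \<phi>a: "\<phi> a = a + N" and \<phi>b: "\<phi> b = b" using ab unfolding \<phi>_def turn_def by auto
  have mem: "\<phi> x \<in> \<phi> ` Y \<longleftrightarrow> x \<in> Y" if "x \<in> G" "Y \<subseteq> G" for x Y
    using inj_on_image_mem_iff[OF inj that] .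
  have b\<psi>: "b \<in> \<psi> B \<longleftrightarrow> b \<notin> B" for B using mem[of b "G - B"] G \<phi>b unfolding \<psi>_def by auto
  have a\<psi>: "a + N \<in> \<psi> B \<longleftrightarrow> a \<notin> B" for B using mem[of a "G - B"] G \<phi>a unfolding \<psi>_def by auto
  have cardG: "card G = N" unfolding G_def by simp
  have cardS: "card S + 2 \<le> N"
    using card_mono[OF fG, of "insert a (insert b S)"] G aS bS ab finS cardG by simp
  \<comment> \<open>Complementation swaps the ends of the edge: the complement of
    \<open>insert a S\<close> contains \<open>b\<close> but not \<open>a\<close>. The rotation then
    puts \<open>b\<close> first and \<open>a\<close>, now \<open>a + N\<close>, last.\<close>
  have insb: "insert b S' = \<psi> (insert a S)"
    unfolding S'_def \<psi>_def using G bS ab \<phi>b by (metis (no_types, lifting) Diff_insert image_insert insert_Diff_single insert_Diff insert_commute DiffI insertE nat_neq_iff)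
  have insa: "insert (a + N) S' = \<psi> (insert b S)"
    unfolding S'_def \<psi>_def using G aS ab \<phi>a by (metis (no_types, lifting) Diff_insert image_insert insert_Diff_single insert_Diff insert_commute DiffI insertE nat_neq_iff)
  interpret D: edge_family "\<psi> ` C" S' b "a + N"
  proof
    show "b < a + N" using abN by simp
    show "b \<notin> S'" using mem[of b "G - insert a (insert b S)"] G \<phi>b unfolding S'_def by auto
    show "a + N \<notin> S'" using mem[of a "G - insert a (insert b S)"] G \<phi>a unfolding S'_def by auto
    show "finite S'" unfolding S'_def using fG by simp
    show "insert b S' \<in> \<psi> ` C" using insb SaC by blast
    show "insert (a + N) S' \<in> \<psi> ` C" using insa SbC by blast
  next
    fix B assume "B \<in> \<psi> ` C"
    then obtain A where A: "A \<in> C" "B = \<psi> A" by blast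
    show "finite B" using A fG unfolding \<psi>_def by simp
    have "card B = card (G - A)" unfolding A(2) \<psi>_def
      by (rule card_image[OF inj_on_subset[OF inj]]) blast
    also have "\<dots> = N - Suc (card S)" using card_Diff_subset[OF finC[OF A(1)] NG[OF A(1)]] cardG cardC[OF A(1)] by simp
    finally have 1: "card B = N - Suc (card S)" .
    have "card S' = card (G - insert a (insert b S))" unfolding S'_def
      by (rule card_image[OF inj_on_subset[OF inj]]) blast
    also have "\<dots> = N - card (insert a (insert b S))" using card_Diff_subset[of "insert a (insert b S)" G] finS G cardG by simp
    also have "\<dots> = N - (card S + 2)" using finS aS bS ab by simp
    finally show "card B = Suc (card S')" using 1 cardS by simp
  next
    fix B D assume "B \<in> \<psi> ` C" "D \<in> \<psi> ` C"
    then obtain A E where A: "A \<in> C" "B = \<psi> A" "E \<in> C" "D = \<psi> E" by blast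
    have "noncrossing (G - A) (G - E)" using noncrossing_complement[OF NG NG] A ncC by blast
    then show "noncrossing B D" unfolding A \<psi>_def \<phi>_def using noncrossing_turn[of "G - A" N "G - E"] unfolding G_def by auto
  qed
  have \<psi>S: "\<psi> B - S' = \<phi> ` (insert a (insert b S) - B)" if "B \<in> C" for B
  proof -
    have "\<psi> B - S' = \<phi> ` ((G - B) - (G - insert a (insert b S)))"
      unfolding \<psi>_def S'_def using inj_on_image_set_diff[OF inj, of "G - B" "G - insert a (insert b S)"] by blast
    moreover have "(G - B) - (G - insert a (insert b S)) = insert a (insert b S) - B" using G by blast
    ultimately show ?thesis by simp
  qed
  have S\<psi>: "S' - \<psi> B = \<phi> ` (B - insert a (insert b S))" if "B \<in> C" for B
  proof -
    have "S' - \<psi> B = \<phi> ` ((G - insert a (insert b S)) - (G - B))"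
      unfolding \<psi>_def S'_def using inj_on_image_set_diff[OF inj, of "G - insert a (insert b S)" "G - B"] by blast
    moreover have "(G - insert a (insert b S)) - (G - B) = B - insert a (insert b S)" using NG[OF that] by blast
    ultimately show ?thesis by simp
  qed
  have card\<psi>: "card (\<psi> B - S') = card (insert a (insert b S) - B)" if "B \<in> C" for B
    unfolding \<psi>S[OF that] by (rule card_image[OF inj_on_subset[OF inj]]) (use G in blast)
  have TTD: "\<exists>U\<in>C. T' = \<psi> U \<and> U - S \<subseteq> {a<..<b} \<and> a \<notin> U \<and> b \<notin> U" if T': "T' \<in> D.TT" for T'
  proof -
    have "T' \<in> \<psi> ` C" "b \<in> T'" "a + N \<in> T'" using T' unfolding D.TT_def by auto
    then obtain U where U: "U \<in> C" "T' = \<psi> U" "a \<notin> U" "b \<notin> U" using a\<psi> b\<psi> by blast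
    have "q \<in> {a<..<b}" if q: "q \<in> U - S" for q
    proof -
      have "\<phi> q \<in> S' - T'" using S\<psi>[OF U(1)] U q by auto
      then have "\<phi> q < b \<or> a + N < \<phi> q" using T' unfolding D.TT_def by blast
      moreover have "q < N" using q NG[OF U(1)] unfolding G_def by auto
      moreover have "q \<noteq> a" "q \<noteq> b" using q U by auto
      ultimately show ?thesis using abN unfolding \<phi>_def turn_def by (auto split: if_splits)
    qed
    then show ?thesis using U by blast
  qed
  have "\<exists>c. b < c \<and> c < a + N \<and> c \<notin> S' \<and> (\<forall>B\<in>\<psi> ` C. noncrossing (insert c S') B)"
  proof (rule D.white_triangle)
    from h show "(D.TT = {} \<and> {b<..<a + N} - S' \<noteq> {}) \<or> (\<exists>U\<in>D.UU. \<forall>T\<in>D.TT. card (U - S') < card (T - S'))"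
    proof
      assume h1: "(\<forall>U\<in>C. \<not> U - S \<subseteq> {a<..<b}) \<and> (\<exists>q\<in>S. q < a \<or> b < q)"
      then have "D.TT = {}" using TTD by blast
      obtain q where q: "q \<in> S" "q < a \<or> b < q" using h1 by blast
      have "q \<in> G" using q G by blast
      then have "\<phi> q \<notin> S'" using mem[of q "G - insert a (insert b S)"] q unfolding S'_def by auto
      moreover have "\<phi> q \<in> {b<..<a + N}" using q(2) \<open>q \<in> G\<close> abN ab unfolding \<phi>_def turn_def G_def by auto
      ultimately show ?thesis using \<open>D.TT = {}\<close> by blast
    next
      assume "\<exists>T\<in>TT. \<not> T - S \<subseteq> {a, b} \<and> (\<forall>U\<in>C. U - S \<subseteq> {a<..<b} \<longrightarrow> card (T - S) \<le> card (U - S))"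
      then obtain T where T: "T \<in> TT" "\<not> T - S \<subseteq> {a, b}"
        "\<And>U. U \<in> C \<Longrightarrow> U - S \<subseteq> {a<..<b} \<Longrightarrow> card (T - S) \<le> card (U - S)" by blast
      have TC: "T \<in> C" "a \<in> T" "b \<in> T" and To: "\<And>p. p \<in> S - T \<Longrightarrow> p < a \<or> b < p" using T(1) unfolding TT_def by auto
      have "insert a (insert b S) - T = S - T" using TC by blast
      then have eq: "\<psi> T - S' = \<phi> ` (S - T)" "card (\<psi> T - S') = card (S - T)" using \<psi>S[OF TC(1)] card\<psi>[OF TC(1)] by simp_all
      have "\<psi> T - S' \<subseteq> {b<..<a + N}"
      proof
        fix y assume "y \<in> \<psi> T - S'"
        then obtain x where x: "x \<in> S" "x \<notin> T" "y = \<phi> x" using eq by blast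
        then have "x < N" using G unfolding G_def by blast
        then show "y \<in> {b<..<a + N}" using To[of x] x abN ab unfolding \<phi>_def turn_def by auto
      qed
      moreover have "S' - \<psi> T \<noteq> {}" using T(2) unfolding S\<psi>[OF TC(1)] by blast
      ultimately have "\<psi> T \<in> D.UU" unfolding D.UU_def using TC by blast
      \<comment> \<open>Passing to complements lowers the excess \<open>card (T - S)\<close> by one
        and raises \<open>card (U - S)\<close> by one, so the weak inequality becomes the strict one
        required for white triangles.\<close>
      moreover have "card (\<psi> T - S') < card (T' - S')" if T': "T' \<in> D.TT" for T'
      proof -
        obtain U where U: "U \<in> C" "T' = \<psi> U" "U - S \<subseteq> {a<..<b}" "a \<notin> U" "b \<notin> U" using TTD[OF T'] by blast
        have "insert a (insert b S) - U = insert a (insert b (S - U))" using U by blast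
        then have "card (T' - S') = card (S - U) + 2" using card\<psi>[OF U(1)] U(2) finS aS bS ab by simp
        moreover have "card (S - T) \<le> card (S - U)" using T(3)[OF U(1,3)] card_outer[OF TC(1)] card_outer[OF U(1)] by simp
        ultimately show ?thesis using eq(2) by simp
      qed
      ultimately show ?thesis by blast
    qed
  qed
  then obtain c where c: "b < c" "c < a + N" "c \<notin> S'" "\<And>B. B \<in> C \<Longrightarrow> noncrossing (insert c S') (\<psi> B)" by blast
  define q where "q = (if c < N then c else c - N)"
  have q: "q < N" "\<phi> q = c" "q < a \<or> b < q" using c(1,2) ab abN unfolding q_def \<phi>_def turn_def by auto
  have qG: "q \<in> G" using q unfolding G_def by simp
  have "q \<in> insert a (insert b S)" using c(3) q(2) qG unfolding S'_def by blast
  then have qS: "q \<in> S" using q(3) ab by auto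
  have "noncrossing (insert a (insert b S) - {q}) B" if B: "B \<in> C" for B
  proof -
    have "insert c S' = \<phi> ` (insert q (G - insert a (insert b S)))" unfolding S'_def using q(2) by simp
    also have "insert q (G - insert a (insert b S)) = G - (insert a (insert b S) - {q})" using qG qS by blast
    finally have "noncrossing (\<phi> ` (G - (insert a (insert b S) - {q}))) (\<phi> ` (G - B))" using c(4)[OF B] unfolding \<psi>_def by simp
    then have "noncrossing (G - (insert a (insert b S) - {q})) (G - B)"
      unfolding \<phi>_def using noncrossing_turn[of "G - (insert a (insert b S) - {q})" N "G - B"] unfolding G_def by auto
    then show ?thesis using noncrossing_complement[of "insert a (insert b S) - {q}" G B] NG[OF B] G by blast
  qed
  then show ?thesis using qS q(3) by blast
qed

text \<open>If some \<open>U\<close> is smaller than every \<open>T\<close>, there is a white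
  triangle; otherwise a smallest \<open>T\<close> is at most as large as every \<open>U\<close>, and
  there is a black one. The degenerate members, with \<open>S - U\<close> empty or with
  \<open>T - S\<close> equal to \<open>{a, b}\<close>, are themselves third vertices; this gives
  \<open>PU\<close> and \<open>QT\<close>.\<close>

lemma (in edge_family) triangle_on_edge:
  assumes N: "\<And>B. B \<in> C \<Longrightarrow> B \<subseteq> {..<N}"
    and ne: "{a<..<b} - S \<noteq> {} \<or> (\<exists>q\<in>S. q < a \<or> b < q)"
  shows "(\<exists>c. a < c \<and> c < b \<and> c \<notin> S \<and> (\<forall>B\<in>C. noncrossing (insert c S) B)) \<or>
    (\<exists>q\<in>S. (q < a \<or> b < q) \<and> (\<forall>B\<in>C. noncrossing (insert a (insert b S) - {q}) B))" (is "?W \<or> ?B")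
proof (rule ccontr)
  assume n: "\<not> (?W \<or> ?B)"
  have noW: "\<not> (TT = {} \<and> {a<..<b} - S \<noteq> {})" "\<not> (\<exists>U\<in>UU. \<forall>T\<in>TT. card (U - S) < card (T - S))"
    using n white_triangle by blast+
  have PU: "U \<in> UU" if "U \<in> C" "U - S \<subseteq> {a<..<b}" for U
  proof -
    have "S - U \<noteq> {}"
    proof
      assume e: "S - U = {}"
      then have "card (U - S) = 1" using card_outer[OF that(1)] by (simp only: card.empty One_nat_def)
      then obtain c where c: "U - S = {c}" by (meson card_1_singletonE)
      have "insert c S = U" using e c by blast
      moreover have "c \<in> {a<..<b}" "c \<notin> S" using c that(2) by blast+
      ultimately have "insert c S \<in> C" "a < c" "c < b" "c \<notin> S" using that(1) by auto
      then have ?W using ncC by blast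
      then show False using n by blast
    qed
    then show ?thesis unfolding UU_def using that by blast
  qed
  have QT: "\<not> T - S \<subseteq> {a, b}" if T: "T \<in> TT" for T
  proof
    assume s: "T - S \<subseteq> {a, b}"
    have T': "T \<in> C" "a \<in> T" "b \<in> T" "\<And>p. p \<in> S - T \<Longrightarrow> p < a \<or> b < p" using T unfolding TT_def by auto
    then have "T - S = {a, b}" using s aS bS by blast
    then have "card (S - T) = 1" using card_outer[OF T'(1)] ab by simp
    then obtain q where q: "S - T = {q}" by (meson card_1_singletonE)
    then have "insert a (insert b S) - {q} = T" using \<open>T - S = {a, b}\<close> by blast
    then have ?B using q T'(1,4) ncC by blast
    then show False using n by blast
  qed
  have noB: "\<not> ((\<forall>U\<in>C. \<not> U - S \<subseteq> {a<..<b}) \<and> (\<exists>q\<in>S. q < a \<or> b < q))"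
      "\<not> (\<exists>T\<in>TT. \<not> T - S \<subseteq> {a, b} \<and> (\<forall>U\<in>C. U - S \<subseteq> {a<..<b} \<longrightarrow> card (T - S) \<le> card (U - S)))"
    using n black_triangle[OF N] by blast+
  have TY: "\<exists>q\<in>S. q < a \<or> b < q" if T: "T \<in> TT" for T
  proof -
    have T': "T \<in> C" "a \<in> T" "b \<in> T" "\<And>p. p \<in> S - T \<Longrightarrow> p < a \<or> b < p" using T unfolding TT_def by auto
    have "{a, b} \<subseteq> T - S" using T' aS bS by blast
    then have "card {a, b} \<le> card (T - S)" using finC[OF T'(1)] by (intro card_mono) auto
    then have "card (S - T) \<noteq> 0" using card_outer[OF T'(1)] ab by simp
    then have "S - T \<noteq> {}" by (metis card.empty)
    then show ?thesis using T'(4) by blast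
  qed
  have UX: "{a<..<b} - S \<noteq> {}" if U: "U \<in> UU" for U
    using UU_piece[OF U] U unfolding piece_def UU_def by blast
  \<comment> \<open>If one of the classes is empty, a first alternative of
    \<open>white_triangle\<close> or \<open>black_triangle\<close> applies; the point it asks for
    comes from a member of the other class, or from \<open>ne\<close> if both are empty.\<close>
  have TTne: "TT \<noteq> {}" and UUne: "UU \<noteq> {}"
    using ne noW(1) noB(1) TY UX PU by blast+
  obtain T where T: "T \<in> TT" "\<And>T'. T' \<in> TT \<Longrightarrow> card (T - S) \<le> card (T' - S)"
    using TTne ex_has_least_nat[of "\<lambda>T. T \<in> TT" _ "\<lambda>T. card (T - S)"] by blast
  have "card (T - S) \<le> card (U - S)" if "U \<in> UU" for U
    using noW(2) that T(2) by (meson le_trans not_le)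
  then have "\<forall>U\<in>C. U - S \<subseteq> {a<..<b} \<longrightarrow> card (T - S) \<le> card (U - S)" using PU by blast
  then show False using noB(2) T(1) QT[OF T(1)] by blast
qed

section \<open>Weak separation and flips\<close>

lemma weakly_separated_refl [simp]: "weakly_separated A A"
  unfolding weakly_separated_def surrounds_def by simp

lemma weakly_separated_sym: "weakly_separated A B = weakly_separated B A"
  unfolding weakly_separated_def by blast

lemma chord_separated_sym: "chord_separated A B = chord_separated B A"
  unfolding chord_separated_def by blast

lemma weakly_imp_chord_separated: "weakly_separated A B \<Longrightarrow> chord_separated A B"
  unfolding weakly_separated_def chord_separated_def by blast

lemma weakly_separated_card_eq: "card A = card B \<Longrightarrow> weakly_separated A B = chord_separated A B"
  unfolding weakly_separated_def chord_separated_def by auto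

lemma weakly_separated_card_less: "card A < card B \<Longrightarrow> weakly_separated A B = surrounds A B"
  unfolding weakly_separated_def by auto

lemma surroundsD: "surrounds A B \<Longrightarrow> i \<in> B \<Longrightarrow> i \<notin> A \<Longrightarrow> k \<in> B \<Longrightarrow> k \<notin> A \<Longrightarrow> j \<in> A \<Longrightarrow> j \<notin> B \<Longrightarrow>
    i < j \<Longrightarrow> j < k \<Longrightarrow> False"
  unfolding surrounds_def by blast

text \<open>Padding with elements above \<open>n\<close> to a common size \<open>R\<close> turns weak into chord separation.\<close>

definition pad :: "nat \<Rightarrow> nat \<Rightarrow> nat set \<Rightarrow> nat set" where
  "pad n R X = X \<union> {n<..n + (R - card X)}"

lemma card_pad:
  assumes "X \<subseteq> {1..n}" "card X \<le> R"
  shows "card (pad n R X) = R" "finite (pad n R X)"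
proof -
  have f: "finite X" using assms(1) by (rule finite_subset) simp
  moreover have "X \<inter> {n<..n + (R - card X)} = {}" using assms(1) by auto
  ultimately show "card (pad n R X) = R" unfolding pad_def using assms(2) by (simp add: card_Un_disjoint)
  show "finite (pad n R X)" unfolding pad_def using f by simp
qed

lemma pad_inter: "X \<subseteq> {1..n} \<Longrightarrow> pad n R X \<inter> {1..n} = X"
  unfolding pad_def by auto

text \<open>The smaller set receives elements beyond all of \<open>pad n R Y\<close>. With one of
  them as fourth point, a failure of \<open>surrounds X Y\<close> becomes an alternation.
  Conversely, the elements of \<open>Y - X\<close> are at most \<open>n\<close>, so every crossing
  contains such a failure.\<close>

lemma pad_less:
  assumes X: "X \<subseteq> {1..n}" and Y: "Y \<subseteq> {1..n}" and l: "card X < card Y" and R: "card Y \<le> R"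
  shows "weakly_separated X Y = noncrossing (pad n R X) (pad n R Y)"
proof -
  have dYX: "pad n R Y - pad n R X = Y - X" using X Y l unfolding pad_def by auto
  have dXY: "pad n R X - pad n R Y = (X - Y) \<union> {n + (R - card Y)<..n + (R - card X)}"
    using X Y l unfolding pad_def by auto
  have "surrounds X Y = noncrossing (pad n R X) (pad n R Y)"
  proof
    assume s: "surrounds X Y"
    show "noncrossing (pad n R X) (pad n R Y)"
    proof (rule noncrossingI)
      fix x y m m' assume x: "x \<in> pad n R X" "x \<notin> pad n R Y" and y: "y \<in> pad n R X" "y \<notin> pad n R Y"
        and m: "m \<in> pad n R Y" "m \<notin> pad n R X" and m': "m' \<in> pad n R Y" "m' \<notin> pad n R X" and "m < m'" "crosses x y m m'"
      have "x \<noteq> m" "x \<noteq> m'" "y \<noteq> m" "y \<noteq> m'" using x y m m' by blast+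
      from crosses_cases[OF this \<open>m < m'\<close> \<open>crosses x y m m'\<close>]
      have or: "(m < x \<and> x < m') \<or> (m < y \<and> y < m')" by blast
      have mm: "m \<in> Y - X" "m' \<in> Y - X" "m' \<le> n" using dYX m m' Y by auto
      have "w < m' \<Longrightarrow> w \<in> X - Y" if "w \<in> pad n R X" "w \<notin> pad n R Y" for w
        using that dXY mm(3) by auto
      then show False using or x y surroundsD[OF s, of m m' x] surroundsD[OF s, of m m' y] mm by blast
    qed
  next
    assume nc: "noncrossing (pad n R X) (pad n R Y)"
    show "surrounds X Y"
      unfolding surrounds_def
    proof
      assume "\<exists>i j k. i < j \<and> j < k \<and> i \<in> Y - X \<and> k \<in> Y - X \<and> j \<in> X - Y"
      then obtain i j k where h: "i < j" "j < k" "i \<in> Y - X" "k \<in> Y - X" "j \<in> X - Y" by blast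
      have e: "n + (R - card X) \<in> pad n R X - pad n R Y" using dXY l R by auto
      have "k < n + (R - card X)" using h Y l R by auto
      then have "crosses j (n + (R - card X)) i k" using h crosses_alternating' by blast
      moreover have "i \<in> pad n R Y - pad n R X" "k \<in> pad n R Y - pad n R X" "j \<in> pad n R X - pad n R Y"
        using h dYX dXY by blast+
      ultimately show False using e nc unfolding noncrossing_def by blast
    qed
  qed
  then show ?thesis using weakly_separated_card_less[OF l] by simp
qed

lemma weakly_separated_pad:
  assumes X: "X \<subseteq> {1..n}" and Y: "Y \<subseteq> {1..n}" and R: "card X \<le> R" "card Y \<le> R"
  shows "weakly_separated X Y = noncrossing (pad n R X) (pad n R Y)"
proof -
  consider "card X < card Y" | "card Y < card X" | "card X = card Y" by linarith
  then show ?thesis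
  proof cases
    case 1 then show ?thesis using pad_less[OF X Y _ R(2)] by blast
  next
    case 2 then show ?thesis using pad_less[OF Y X _ R(1)] weakly_separated_sym noncrossing_sym by metis
  next
    case 3
    then have "pad n R X - pad n R Y = X - Y" "pad n R Y - pad n R X = Y - X" unfolding pad_def using X Y by auto
    then have "noncrossing (pad n R X) (pad n R Y) = noncrossing X Y" unfolding noncrossing_def by simp
    then show ?thesis using weakly_separated_card_eq[OF 3] chord_separated_iff_noncrossing by simp
  qed
qed

lemma crosses_split': "crosses x y m m' \<Longrightarrow> crosses x q m m' \<or> crosses y q m m'"
  unfolding crosses_def by blast

lemma crosses_swap: "crosses x y m m' \<Longrightarrow> crosses y x m m'" "crosses x y m m' \<Longrightarrow> crosses x y m' m"
  unfolding crosses_def by blast+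

text \<open>By size, one element of \<open>S\<close> missing from \<open>Y\<close> forces at least
  three elements of \<open>Y\<close> outside \<open>S\<close>, so two of them can be
  avoided.\<close>

lemma obtain_outside:
  assumes "finite Y" "finite S" "card Y \<ge> card S + 2" "M \<subseteq> S - Y" "card M \<ge> 1"
  obtains y where "y \<in> Y" "y \<notin> S" "y \<noteq> i" "y \<noteq> (k :: nat)"
proof -
  have "card M \<le> card (S - Y)" using assms by (intro card_mono) auto
  then have "3 \<le> card (Y - S)" using card_Diff_swap[OF assms(1,2)] assms(3,5) by linarith
  moreover have "card (Y - S) \<le> 2" if "Y - S \<subseteq> {i, k}"
    using card_mono[OF _ that] by (simp add: card_insert_if split: if_splits)
  ultimately have "\<not> Y - S \<subseteq> {i, k}" by fastforce
  then show ?thesis using that by blast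
qed

text \<open>If the chord of \<open>Y\<close> that crosses \<open>insert j (insert e S)\<close> is
  not \<open>i k\<close>, one of the four sides is crossed as well. For the chord \<open>i k\<close>
  itself, a third element \<open>y\<close> of \<open>Y - S\<close> splits it into halves, one of
  which crosses a side. Such a \<open>y\<close> exists as soon as \<open>Y\<close> misses an element
  of \<open>S\<close>; if it misses none and contains \<open>i, k\<close>, then \<open>Y\<close> is
  the excepted set by size.\<close>

lemma square_move:
  assumes fin: "finite Y" "finite S" and card: "card Y = card S + 2"
    and nS: "i \<notin> S" "j \<notin> S" "k \<notin> S" "e \<notin> S" and d: "i \<noteq> j" "i \<noteq> k" "i \<noteq> e" "j \<noteq> k" "j \<noteq> e" "k \<noteq> e"
    and c: "crosses i k j e"
    and ij: "noncrossing Y (insert i (insert j S))" and jk: "noncrossing Y (insert j (insert k S))"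
    and ke: "noncrossing Y (insert k (insert e S))" and ie: "noncrossing Y (insert i (insert e S))"
  shows "Y = insert i (insert k S) \<or> noncrossing Y (insert j (insert e S))"
proof (rule ccontr)
  assume "\<not> ?thesis"
  then have ne: "Y \<noteq> insert i (insert k S)" and "\<not> noncrossing Y (insert j (insert e S))" by auto
  then obtain x z m m' where x: "x \<in> Y" "x \<notin> S" "x \<noteq> j" "x \<noteq> e" and z: "z \<in> Y" "z \<notin> S" "z \<noteq> j" "z \<noteq> e"
    and m: "m \<in> insert j (insert e S)" "m \<notin> Y" and m': "m' \<in> insert j (insert e S)" "m' \<notin> Y"
    and cr: "crosses x z m m'" unfolding noncrossing_def by blast
  have side: False if "x \<in> Y" "z \<in> Y" "x \<notin> S" "z \<notin> S" "x \<notin> {u, v}" "z \<notin> {u, v}" "noncrossing Y (insert u (insert v S))"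
    "m \<in> insert u (insert v S)" "m \<notin> Y" "m' \<in> insert u (insert v S)" "m' \<notin> Y" "crosses x z m m'" for x z m m' u v
    using noncrossingD[OF that(7), of x z m m'] that by blast
  have one: "\<not> crosses i k m w" if m: "m \<in> S" "m \<notin> Y" and w: "w \<in> {j, e}" "w \<notin> Y" and ik: "i \<in> Y" "k \<in> Y" for m w
  proof
    assume cr: "crosses i k m w"
    obtain y where y: "y \<in> Y" "y \<notin> S" "y \<noteq> i" "y \<noteq> k"
      using obtain_outside[of Y S "{m}" i k] fin card m by auto
    have yw: "y \<noteq> w" using y w by blast
    from crosses_split'[OF cr, of y] show False
    proof
      assume "crosses i y m w"
      moreover have "noncrossing Y (insert k (insert w S))" using w jk ke by (auto simp: insert_commute)
      ultimately show False using side[of i y k w m w] m w ik y yw nS d by blast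
    next
      assume "crosses k y m w"
      moreover have "noncrossing Y (insert i (insert w S))" using w ij ie by auto
      ultimately show False using side[of k y i w m w] m w ik y yw nS d by blast
    qed
  qed
  have mixed: False if m: "m \<in> S" "m \<notin> Y" and w: "w \<in> {j, e}" "w \<notin> Y" and cr: "crosses x z m w" for m w
  proof -
    have "noncrossing Y (insert i (insert w S))" "noncrossing Y (insert k (insert w S))"
      using w jk ke ij ie by (auto simp: insert_commute)
    then have "i \<in> {x, z}" "k \<in> {x, z}"
      using side[of x z i w m w] side[of x z k w m w] x z w m cr by blast+
    then have "(x = i \<and> z = k) \<or> (x = k \<and> z = i)" using d by blast
    then show False using one[OF m w] x z cr crosses_swap by blast
  qed
  consider "m \<in> S" "m' \<in> S" | "m \<in> S" "m' \<in> {j, e}" | "m \<in> {j, e}" "m' \<in> S" | "m \<in> {j, e}" "m' \<in> {j, e}"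
    using m m' by blast
  then show False
  proof cases
    case 1
    then have "i \<in> {x, z}" "k \<in> {x, z}"
      using side[of x z i j m m'] side[of x z k e m m'] ij ke x z m m' cr by blast+
    then have ik: "crosses i k m m'" "i \<in> Y" "k \<in> Y" using d cr crosses_swap x z by blast+
    obtain y where y: "y \<in> Y" "y \<notin> S" "y \<noteq> i" "y \<noteq> k"
      using obtain_outside[of Y S "{m}" i k] fin card m 1 by auto
    from crosses_split'[OF ik(1), of y] show False
    proof
      assume cr: "crosses i y m m'"
      show False
      proof (cases "y = j")
        case True then show False using side[of i y k e m m'] cr ke m m' 1 ik y nS d by blast
      next
        case False then show False using side[of i y j k m m'] cr jk m m' 1 ik y nS d by blast
      qed
    next
      assume cr: "crosses k y m m'"
      show False
      proof (cases "y = j")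
        case True then show False using side[of k y i e m m'] cr ie m m' 1 ik y nS d by blast
      next
        case False then show False using side[of k y i j m m'] cr ij m m' 1 ik y nS d by blast
      qed
    qed
  next
    case 2 then show False using mixed m m' cr by blast
  next
    case 3 then show False using mixed[of m' m] m m' cr crosses_swap(2) by blast
  next
    case 4
    have "m \<noteq> m'" using cr unfolding crosses_def by blast
    then have cr': "crosses x z j e" and je: "j \<notin> Y" "e \<notin> Y" using 4 cr crosses_swap(2) m m' by blast+
    have "u \<in> {x, z}" if u: "u = i \<or> u = k" for u
      proof (rule ccontr)
        assume nu: "u \<notin> {x, z}"
        have uj: "noncrossing Y (insert u (insert j S))" and ue: "noncrossing Y (insert u (insert e S))"
          using u ij jk ke ie by (auto simp: insert_commute)
        \<comment> \<open>If \<open>Y\<close> contains \<open>S\<close>, then \<open>Y - S\<close>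
          consists of \<open>x\<close> and \<open>z\<close> by size, so \<open>u\<close> itself is
          missing from \<open>Y\<close>.\<close>
        have "\<exists>q. q \<in> insert u S \<and> q \<notin> Y"
        proof (cases "S - Y = {}")
          case True
          have "Y - S = {x, z}"
          proof -
            have "card (Y - S) = 2" using card_Diff_swap[OF fin] card True by simp
            moreover have "x \<noteq> z" using cr unfolding crosses_def by blast
            ultimately show ?thesis using x z fin by (intro card_subset_eq[symmetric]) auto
          qed
          then have "u \<notin> Y" using nu u nS by blast
          then show ?thesis by blast
        next
          case False then show ?thesis by blast
        qed
        then obtain q where q: "q \<in> insert u S" "q \<notin> Y" by blast
        from crosses_split[OF cr', of q] show False
        proof
          assume "crosses x z q j"
          then show False using side[of x z u j q j] uj q je x z nu by blast
        next
          assume "crosses x z q e"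
          then show False using side[of x z u e q e] ue q je x z nu by blast
        qed
      qed
    then have "i \<in> {x, z}" "k \<in> {x, z}" by blast+
    then have ik: "i \<in> Y" "k \<in> Y" using x z by auto
    show False
    proof (cases "S - Y = {}")
      case True
      have "card (insert i (insert k S)) = card Y" using card fin nS d by simp
      moreover have "insert i (insert k S) \<subseteq> Y" using True ik by blast
      ultimately show False using ne card_subset_eq[OF fin(1)] by blast
    next
      case False
      then obtain q where "q \<in> S" "q \<notin> Y" by blast
      then show False using crosses_split[OF c, of q] one je ik by blast
    qed
  qed
qed

text \<open>In padded form \<open>insert i X\<close> becomes \<open>insert i (insert e S)\<close>,
  and \<open>insert i (insert j X)\<close> becomes \<open>insert i (insert j S)\<close>. The flip is
  the square move with corners \<open>i, j, k, e\<close>, and the two conclusions are its two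
  directions.\<close>

lemma flip_separated:
  assumes n: "X \<subseteq> {1..n}" "Y \<subseteq> {1..n}" "i \<in> {1..n}" "j \<in> {1..n}" "k \<in> {1..n}"
    and l: "i < j" "j < k" and nX: "i \<notin> X" "j \<notin> X" "k \<notin> X"
    and w: "weakly_separated Y (insert i X)" "weakly_separated Y (insert k X)"
      "weakly_separated Y (insert i (insert j X))" "weakly_separated Y (insert j (insert k X))"
  shows "Y = insert i (insert k X) \<or> weakly_separated Y (insert j X)"
    and "Y = insert j X \<or> weakly_separated Y (insert i (insert k X))"
proof -
  have finX: "finite X" and finY: "finite Y" using n by (auto intro: finite_subset)
  define R where "R = max (card Y) (card X + 2)"
  have R: "card Y \<le> R" "card X + 2 \<le> R" unfolding R_def by auto
  define S where "S = X \<union> {n<..n + (R - card X - 2)}"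
  \<comment> \<open>The element that pads sets of size \<open>card X + 1\<close> but not those of
    size \<open>card X + 2\<close>.\<close>
  define e where "e = n + (R - card X - 1)"
  have ne: "n < e" using R unfolding e_def by simp
  then have "e \<notin> X" using n(1) by auto
  then have e: "n < e" "e \<notin> S" using ne R unfolding e_def S_def by auto
  have nS: "i \<notin> S" "j \<notin> S" "k \<notin> S" using nX n unfolding S_def by auto
  have ive: "{n<..n + (R - card X - 1)} = insert e {n<..n + (R - card X - 2)}" using R unfolding e_def by auto
  have p1: "pad n R (insert u X) = insert u (insert e S)" if "u \<notin> X" for u
  proof -
    have eq: "R - card (insert u X) = R - card X - 1" using that finX by simp
    show ?thesis unfolding pad_def S_def eq ive by auto
  qed
  have p2: "pad n R (insert u (insert v X)) = insert u (insert v S)" if "u \<notin> X" "v \<notin> X" "u \<noteq> v" for u v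
  proof -
    have eq: "R - card (insert u (insert v X)) = R - card X - 2" using that finX by simp
    show ?thesis unfolding pad_def S_def eq by auto
  qed
  have c1: "card (insert u X) \<le> R" "card (insert u (insert v X)) \<le> R" for u v
    using finX R by (simp_all add: card_insert_if)
  have sub: "insert u X \<subseteq> {1..n}" "insert u (insert v X) \<subseteq> {1..n}" if "u \<in> {1..n}" "v \<in> {1..n}" for u v
    using that n by auto
  let ?P = "pad n R Y"
  have cP: "card ?P = R" "finite ?P" using card_pad[OF n(2) R(1)] by auto
  have finS: "finite S" unfolding S_def using finX by simp
  have cS: "card ?P = card S + 2"
  proof -
    have "X \<inter> {n<..n + (R - card X - 2)} = {}" using n(1) by auto
    then have "card S = card X + (R - card X - 2)" unfolding S_def using finX by (simp add: card_Un_disjoint)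
    then show ?thesis using cP R by simp
  qed
  have sides: "noncrossing ?P (insert i (insert j S))" "noncrossing ?P (insert j (insert k S))"
    "noncrossing ?P (insert k (insert e S))" "noncrossing ?P (insert i (insert e S))"
    using w weakly_separated_pad[OF n(2) sub(1)[OF n(3,3)] R(1) c1(1)] weakly_separated_pad[OF n(2) sub(1)[OF n(5,5)] R(1) c1(1)]
      weakly_separated_pad[OF n(2) sub(2)[OF n(3,4)] R(1) c1(2)] weakly_separated_pad[OF n(2) sub(2)[OF n(4,5)] R(1) c1(2)]
      p1 p2 nX l by auto
  have ne: "i \<noteq> j" "i \<noteq> k" "i \<noteq> e" "j \<noteq> k" "j \<noteq> e" "k \<noteq> e" using l e n by auto
  have "j < e" "k < e" using e n by auto
  then have cr: "crosses i k j e" "crosses j e i k" using l unfolding crosses_def by auto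
  have eqY: "Y = V" if "?P = pad n R V" "V \<subseteq> {1..n}" for V
    using pad_inter[OF n(2), of R] pad_inter[OF that(2), of R] that(1) by simp
  have "?P = insert i (insert k S) \<or> noncrossing ?P (insert j (insert e S))"
    using square_move[OF cP(2) finS cS nS e(2) ne cr(1) sides] .
  then show "Y = insert i (insert k X) \<or> weakly_separated Y (insert j X)"
    using eqY[OF _ sub(2)[OF n(3,5)]] p2[of i k] p1[of j] nX ne weakly_separated_pad[OF n(2) sub(1)[OF n(4,4)] R(1) c1(1)] by metis
  have "?P = insert j (insert e S) \<or> noncrossing ?P (insert i (insert k S))"
    using square_move[OF cP(2) finS cS nS(2) nS(1) e(2) nS(3) _ _ _ _ _ _ cr(2), unfolded insert_commute[of j i] insert_commute[of e k] insert_commute[of e i] insert_commute[of k j]]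
      sides ne by (metis insert_commute)
  then show "Y = insert j X \<or> weakly_separated Y (insert i (insert k X))"
    using eqY[OF _ sub(1)[OF n(4,4)]] p2[of i k] p1[of j] nX ne weakly_separated_pad[OF n(2) sub(2)[OF n(3,5)] R(1) c1(2)] by metis
qed

text \<open>In a chain, a larger set met earlier is only chord separated from the current
  collection, so padding is no help. Here the surplus of \<open>Y\<close> provides a third element
  of \<open>Y - X\<close>, which splits the chord \<open>i k\<close> as in the square move.\<close>

lemma flip_chord_separated:
  assumes fin: "finite X" "finite Y" and card: "card X + 2 \<le> card Y"
    and l: "i < j" "j < k" and nX: "i \<notin> X" "j \<notin> X" "k \<notin> X"
    and w: "noncrossing Y (insert i X)" "noncrossing Y (insert k X)"
      "noncrossing Y (insert i (insert j X))" "noncrossing Y (insert j (insert k X))"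
  shows "noncrossing Y (insert j X)"
proof (rule ccontr)
  assume "\<not> ?thesis"
  then obtain x z m m' where x: "x \<in> Y" "x \<notin> X" "x \<noteq> j" and z: "z \<in> Y" "z \<notin> X" "z \<noteq> j"
    and m: "m \<in> insert j X" "m \<notin> Y" and m': "m' \<in> insert j X" "m' \<notin> Y"
    and cr: "crosses x z m m'" unfolding noncrossing_def by blast
  have "m \<noteq> m'" using cr unfolding crosses_def by blast
  then obtain p q where p: "p \<in> X" "p \<notin> Y" and q: "q \<in> insert j X" "q \<notin> Y" and cr: "crosses x z p q"
    using m m' cr crosses_swap(2) by blast
  have side: False if "x \<in> Y" "z \<in> Y" "x \<notin> A" "z \<notin> A" "noncrossing Y A" "q \<in> A" "p \<in> A" "crosses x z p q" for x z A
    using noncrossingD[OF that(5), of x z p q] that p q by blast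
  have ik: "i \<noteq> j" "k \<noteq> j" "i \<noteq> k" using l by auto
  have "u \<in> {x, z}" if "u = i \<or> u = k" for u
  proof (rule ccontr)
    assume "u \<notin> {x, z}"
    moreover have "noncrossing Y (insert j (insert u X))" using w that by (auto simp: insert_commute)
    ultimately show False using side[of x z "insert j (insert u X)"] x z p q cr by blast
  qed
  then have "i \<in> {x, z}" "k \<in> {x, z}" by blast+
  then have xz: "(x = i \<and> z = k) \<or> (x = k \<and> z = i)" using ik(3) by blast
  then have ikY: "i \<in> Y" "k \<in> Y" using x(1) z(1) by blast+
  have cr: "crosses i k p q" using xz cr crosses_swap(1)[OF cr] by blast
  obtain y where y: "y \<in> Y" "y \<notin> X" "y \<noteq> i" "y \<noteq> k"
    using obtain_outside[of Y X "{p}" i k] fin card p by auto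
  have W: "noncrossing Y (insert u (insert j X))" "noncrossing Y (insert u X)" if "u = i \<or> u = k" for u
    using w that by (auto simp: insert_commute)
  have step: False if "u = i \<or> u = k" "v = i \<or> v = k" "u \<noteq> v" "crosses u y p q" for u v
  proof (cases "q = j")
    case True
    then have "y \<noteq> j" using y q by blast
    then show False using side[of u y "insert v (insert j X)"] W(1)[OF that(2)] that ikY y p True nX ik by blast
  next
    case False
    then show False using side[of u y "insert v X"] W(2)[OF that(2)] that ikY y p q nX by blast
  qed
  from crosses_split'[OF cr, of y] show False using step[of i k] step[of k i] ik by blast
qed

lemma not_weakly_separated_flip:
  assumes "finite X" "i < j" "j < k" "i \<notin> X" "j \<notin> X" "k \<notin> X"
  shows "\<not> weakly_separated (insert j X) (insert i (insert k X))"
proof -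
  have "card (insert j X) < card (insert i (insert k X))" using assms by simp
  moreover have "\<not> surrounds (insert j X) (insert i (insert k X))"
    using assms unfolding surrounds_def by (metis DiffI insertCI insertE order_less_imp_not_eq)
  ultimately show ?thesis using weakly_separated_card_less by blast
qed

section \<open>Maximal weakly separated collections under flips\<close>

abbreviation max_weak :: "nat \<Rightarrow> nat set set \<Rightarrow> bool" where
  "max_weak \<equiv> maximal_separated_collection weakly_separated"

lemma maximal_separated_collection_iff:
  assumes sym: "\<And>A B. sep A B = sep B A"
  shows "maximal_separated_collection sep n W \<longleftrightarrow> W \<subseteq> Pow {1..n} \<and> pairwise sep W \<and>
     (\<forall>Z. Z \<subseteq> {1..n} \<longrightarrow> (\<forall>Y\<in>W. Y \<noteq> Z \<longrightarrow> sep Y Z) \<longrightarrow> Z \<in> W)"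
proof
  assume m: "maximal_separated_collection sep n W"
  have s: "W \<subseteq> Pow {1..n}" "pairwise sep W"
    using m unfolding maximal_separated_collection_def separated_collection_def by auto
  moreover have "Z \<in> W" if Z: "Z \<subseteq> {1..n}" "\<forall>Y\<in>W. Y \<noteq> Z \<longrightarrow> sep Y Z" for Z
  proof -
    have "pairwise sep (insert Z W)" using s(2) Z(2) sym unfolding pairwise_insert by blast
    then have "separated_collection sep n (insert Z W)" using s(1) Z(1) unfolding separated_collection_def by blast
    then show ?thesis using m unfolding maximal_separated_collection_def by blast
  qed
  ultimately show "W \<subseteq> Pow {1..n} \<and> pairwise sep W \<and>
     (\<forall>Z. Z \<subseteq> {1..n} \<longrightarrow> (\<forall>Y\<in>W. Y \<noteq> Z \<longrightarrow> sep Y Z) \<longrightarrow> Z \<in> W)" by blast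
next
  assume h: "W \<subseteq> Pow {1..n} \<and> pairwise sep W \<and>
     (\<forall>Z. Z \<subseteq> {1..n} \<longrightarrow> (\<forall>Y\<in>W. Y \<noteq> Z \<longrightarrow> sep Y Z) \<longrightarrow> Z \<in> W)"
  have "G = W" if G: "separated_collection sep n G" "W \<subseteq> G" for G
  proof
    show "G \<subseteq> W"
    proof
      fix Z assume Z: "Z \<in> G"
      then have "Z \<subseteq> {1..n}" using G unfolding separated_collection_def by blast
      moreover have "\<forall>Y\<in>W. Y \<noteq> Z \<longrightarrow> sep Y Z"
        using G Z unfolding separated_collection_def pairwise_def by blast
      ultimately show "Z \<in> W" using h by blast
    qed
  qed (use G in blast)
  then show "maximal_separated_collection sep n W"
    unfolding maximal_separated_collection_def using h by (simp add: separated_collection_def)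
qed

lemmas max_weak_iff = maximal_separated_collection_iff[of weakly_separated, OF weakly_separated_sym]
lemmas max_chord_iff = maximal_separated_collection_iff[of chord_separated, OF chord_separated_sym]

lemma max_weak_sub: "max_weak n W \<Longrightarrow> A \<in> W \<Longrightarrow> A \<subseteq> {1..n}"
  unfolding max_weak_iff by blast

lemma max_weakD: "max_weak n W \<Longrightarrow> A \<in> W \<Longrightarrow> B \<in> W \<Longrightarrow> weakly_separated A B"
  unfolding max_weak_iff pairwise_def by (cases "A = B") auto

lemma max_weak_mem: "max_weak n W \<Longrightarrow> Z \<subseteq> {1..n} \<Longrightarrow> (\<And>Y. Y \<in> W \<Longrightarrow> weakly_separated Y Z) \<Longrightarrow> Z \<in> W"
proof -
  assume h: "max_weak n W" "Z \<subseteq> {1..n}" "\<And>Y. Y \<in> W \<Longrightarrow> weakly_separated Y Z"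
  have "\<forall>Z. Z \<subseteq> {1..n} \<longrightarrow> (\<forall>Y\<in>W. Y \<noteq> Z \<longrightarrow> weakly_separated Y Z) \<longrightarrow> Z \<in> W"
    using h(1) unfolding max_weak_iff by (elim conjE)
  then show "Z \<in> W" using h(2,3) by simp
qed

lemma max_weak_finite: "max_weak n W \<Longrightarrow> finite W"
  unfolding max_weak_iff by (meson finite_Pow_iff finite_atLeastAtMost finite_subset)

lemma max_weakI:
  assumes "W \<subseteq> Pow {1..n}" "\<And>A B. A \<in> W \<Longrightarrow> B \<in> W \<Longrightarrow> A \<noteq> B \<Longrightarrow> weakly_separated A B"
    "\<And>Z. Z \<subseteq> {1..n} \<Longrightarrow> (\<And>Y. Y \<in> W \<Longrightarrow> weakly_separated Y Z) \<Longrightarrow> Z \<in> W"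
  shows "max_weak n W"
  unfolding max_weak_iff pairwise_def using assms weakly_separated_refl by metis

definition flip_site :: "nat set set \<Rightarrow> nat set \<Rightarrow> nat \<Rightarrow> nat \<Rightarrow> nat \<Rightarrow> bool" where
  "flip_site W X i j k \<longleftrightarrow> i < j \<and> j < k \<and> i \<notin> X \<and> j \<notin> X \<and> k \<notin> X \<and> insert i X \<in> W \<and> insert k X \<in> W \<and>
     insert i (insert j X) \<in> W \<and> insert j (insert k X) \<in> W"

lemma flip_site_sub:
  assumes "flip_site W X i j k" "W \<subseteq> Pow {1..n}"
  shows "X \<subseteq> {1..n}" "i \<in> {1..n}" "j \<in> {1..n}" "k \<in> {1..n}"
  using assms unfolding flip_site_def by blast+

text \<open>Separation from the four sides of the square implies separation from \<open>A\<close>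
  for every set other than \<open>B\<close>. Hence a set that fits the new collection is
  \<open>B\<close> itself or already fits the old one.\<close>

lemma max_weak_exchange:
  assumes W: "max_weak n W" and s: "flip_site W X i j k"
    and AB: "A = insert i (insert k X) \<and> B = insert j X \<or> A = insert j X \<and> B = insert i (insert k X)"
    and A: "A \<in> W"
  shows "max_weak n (insert B (W - {A}))" "B \<notin> W"
proof -
  have Wsub: "W \<subseteq> Pow {1..n}" using W unfolding max_weak_iff by blast
  note sub = flip_site_sub[OF s Wsub]
  have h: "i < j" "j < k" "i \<notin> X" "j \<notin> X" "k \<notin> X" and m: "insert i X \<in> W" "insert k X \<in> W"
    "insert i (insert j X) \<in> W" "insert j (insert k X) \<in> W" using s unfolding flip_site_def by auto
  have finX: "finite X" using sub(1) by (rule finite_subset) simp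
  have n1: "\<not> weakly_separated A B" using not_weakly_separated_flip[OF finX h] AB weakly_separated_sym by blast
  then show BW: "B \<notin> W" using max_weakD[OF W A] by blast
  have sep: "Y = A \<or> weakly_separated Y B" "Y = B \<or> weakly_separated Y A" if Y: "Y \<subseteq> {1..n}"
    "weakly_separated Y (insert i X)" "weakly_separated Y (insert k X)"
    "weakly_separated Y (insert i (insert j X))" "weakly_separated Y (insert j (insert k X))" for Y
    using flip_separated[OF sub(1) Y(1) sub(2-4) h Y(2-5)] AB by blast+
  have sq: "insert i X \<noteq> A" "insert k X \<noteq> A" "insert i (insert j X) \<noteq> A" "insert j (insert k X) \<noteq> A"
    using AB h by (metis insertCI insertE order_less_irrefl order_less_trans)+
  show "max_weak n (insert B (W - {A}))"
  proof (rule max_weakI)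
    show "insert B (W - {A}) \<subseteq> Pow {1..n}" using Wsub sub AB by blast
  next
    have YB: "weakly_separated Y B" if "Y \<in> W" "Y \<noteq> A" for Y
      using sep(1)[of Y] that m max_weakD[OF W] Wsub by blast
    fix Y Z assume "Y \<in> insert B (W - {A})" "Z \<in> insert B (W - {A})" "Y \<noteq> Z"
    then show "weakly_separated Y Z" using YB weakly_separated_sym max_weakD[OF W] by blast
  next
    fix Z assume Z: "Z \<subseteq> {1..n}" and w: "\<And>Y. Y \<in> insert B (W - {A}) \<Longrightarrow> weakly_separated Y Z"
    show "Z \<in> insert B (W - {A})"
    proof (cases "Z = B")
      case False
      have wZ: "weakly_separated Z Y" if "Y \<in> W" "Y \<noteq> A" for Y
        using w[of Y] that weakly_separated_sym[of Y Z] by simp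
      have "weakly_separated A Z" using sep(2)[OF Z wZ wZ wZ wZ] m sq False weakly_separated_sym[of Z A] by simp
      then have "Z \<in> W" using max_weak_mem[OF W Z] w by blast
      moreover have "Z \<noteq> A" using w[of B] n1 weakly_separated_sym by blast
      ultimately show ?thesis by blast
    qed simp
  qed
qed

section \<open>Existence of flips\<close>

definition convex_nat :: "nat set \<Rightarrow> bool" where
  "convex_nat A \<longleftrightarrow> (\<forall>x\<in>A. \<forall>z\<in>A. \<forall>y. x < y \<longrightarrow> y < z \<longrightarrow> y \<in> A)"

lemma convex_natD: "convex_nat A \<Longrightarrow> x \<in> A \<Longrightarrow> z \<in> A \<Longrightarrow> x < y \<Longrightarrow> y < z \<Longrightarrow> y \<in> A"
  unfolding convex_nat_def by blast

lemma surrounds_convex: "convex_nat I \<Longrightarrow> surrounds Y I"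
  unfolding surrounds_def using convex_natD by blast

text \<open>An interval is surrounded by every set, so the members above level \<open>r\<close> put
  no restriction on sets of size at most \<open>r\<close>.\<close>

locale top_nonconvex =
  fixes n :: nat and W :: "nat set set" and r :: nat and A0 :: "nat set"
  assumes W: "max_weak n W" and A0: "A0 \<in> W" "\<not> convex_nat A0" "card A0 = r"
    and top: "A \<in> W \<Longrightarrow> r < card A \<Longrightarrow> convex_nat A"
begin

lemma W_sub: "A \<in> W \<Longrightarrow> A \<subseteq> {1..n}" using max_weak_sub[OF W] .

lemma W_fin: "A \<in> W \<Longrightarrow> finite A" using W_sub by (meson finite_atLeastAtMost finite_subset)

lemma r_bounds: "2 \<le> r" "r \<le> n"
proof -
  obtain x y z where "x \<in> A0" "z \<in> A0" "x < y" "y < z" using A0(2) unfolding convex_nat_def by blast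
  moreover have "card {x, z} \<le> card A0" using calculation(1,2) W_fin[OF A0(1)] by (intro card_mono) auto
  ultimately have "2 \<le> card A0" by simp
  then show "2 \<le> r" using A0(3) by simp
  show "r \<le> n" using card_mono[OF _ W_sub[OF A0(1)]] A0(3) by simp
qed

lemma convex_mem:
  assumes I: "convex_nat I" "I \<subseteq> {1..n}" "r \<le> card I"
  shows "I \<in> W"
proof (rule max_weak_mem[OF W I(2)])
  fix Y assume Y: "Y \<in> W"
  show "weakly_separated Y I"
  proof (cases "card Y \<le> card I")
    case True then show ?thesis using surrounds_convex[OF I(1)] unfolding weakly_separated_def by blast
  next
    case False
    then have "surrounds I Y" using top[OF Y] I(3) surrounds_convex by simp
    then show ?thesis using False unfolding weakly_separated_def by simp
  qed
qed

lemma prefix_mem: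
  assumes "m \<le> n" shows "{1..<Suc m} \<in> W"
proof (rule max_weak_mem[OF W])
  show "{1..<Suc m} \<subseteq> {1..n}" using assms by auto
  fix Y assume Y: "Y \<in> W"
  have c: "convex_nat {1..<Suc m}" unfolding convex_nat_def by auto
  have "surrounds {1..<Suc m} Y" unfolding surrounds_def using W_sub[OF Y] by fastforce
  then show "weakly_separated Y {1..<Suc m}"
    using surrounds_convex[OF c, of Y] unfolding weakly_separated_def by (metis linear)
qed

definition padded :: "nat set set" where "padded = pad n r ` {A\<in>W. card A \<le> r}"

lemma pad_r: "card A = r \<Longrightarrow> pad n r A = A" unfolding pad_def by simp

lemma pad_r1:
  assumes "card A = r - 1" shows "pad n r A = insert (Suc n) A"
proof -
  have "{n<..n + (r - card A)} = {Suc n}" using assms r_bounds(1) by auto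
  then show ?thesis unfolding pad_def by simp
qed

text \<open>Maximality of \<open>W\<close> enters the walk here: the third vertex of a triangle
  found in the padded family belongs to \<open>W\<close>.\<close>

lemma padded_free:
  assumes D: "D \<subseteq> {1..n}" "card D \<le> r" and nc: "\<And>B. B \<in> padded \<Longrightarrow> noncrossing (pad n r D) B"
  shows "D \<in> W"
proof (rule max_weak_mem[OF W D(1)])
  fix Y assume Y: "Y \<in> W"
  show "weakly_separated Y D"
  proof (cases "card Y \<le> r")
    case True
    then have "noncrossing (pad n r D) (pad n r Y)" using nc Y unfolding padded_def by blast
    then show ?thesis using weakly_separated_pad[OF W_sub[OF Y] D(1) True D(2)] noncrossing_sym by blast
  next
    case False
    then have "surrounds D Y" using top[OF Y] surrounds_convex by simp
    then show ?thesis using False D(2) unfolding weakly_separated_def by simp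
  qed
qed

lemma padded_edge_family:
  assumes "finite S" "card S = r - 1" "a < b" "a \<notin> S" "b \<notin> S" "insert a S \<in> padded" "insert b S \<in> padded"
  shows "edge_family padded S a b"
proof
  fix B assume "B \<in> padded"
  then obtain A where A: "A \<in> W" "card A \<le> r" "B = pad n r A" unfolding padded_def by blast
  show "finite B" "card B = Suc (card S)" using card_pad[OF W_sub[OF A(1)] A(2)] A(3) assms(2) r_bounds(1) by auto
next
  fix B D assume "B \<in> padded" "D \<in> padded"
  then show "noncrossing B D" unfolding padded_def
    using weakly_separated_pad[OF W_sub W_sub] max_weakD[OF W] by blast
qed (use assms in auto)

lemma padded_bound: "B \<in> padded \<Longrightarrow> B \<subseteq> {..<Suc (n + r)}"
  unfolding padded_def pad_def using W_sub by fastforce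

section \<open>The strip between two levels\<close>

definition edge :: "nat set \<Rightarrow> nat \<Rightarrow> bool" where
  "edge Y c \<longleftrightarrow> c \<notin> Y \<and> Y \<in> W \<and> insert c Y \<in> W \<and> card Y = r - 1"

lemma edge_facts:
  assumes "edge Y c"
  shows "finite Y" "Y \<subseteq> {1..n}" "c \<in> {1..n}" "card (insert c Y) = r" "insert c Y \<in> padded" "insert (Suc n) Y \<in> padded"
proof -
  have e: "c \<notin> Y" "Y \<in> W" "insert c Y \<in> W" "card Y = r - 1" using assms unfolding edge_def by auto
  show f: "finite Y" and s: "Y \<subseteq> {1..n}" using W_fin W_sub e by auto
  show "c \<in> {1..n}" using W_sub[OF e(3)] by blast
  show c: "card (insert c Y) = r" using e f r_bounds(1) by simp
  show "insert c Y \<in> padded" using pad_r[OF c] c e(3) unfolding padded_def by (metis (mono_tags, lifting) imageI le_refl mem_Collect_eq)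
  show "insert (Suc n) Y \<in> padded" using pad_r1[OF e(4)] e(2,4) unfolding padded_def
    by (metis (mono_tags, lifting) diff_le_self imageI mem_Collect_eq)
qed

text \<open>Padded to size \<open>r\<close>, the set \<open>Y\<close> becomes
  \<open>insert (Suc n) Y\<close>, so the step from \<open>Y\<close> up to \<open>insert c Y\<close>
  is an edge with ends \<open>c\<close> and \<open>Suc n\<close> over \<open>Y\<close>. A white
  triangle on it keeps the lower set, a black one keeps the upper set.\<close>

lemma next_edge:
  assumes e: "edge Y c" and ne: "{c<..n} - Y \<noteq> {} \<or> (\<exists>q\<in>Y. q < c)"
  shows "(\<exists>c'. c < c' \<and> edge Y c') \<or> (\<exists>d\<in>Y. d < c \<and> edge (insert c Y - {d}) d)"
proof -
  note f = edge_facts[OF e]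
  have e': "c \<notin> Y" "Y \<in> W" "insert c Y \<in> W" "card Y = r - 1" using e unfolding edge_def by auto
  interpret E: edge_family padded Y c "Suc n"
  proof (rule padded_edge_family[OF f(1) e'(4) _ e'(1) _ f(5,6)])
    show "c < Suc n" using f(3) by simp
    show "Suc n \<notin> Y" using f(2) by auto
  qed
  have "{c<..<Suc n} - Y \<noteq> {} \<or> (\<exists>q\<in>Y. q < c \<or> Suc n < q)"
    using ne by (auto simp: less_Suc_eq_le greaterThanLessThan_def greaterThanAtMost_def lessThan_Suc_atMost)
  from E.triangle_on_edge[OF padded_bound this] show ?thesis
  proof
    assume "\<exists>c'. c < c' \<and> c' < Suc n \<and> c' \<notin> Y \<and> (\<forall>B\<in>padded. noncrossing (insert c' Y) B)"
    then obtain c' where c': "c < c'" "c' < Suc n" "c' \<notin> Y" "\<And>B. B \<in> padded \<Longrightarrow> noncrossing (insert c' Y) B" by blast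
    have cd: "card (insert c' Y) = r" using c'(3) f(1) e'(4) r_bounds(1) by simp
    have "insert c' Y \<in> W" using padded_free[of "insert c' Y"] c' f(2,3) cd pad_r[OF cd] by auto
    then show ?thesis using c' e' unfolding edge_def by blast
  next
    assume "\<exists>q\<in>Y. (q < c \<or> Suc n < q) \<and> (\<forall>B\<in>padded. noncrossing (insert c (insert (Suc n) Y) - {q}) B)"
    then obtain q where q: "q \<in> Y" "q < c \<or> Suc n < q"
      "\<And>B. B \<in> padded \<Longrightarrow> noncrossing (insert c (insert (Suc n) Y) - {q}) B" by blast
    have qn: "q \<le> n" "q < c" using q(1,2) f(2) by auto
    have cd: "card (insert c Y - {q}) = r - 1" using q(1) f(1,4) by (simp add: card_Diff_singleton_if)
    have "insert (Suc n) (insert c Y - {q}) = insert c (insert (Suc n) Y) - {q}" using qn by auto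
    then have "noncrossing (pad n r (insert c Y - {q})) B" if "B \<in> padded" for B
      using q(3)[OF that] pad_r1[OF cd] by simp
    moreover have "insert c Y - {q} \<subseteq> {1..n}" "card (insert c Y - {q}) \<le> r" using f(2,3) cd by auto
    ultimately have "insert c Y - {q} \<in> W" using padded_free by blast
    moreover have "insert q (insert c Y - {q}) = insert c Y" using q(1) by blast
    ultimately have "edge (insert c Y - {q}) q" using cd e' unfolding edge_def by simp
    then show ?thesis using q(1) qn by blast
  qed
qed

text \<open>Two neighbouring upper sets over the same \<open>Y\<close> form an edge inside level
  \<open>r\<close>. By the choice of \<open>c'\<close> no white triangle fits between them, so there
  is a black one. The side on which \<open>q\<close> lies distinguishes an ascent from a
  descent.\<close>

lemma next_edge_triangle:
  assumes e: "edge Y c" and e2: "edge Y c'" and l: "c < c'" and min: "\<And>x. edge Y x \<Longrightarrow> c < x \<Longrightarrow> c' \<le> x"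
    and ne: "{c<..<c'} - Y \<noteq> {} \<or> (\<exists>q\<in>Y. q < c \<or> c' < q)"
  shows "\<exists>q\<in>Y. (q < c \<or> c' < q) \<and> insert c (insert c' Y) - {q} \<in> W"
proof -
  note f = edge_facts[OF e] and f' = edge_facts[OF e2]
  have e': "c \<notin> Y" "c' \<notin> Y" "Y \<in> W" "card Y = r - 1" using e e2 unfolding edge_def by auto
  interpret E: edge_family padded Y c c'
    using padded_edge_family[OF f(1) e'(4) l e'(1,2) f(5) f'(5)] .
  from E.triangle_on_edge[OF padded_bound ne] show ?thesis
  proof
    assume "\<exists>x. c < x \<and> x < c' \<and> x \<notin> Y \<and> (\<forall>B\<in>padded. noncrossing (insert x Y) B)"
    then obtain x where x: "c < x" "x < c'" "x \<notin> Y" "\<And>B. B \<in> padded \<Longrightarrow> noncrossing (insert x Y) B" by blast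
    have cd: "card (insert x Y) = r" using x(3) f(1) e'(4) r_bounds(1) by simp
    have "insert x Y \<in> W" using padded_free[of "insert x Y"] x f(2,3) f'(3) cd pad_r[OF cd] by auto
    then have "edge Y x" using x e' unfolding edge_def by blast
    then show ?thesis using min x by fastforce
  next
    assume "\<exists>q\<in>Y. (q < c \<or> c' < q) \<and> (\<forall>B\<in>padded. noncrossing (insert c (insert c' Y) - {q}) B)"
    then obtain q where q: "q \<in> Y" "q < c \<or> c' < q"
      "\<And>B. B \<in> padded \<Longrightarrow> noncrossing (insert c (insert c' Y) - {q}) B" by blast
    have "card (insert c (insert c' Y)) = Suc r" using e' f(1) l r_bounds(1) by simp
    then have cd: "card (insert c (insert c' Y) - {q}) = r" using q(1) f(1) by (simp add: card_Diff_singleton_if)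
    have "noncrossing (pad n r (insert c (insert c' Y) - {q})) B" if "B \<in> padded" for B
      using q(3)[OF that] pad_r[OF cd] by simp
    moreover have "insert c (insert c' Y) - {q} \<subseteq> {1..n}" "card (insert c (insert c' Y) - {q}) \<le> r"
      using f(2,3) f'(3) cd by auto
    ultimately have "insert c (insert c' Y) - {q} \<in> W" using padded_free by blast
    then show ?thesis using q by blast
  qed
qed

lemma edge_least:
  assumes "c < x" "edge Y x"
  obtains c' where "c < c'" "edge Y c'" "\<And>x. edge Y x \<Longrightarrow> c < x \<Longrightarrow> c' \<le> x"
proof -
  define c' where "c' = (LEAST x. c < x \<and> edge Y x)"
  have "c < c' \<and> edge Y c'" unfolding c'_def by (rule LeastI[of "\<lambda>x. c < x \<and> edge Y x", OF conjI[OF assms]])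
  moreover have "c' \<le> y" if "edge Y y" "c < y" for y
    unfolding c'_def by (rule Least_le) (use that in blast)
  ultimately show ?thesis using that by blast
qed

text \<open>With the factor 2 both kinds of step increase the rank: replacing \<open>d\<close> by
  \<open>c\<close> in \<open>Y\<close> gains \<open>2 * (c - d)\<close>, while the last summand
  loses only \<open>c - d\<close>.\<close>

definition rank :: "nat set \<Rightarrow> nat \<Rightarrow> nat" where "rank Y c = 2 * \<Sum>Y + c"

lemma rank_bound:
  assumes "edge Y c" shows "rank Y c \<le> 2 * (n * n) + n"
proof -
  note f = edge_facts[OF assms]
  have "\<Sum>Y \<le> of_nat (card Y) * n" by (rule sum_bounded_above) (use f in auto)
  also have "\<dots> \<le> n * n" using card_mono[OF _ f(2)] by simp
  finally have "2 * \<Sum>Y \<le> 2 * (n * n)" by (rule mult_le_mono2)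
  moreover have "c \<le> n" using f(3) by simp
  ultimately show ?thesis unfolding rank_def by (rule add_mono)
qed

lemma rank_remove:
  assumes "edge Y c" "d \<in> Y" "d < c"
  shows "rank Y c < rank (insert c Y - {d}) d"
proof -
  note f = edge_facts[OF assms(1)]
  have cY: "c \<notin> Y" using assms(1) unfolding edge_def by blast
  have "\<Sum>(insert c Y) = c + \<Sum>Y" using f(1) cY by simp
  moreover have "\<Sum>(insert c Y) = d + \<Sum>(insert c Y - {d})" using f(1) assms(2) by (subst sum.remove[of _ d]) auto
  ultimately show ?thesis using assms(3) unfolding rank_def by linarith
qed

text \<open>Walk along the edges \<open>(Y, c)\<close>, i.e. from left to right through the strip of the tiling between
  the levels \<open>r - 1\<close> and \<open>r\<close>. The three sets below record that the walk went up at some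
  place; the next step down completes a flip.\<close>

definition ascent :: "nat set \<Rightarrow> nat \<Rightarrow> bool" where
  "ascent Y c \<longleftrightarrow> (\<exists>q j k. q < j \<and> j < k \<and> c \<le> k \<and> q \<in> insert c Y \<and> k \<in> insert c Y \<and> j \<notin> insert c Y \<and>
     insert c Y - {k} \<in> W \<and> insert j (insert c Y - {k}) \<in> W \<and> insert j (insert c Y - {q}) \<in> W)"

lemma ascentI: "\<lbrakk>q < j; j < k; c \<le> k; q \<in> insert c Y; k \<in> insert c Y; j \<notin> insert c Y;
     insert c Y - {k} \<in> W; insert j (insert c Y - {k}) \<in> W; insert j (insert c Y - {q}) \<in> W\<rbrakk> \<Longrightarrow> ascent Y c"
  unfolding ascent_def by blast

definition has_flip :: bool where
  "has_flip \<longleftrightarrow> (\<exists>X i j k. flip_site W X i j k \<and> insert i (insert k X) \<in> W)"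

text \<open>The site of the flip is \<open>Y - {k}\<close>, with \<open>c\<close> in the role of
  \<open>i\<close>.\<close>

lemma has_flipI:
  assumes "edge Y c" "c < j" "j < k" "k \<in> Y" "j \<notin> Y" "insert c Y - {k} \<in> W"
    "insert c (insert j Y) - {k} \<in> W" "insert j Y \<in> W"
  shows has_flip
proof -
  have e: "c \<notin> Y" "Y \<in> W" "insert c Y \<in> W" using assms(1) unfolding edge_def by auto
  have "insert c (Y - {k}) = insert c Y - {k}" "insert k (Y - {k}) = Y"
    "insert c (insert j (Y - {k})) = insert c (insert j Y) - {k}" "insert j (insert k (Y - {k})) = insert j Y"
    "insert c (insert k (Y - {k})) = insert c Y"
    using assms(2-4) by auto
  then have "flip_site W (Y - {k}) c j k" "insert c (insert k (Y - {k})) \<in> W"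
    unfolding flip_site_def using assms e by auto
  then show ?thesis unfolding has_flip_def by blast
qed

lemma ws_crossing:
  assumes "A \<in> W" "B \<in> W" "card A = r" "card B = r" "x \<in> A" "x \<notin> B" "y \<in> A" "y \<notin> B" "m \<in> B" "m \<notin> A"
    "m' \<in> B" "m' \<notin> A" "crosses x y m m'"
  shows False
proof -
  have "noncrossing A B" using max_weakD[OF W assms(1,2)] assms(3,4) weakly_imp_chord_separated
      chord_separated_iff_noncrossing by blast
  then show False using noncrossingD[of A B x y m m'] assms by blast
qed

text \<open>If \<open>k = c\<close> or \<open>k < p\<close>, noncrossing of the set of the descent
  with those recorded by the ascent forces \<open>j = c'\<close>, which also excludes
  \<open>k = c\<close>. Weak separation from the lower set of the ascent excludes
  \<open>p < k\<close>. In the cases \<open>p = k\<close> and \<open>k < p\<close> that remain, the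
  sets at hand form a flip at \<open>Y - {k}\<close>.\<close>

lemma descent_flip:
  assumes e: "edge Y c" and e2: "edge Y c'" and l: "c < c'"
    and asc: "q < j" "j < k" "c \<le> k" "q \<in> insert c Y" "k \<in> insert c Y" "j \<notin> insert c Y"
     "insert c Y - {k} \<in> W" "insert j (insert c Y - {k}) \<in> W" "insert j (insert c Y - {q}) \<in> W"
    and p: "p \<in> Y" "c' < p" "insert c (insert c' Y) - {p} \<in> W"
  shows has_flip
proof -
  note f = edge_facts[OF e] and f' = edge_facts[OF e2]
  have e': "c \<notin> Y" "c' \<notin> Y" "Y \<in> W" "card Y = r - 1" "insert c Y \<in> W" "insert c' Y \<in> W" using e e2 unfolding edge_def by auto
  have fZ: "finite (insert c Y)" using f(1) by simp
  have card_swap: "card (insert y (insert c Y - {x})) = r" if "x \<in> insert c Y" "y \<notin> insert c Y" for x y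
    using that fZ f(4) r_bounds(1) by (simp add: card_Diff_singleton_if)
  have E3: "insert c (insert c' Y) - {p} = insert c' (insert c Y - {p})" using p(2) by auto
  have c'Z: "c' \<notin> insert c Y" using e' l by auto
  have pZ: "p \<in> insert c Y" using p by simp
  have cE3: "card (insert c' (insert c Y - {p})) = r" using card_swap[OF pZ c'Z] .
  have E3W: "insert c' (insert c Y - {p}) \<in> W" using p(3) E3 by simp
  have A3: "card (insert j (insert c Y - {q})) = r" "card (insert j (insert c Y - {k})) = r"
    using card_swap asc by auto
  have jc': "j = c'" if "c = k \<or> k < p"
  proof (rule ccontr)
    assume ne: "j \<noteq> c'"
    have qp: "q < p" using that asc p l by linarith
    have mem: "j \<notin> insert c' (insert c Y - {p})" "p \<in> insert j (insert c Y - {q})" "p \<notin> insert c' (insert c Y - {p})"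
      "q \<in> insert c' (insert c Y - {p})" "q \<notin> insert j (insert c Y - {q})" "c' \<notin> insert j (insert c Y - {q})"
      using ne asc pZ c'Z qp p(2) by auto
    have nj: "\<not> j < c'"
    proof
      assume "j < c'"
      then have "crosses j p q c'" using asc(1) p(2) unfolding crosses_def by auto
      then show False using ws_crossing[OF asc(9) E3W A3(1) cE3, of j p q c'] mem by blast
    qed
    then have "c' < j" using ne by linarith
    then have kp: "k < p" using that l asc by auto
    have "p \<in> insert j (insert c Y - {k})" "k \<in> insert c' (insert c Y - {p})" "k \<notin> insert j (insert c Y - {k})"
      "c' \<notin> insert j (insert c Y - {k})"
      using kp asc pZ c'Z ne by auto
    moreover have "crosses j p k c'" using \<open>c' < j\<close> asc(2) kp unfolding crosses_def by auto
    ultimately show False using ws_crossing[OF asc(8) E3W A3(2) cE3, of j p k c'] mem by blast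
  qed
  have ck: "c < k" using jc' asc(2,3) l by (metis le_neq_implies_less less_trans order_less_irrefl)
  then have kY: "k \<in> Y" using asc(5) by simp
  have "\<not> p < k"
  proof
    assume pk: "p < k"
    \<comment> \<open>The two sets have different sizes, so weak separation says more than
      noncrossing: it gives \<open>surrounds\<close>.\<close>
    have c1: "card (insert c Y - {k}) < card (insert c' (insert c Y - {p}))"
      using cE3 f(4) asc(5) fZ r_bounds(1) by (simp add: card_Diff_singleton_if)
    have "surrounds (insert c Y - {k}) (insert c' (insert c Y - {p}))"
      using max_weakD[OF W asc(7) E3W] weakly_separated_card_less[OF c1] by blast
    moreover have "c' \<in> insert c' (insert c Y - {p})" "c' \<notin> insert c Y - {k}" "k \<in> insert c' (insert c Y - {p})"
      "k \<notin> insert c Y - {k}" "p \<in> insert c Y - {k}" "p \<notin> insert c' (insert c Y - {p})"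
      using c'Z asc(5) pk pZ p(2) by auto
    ultimately show False using surroundsD p(2) pk by blast
  qed
  then consider "p = k" | "k < p" by linarith
  then show ?thesis
  proof cases
    case 1
    then show ?thesis using has_flipI[OF e l, of k] kY e' asc(7) p by simp
  next
    case 2
    then have "j = c'" using jc' by blast
    moreover from this have "insert c (insert c' Y) - {k} = insert j (insert c Y - {k})" using asc(2) by auto
    ultimately show ?thesis using has_flipI[OF e l, of k] kY e' asc by simp
  qed
qed

text \<open>The gap at \<open>j\<close> keeps the walk off the boundary, so there is always a next
  edge. A step over a black triangle keeps the upper set and with it the recorded ascent; a step
  over a white one yields a new ascent or a descent. The rank is bounded, so a descent has to
  come.\<close>

lemma ascent_has_flip: "edge Y c \<Longrightarrow> ascent Y c \<Longrightarrow> has_flip"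
proof (induction "2 * (n * n) + n - rank Y c" arbitrary: Y c rule: less_induct)
  case less
  note e = less.prems(1)
  note f = edge_facts[OF e]
  have e': "c \<notin> Y" "Y \<in> W" "insert c Y \<in> W" using e unfolding edge_def by auto
  have IH: "edge Y' c' \<Longrightarrow> ascent Y' c' \<Longrightarrow> rank Y c < rank Y' c' \<Longrightarrow> has_flip" for Y' c'
    using less.hyps[of Y' c'] rank_bound by (metis diff_less_mono2 le_eq_less_or_eq less_le_trans)
  obtain q j k where a: "q < j" "j < k" "c \<le> k" "q \<in> insert c Y" "k \<in> insert c Y" "j \<notin> insert c Y"
     "insert c Y - {k} \<in> W" "insert j (insert c Y - {k}) \<in> W" "insert j (insert c Y - {q}) \<in> W"
    using less.prems(2) unfolding ascent_def by blast
  have kn: "k \<le> n" using a(5) f(2,3) by auto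
  have "{c<..n} - Y \<noteq> {} \<or> (\<exists>q\<in>Y. q < c)"
  proof (rule ccontr)
    assume n: "\<not> ?thesis"
    then have "c \<le> q" using a(4) by (metis insertE le_refl not_le)
    then have "j \<in> {c<..n} - Y" using a kn by auto
    then show False using n by blast
  qed
  from next_edge[OF e this] show ?case
  proof
    assume "\<exists>d\<in>Y. d < c \<and> edge (insert c Y - {d}) d"
    then obtain d where d: "d \<in> Y" "d < c" "edge (insert c Y - {d}) d" by blast
    have "insert d (insert c Y - {d}) = insert c Y" using d(1) by blast
    then have "ascent (insert c Y - {d}) d" using ascentI[of q j k d "insert c Y - {d}"] a d(2) by simp
    then show ?case using IH[OF d(3)] rank_remove[OF e d(1,2)] by blast
  next
    assume "\<exists>c'. c < c' \<and> edge Y c'"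
    then obtain c' where c': "c < c'" "edge Y c'" "\<And>x. edge Y x \<Longrightarrow> c < x \<Longrightarrow> c' \<le> x" using edge_least by blast
    have c'Y: "c' \<notin> Y" using c' unfolding edge_def by blast
    have "{c<..<c'} - Y \<noteq> {} \<or> (\<exists>q\<in>Y. q < c \<or> c' < q)"
    proof (rule ccontr)
      assume n: "\<not> ?thesis"
      have "c \<le> q" using n a(4) by (metis insertE le_refl not_le)
      moreover have "k < c'" using n a(5) c'(1) c'Y by (metis insertE linorder_neqE_nat)
      ultimately have "j \<in> {c<..<c'} - Y" using a by auto
      then show False using n by blast
    qed
    from next_edge_triangle[OF e c'(2,1,3) this]
    obtain p where p: "p \<in> Y" "p < c \<or> c' < p" "insert c (insert c' Y) - {p} \<in> W" by blast
    from p(2) show ?case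
    proof
      assume "c' < p"
      then show ?case using descent_flip[OF e c'(2,1) a p(1) _ p(3)] by blast
    next
      assume pc: "p < c"
      have "insert c' Y - {c'} = Y" using c'Y by blast
      moreover have "insert c (insert c' Y - {p}) = insert c (insert c' Y) - {p}" using pc by auto
      moreover have "c \<notin> insert c' Y" using e' c' by auto
      ultimately have "ascent Y c'" using ascentI[of p c c' c' Y] pc c'(1) p(1,3) e' by simp
      then show ?case using IH[OF c'(2)] c'(1) unfolding rank_def by simp
    qed
  qed
qed

text \<open>\<open>A0\<close> has \<open>r\<close> elements and a gap \<open>j\<close>, so an
  interval of length \<open>r - 1\<close> through \<open>j\<close> fits strictly between the minimum
  and the maximum of \<open>A0\<close>. As the smaller set it would have to surround
  \<open>A0\<close>, but \<open>j\<close> lies between two elements of \<open>A0\<close> outside the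
  interval.\<close>

lemma interval_missing: "\<exists>s. 1 \<le> s \<and> s + (r - 1) \<le> Suc n \<and> {s..<s + (r - 1)} \<notin> W"
proof -
  obtain x j z where g: "x \<in> A0" "z \<in> A0" "x < j" "j < z" "j \<notin> A0" using A0(2) unfolding convex_nat_def by blast
  have fin: "finite A0" using W_fin[OF A0(1)] .
  define m where "m = Min A0"
  define M where "M = Max A0"
  have mM: "m \<in> A0" "M \<in> A0" "\<And>y. y \<in> A0 \<Longrightarrow> m \<le> y" "\<And>y. y \<in> A0 \<Longrightarrow> y \<le> M"
    using Min_in[OF fin] Max_in[OF fin] Min_le[OF fin] Max_ge[OF fin] g(1) unfolding m_def M_def by blast+
  have mj: "m < j" "j < M" using g mM(3)[OF g(1)] mM(4)[OF g(2)] by auto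
  have "A0 \<subseteq> {m..M} - {j}" using mM g by auto
  then have "card A0 \<le> card ({m..M} - {j})" by (intro card_mono) auto
  then have rM: "m + r \<le> M" using A0(3) mj by (simp add: card_Diff_singleton_if)
  \<comment> \<open>The least start beyond \<open>m\<close> for which the interval reaches
    \<open>j\<close>.\<close>
  define s where "s = max (m + 1) (j - (r - 2))"
  have s: "m < s" "s \<le> j" "j < s + (r - 1)" "s + (r - 1) \<le> M" using mj rM r_bounds unfolding s_def by auto
  have Mn: "M \<le> n" "1 \<le> m" using mM W_sub[OF A0(1)] by auto
  have "{s..<s + (r - 1)} \<notin> W"
  proof
    assume I: "{s..<s + (r - 1)} \<in> W"
    have "card {s..<s + (r - 1)} < card A0" using A0(3) r_bounds by simp
    then have "surrounds {s..<s + (r - 1)} A0" using max_weakD[OF W I A0(1)] weakly_separated_card_less by blast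
    moreover have "m \<notin> {s..<s + (r - 1)}" "M \<notin> {s..<s + (r - 1)}" "j \<in> {s..<s + (r - 1)}" using s by auto
    ultimately show False using surroundsD mM(1,2) mj g(5) by blast
  qed
  then show ?thesis using s Mn by (intro exI[of _ s]) auto
qed

text \<open>Before the first ascent all upper sets are intervals, and each passage to the next one
  goes through an interval of length \<open>r - 1\<close>. A walk to the right end without an ascent
  would put all of these into \<open>W\<close>, against \<open>interval_missing\<close>.\<close>

lemma flip_exists_from_interval:
  "edge Y c \<Longrightarrow> insert c Y = {a..<a + r} \<Longrightarrow> (\<And>s. 1 \<le> s \<Longrightarrow> s \<le> a \<Longrightarrow> {s..<s + (r - 1)} \<in> W) \<Longrightarrow> has_flip"
proof (induction "2 * (n * n) + n - rank Y c" arbitrary: Y c a rule: less_induct)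
  case less
  note e = less.prems(1) and Z = less.prems(2) and B = less.prems(3)
  note f = edge_facts[OF e]
  have e': "c \<notin> Y" "Y \<in> W" "insert c Y \<in> W" using e unfolding edge_def by auto
  have IH: "edge Y' c' \<Longrightarrow> insert c' Y' = {a'..<a' + r} \<Longrightarrow> (\<And>s. 1 \<le> s \<Longrightarrow> s \<le> a' \<Longrightarrow> {s..<s + (r - 1)} \<in> W) \<Longrightarrow>
      rank Y c < rank Y' c' \<Longrightarrow> has_flip" for Y' c' a'
    using less.hyps[of Y' c' a'] rank_bound by (metis diff_less_mono2 le_eq_less_or_eq less_le_trans)
  have cZ: "a \<le> c" "c < a + r" using Z by auto
  have Y: "Y = {a..<a + r} - {c}" using Z e' by blast
  have an: "1 \<le> a" "a + r \<le> Suc n"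
  proof -
    have "insert c Y \<subseteq> {1..n}" using f(2,3) by blast
    then have "{a..<a + r} \<subseteq> {1..n}" using Z by simp
    moreover have "a \<in> {a..<a + r}" "a + r - 1 \<in> {a..<a + r}" using r_bounds by auto
    ultimately have "a \<in> {1..n}" "a + r - 1 \<in> {1..n}" by blast+
    then show "1 \<le> a" "a + r \<le> Suc n" by auto
  qed
  have Ya: "c = a \<Longrightarrow> Y = {Suc a..<Suc a + (r - 1)}" using Y r_bounds by auto
  have "{c<..n} - Y \<noteq> {} \<or> (\<exists>q\<in>Y. q < c)"
  proof (rule ccontr)
    assume n: "\<not> ?thesis"
    have ca: "c = a"
    proof (rule ccontr)
      assume "c \<noteq> a"
      then have "a \<in> Y" "a < c" using Y cZ by auto
      then show False using n by blast
    qed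
    have "\<not> a + r \<le> n"
    proof
      assume "a + r \<le> n"
      then have "a + r \<in> {c<..n} - Y" using Y cZ by auto
      then show False using n by blast
    qed
    then have an': "a + r = Suc n" using an by simp
    obtain s where s: "1 \<le> s" "s + (r - 1) \<le> Suc n" "{s..<s + (r - 1)} \<notin> W" using interval_missing by blast
    have "s \<le> Suc a" using s(2) an' r_bounds by linarith
    then show False using s B[of s] Ya[OF ca] e'(2) by (cases "s = Suc a") auto
  qed
  from next_edge[OF e this] show ?case
  proof
    assume "\<exists>d\<in>Y. d < c \<and> edge (insert c Y - {d}) d"
    then obtain d where d: "d \<in> Y" "d < c" "edge (insert c Y - {d}) d" by blast
    have "insert d (insert c Y - {d}) = {a..<a + r}" using d(1) Z by blast
    then show ?case using IH[OF d(3) _ B] rank_remove[OF e d(1,2)] by blast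
  next
    assume "\<exists>c'. c < c' \<and> edge Y c'"
    then obtain c' where c': "c < c'" "edge Y c'" "\<And>x. edge Y x \<Longrightarrow> c < x \<Longrightarrow> c' \<le> x" using edge_least by blast
    have c'Y: "c' \<notin> Y" "c' \<le> n" using c' edge_facts(3)[OF c'(2)] unfolding edge_def by auto
    have c'a: "a + r \<le> c'" using c'Y c'(1) Y cZ by auto
    show ?case
    proof (cases "c = a")
      case True
      \<comment> \<open>The lower set is now an interval itself. Adding \<open>a + r\<close> gives
        the upper interval shifted by one, which belongs to \<open>W\<close> by
        \<open>convex_mem\<close>.\<close>
      have eq: "insert (a + r) Y = {Suc a..<Suc a + r}" using Ya[OF True] r_bounds by auto
      have "convex_nat {Suc a..<Suc a + r}" unfolding convex_nat_def by auto
      moreover have "{Suc a..<Suc a + r} \<subseteq> {1..n}" using c'a c'Y(2) by auto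
      ultimately have "{Suc a..<Suc a + r} \<in> W" using convex_mem by simp
      then have "insert (a + r) Y \<in> W" using eq by simp
      moreover have "a + r \<notin> Y" using Y by auto
      ultimately have e3: "edge Y (a + r)" using e unfolding edge_def by blast
      have "{s..<s + (r - 1)} \<in> W" if "1 \<le> s" "s \<le> Suc a" for s
        using that B[of s] Ya[OF True] e'(2) by (cases "s = Suc a") auto
      then show ?thesis using IH[OF e3 eq] cZ unfolding rank_def by simp
    next
      case False
      then have aY: "a \<in> Y" "a < c" using Y cZ by auto
      then have "{c<..<c'} - Y \<noteq> {} \<or> (\<exists>q\<in>Y. q < c \<or> c' < q)" by blast
      from next_edge_triangle[OF e c'(2,1,3) this]
      obtain p where p: "p \<in> Y" "p < c \<or> c' < p" "insert c (insert c' Y) - {p} \<in> W" by blast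
      \<comment> \<open>All of \<open>Y\<close> lies to the left of \<open>c'\<close>, so the
        triangle must point to the left: this is an ascent.\<close>
      have "p < a + r" using p(1) Y by auto
      then have pc: "p < c" using p(2) c'a by linarith
      have "insert c' Y - {c'} = Y" using c'Y by blast
      moreover have "insert c (insert c' Y - {p}) = insert c (insert c' Y) - {p}" using pc by auto
      moreover have "c \<notin> insert c' Y" using e' c' by auto
      ultimately have "ascent Y c'" using ascentI[of p c c' c' Y] pc c'(1) p(1,3) e' by simp
      then show ?thesis using ascent_has_flip[OF c'(2)] by blast
    qed
  qed
qed

lemma flip_exists: has_flip
proof -
  have c: "convex_nat {1..<1 + r}" unfolding convex_nat_def by auto
  have eq: "insert r {1..<r} = {1..<1 + r}" using r_bounds by auto
  have m: "{1..<r} \<in> W" using prefix_mem[of "r - 1"] r_bounds by simp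
  have "{1..<1 + r} \<subseteq> {1..n}" using r_bounds(2) by auto
  then have "{1..<1 + r} \<in> W" using convex_mem[OF c] by simp
  then have e: "edge {1..<r} r" using m eq unfolding edge_def by simp
  have "{s..<s + (r - 1)} \<in> W" if "1 \<le> s" "s \<le> 1" for s
  proof -
    have "{s..<s + (r - 1)} = {1..<r}" using that r_bounds by auto
    then show ?thesis using m by simp
  qed
  then show ?thesis using flip_exists_from_interval[OF e eq] by blast
qed

end

lemma lowering_flip_exists:
  assumes W: "max_weak n W" and A: "A \<in> W" "\<not> convex_nat A"
  shows "\<exists>X i j k. flip_site W X i j k \<and> insert i (insert k X) \<in> W"
proof -
  have "card B < Suc n" if "B \<in> W \<and> \<not> convex_nat B" for B
    using card_mono[OF _ max_weak_sub[OF W, of B]] that by simp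
  then obtain A0 where A0: "A0 \<in> W" "\<not> convex_nat A0" "\<And>A. A \<in> W \<Longrightarrow> \<not> convex_nat A \<Longrightarrow> card A \<le> card A0"
    using ex_has_greatest_nat[of "\<lambda>B. B \<in> W \<and> \<not> convex_nat B" A card "Suc n"] A by blast
  interpret top_nonconvex n W "card A0" A0
  proof
    show "convex_nat A" if "A \<in> W" "card A0 < card A" for A using A0(3)[of A] that by linarith
  qed (use W A0 in auto)
  show ?thesis using flip_exists unfolding has_flip_def .
qed

section \<open>Chains of flips\<close>

lemma card_complement: "A \<subseteq> {1..n} \<Longrightarrow> card ({1..n} - A) = n - card A"
  using card_Diff_subset[of A "{1..n}"] by (simp add: finite_subset)

lemma card_sub_le: "A \<subseteq> {1..n} \<Longrightarrow> card A \<le> n" for n :: nat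
  using card_mono[of "{1..n}" A] by simp

lemma weakly_separated_complement:
  assumes "A \<subseteq> {1..n}" "B \<subseteq> {1..n}"
  shows "weakly_separated ({1..n} - A) ({1..n} - B) = weakly_separated A B"
proof -
  have d: "({1..n} - A) - ({1..n} - B) = B - A" "({1..n} - B) - ({1..n} - A) = A - B" using assms by blast+
  have "surrounds ({1..n} - A) ({1..n} - B) = surrounds B A" "surrounds ({1..n} - B) ({1..n} - A) = surrounds A B"
    unfolding surrounds_def d by blast+
  moreover have "(card ({1..n} - A) \<le> card ({1..n} - B)) = (card B \<le> card A)"
     "(card ({1..n} - B) \<le> card ({1..n} - A)) = (card A \<le> card B)"
    using assms card_sub_le[OF assms(1)] card_sub_le[OF assms(2)] card_complement[OF assms(1)] card_complement[OF assms(2)]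
    by linarith+
  ultimately show ?thesis unfolding weakly_separated_def by blast
qed

lemma max_weak_complement:
  assumes W: "max_weak n W"
  shows "max_weak n ((\<lambda>A. {1..n} - A) ` W)"
proof (rule max_weakI)
  show "(\<lambda>A. {1..n} - A) ` W \<subseteq> Pow {1..n}" by blast
next
  fix A B assume "A \<in> (\<lambda>A. {1..n} - A) ` W" "B \<in> (\<lambda>A. {1..n} - A) ` W"
  then show "weakly_separated A B"
    using max_weakD[OF W] weakly_separated_complement max_weak_sub[OF W] by auto
next
  fix Z assume Z: "Z \<subseteq> {1..n}" and w: "\<And>Y. Y \<in> (\<lambda>A. {1..n} - A) ` W \<Longrightarrow> weakly_separated Y Z"
  have zz: "{1..n} - ({1..n} - Z) = Z" using Z by blast
  have "{1..n} - Z \<in> W"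
  proof (rule max_weak_mem[OF W])
    fix Y assume Y: "Y \<in> W"
    have "weakly_separated ({1..n} - Y) Z" using w Y by blast
    then show "weakly_separated Y ({1..n} - Z)"
      using weakly_separated_complement[of Y n "{1..n} - Z"] max_weak_sub[OF W Y] zz by simp
  qed blast
  then show "Z \<in> (\<lambda>A. {1..n} - A) ` W" using zz by (metis imageI)
qed

text \<open>Complementation maps a lowering flip at \<open>X\<close> to a raising flip at the
  complement of \<open>X\<close> and \<open>{i, j, k}\<close>.\<close>

lemma raising_flip_exists:
  assumes W: "max_weak n W" and A: "A \<in> W" "\<not> convex_nat ({1..n} - A)"
  shows "\<exists>X i j k. flip_site W X i j k \<and> insert j X \<in> W"
proof -
  have "{1..n} - A \<in> (\<lambda>A. {1..n} - A) ` W" using A(1) by (rule imageI)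
  from lowering_flip_exists[OF max_weak_complement[OF W] this A(2)]
  obtain X i j k where s: "flip_site ((\<lambda>A. {1..n} - A) ` W) X i j k" "insert i (insert k X) \<in> (\<lambda>A. {1..n} - A) ` W"
    by blast
  have inv: "{1..n} - B \<in> W" if "B \<in> (\<lambda>A. {1..n} - A) ` W" for B
  proof -
    obtain A where A: "A \<in> W" "B = {1..n} - A" using \<open>B \<in> _\<close> by blast
    then have "{1..n} - B = A" using max_weak_sub[OF W A(1)] by blast
    then show ?thesis using A by simp
  qed
  note sub = flip_site_sub[OF s(1)]
  have sb: "X \<subseteq> {1..n}" "i \<in> {1..n}" "j \<in> {1..n}" "k \<in> {1..n}" using sub by blast+
  have h: "i < j" "j < k" "i \<notin> X" "j \<notin> X" "k \<notin> X" using s(1) unfolding flip_site_def by simp_all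
  have s': "insert i X \<in> (\<lambda>A. {1..n} - A) ` W" "insert k X \<in> (\<lambda>A. {1..n} - A) ` W"
    "insert i (insert j X) \<in> (\<lambda>A. {1..n} - A) ` W" "insert j (insert k X) \<in> (\<lambda>A. {1..n} - A) ` W"
    using s(1) unfolding flip_site_def by simp_all
  note m = inv[OF s'(1)] inv[OF s'(2)] inv[OF s'(3)] inv[OF s'(4)] inv[OF s(2)]
  define X' where "X' = {1..n} - X - {i, j, k}"
  have eq: "{1..n} - insert i X = insert j (insert k X')" "{1..n} - insert k X = insert i (insert j X')"
    "{1..n} - insert i (insert j X) = insert k X'" "{1..n} - insert j (insert k X) = insert i X'"
    "{1..n} - insert i (insert k X) = insert j X'"
    using h sb unfolding X'_def by auto
  have "flip_site W X' i j k" using h m unfolding flip_site_def eq unfolding X'_def by blast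
  then show ?thesis using m eq by auto
qed

section \<open>Unions of chains of lowering flips\<close>

definition lowers :: "nat set set \<Rightarrow> nat set set \<Rightarrow> bool" where
  "lowers W W' \<longleftrightarrow> (\<exists>X i j k. flip_site W X i j k \<and> insert i (insert k X) \<in> W \<and>
     W' = insert (insert j X) (W - {insert i (insert k X)}))"

text \<open>\<open>S\<close> accumulates the members of all collections of the chain,
  \<open>G\<close> is the last collection. The number of flips is recorded because a comparison with
  \<open>card S\<close> later shows that no set is produced twice.\<close>

inductive lowering_chain :: "nat set set \<Rightarrow> nat set set \<Rightarrow> nat set set \<Rightarrow> nat \<Rightarrow> bool" for A where
  start: "lowering_chain A A A 0"
| step: "lowering_chain A S G m \<Longrightarrow> lowers G G' \<Longrightarrow> lowering_chain A (S \<union> G') G' (Suc m)"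

lemma lowering_chain_sub: "lowering_chain A S G m \<Longrightarrow> A \<subseteq> S \<and> G \<subseteq> S"
  by (induction rule: lowering_chain.induct) auto

lemma lowering_chain_trans:
  "lowering_chain B S' C m' \<Longrightarrow> lowering_chain A S B m \<Longrightarrow> lowering_chain A (S \<union> S') C (m + m')"
proof (induction rule: lowering_chain.induct)
  case start
  then have "S \<union> B = S" using lowering_chain_sub by blast
  then show ?case using start by simp
next
  case (step S1 G m1 G')
  have "lowering_chain A ((S \<union> S1) \<union> G') G' (Suc (m + m1))" using lowering_chain.step[OF step.IH[OF step.prems] step.hyps(2)] .
  then show ?case by (simp add: Un_assoc)
qed

text \<open>The relation between an earlier \<open>Y\<close> and a current \<open>Z\<close> is
  asymmetric: weak if \<open>card Y <= card Z\<close>, otherwise just chord separation. For the new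
  set \<open>insert j X\<close>, \<open>flip_separated\<close> handles the \<open>Y\<close> of size
  up to \<open>card X + 1\<close> and \<open>flip_chord_separated\<close> the larger ones. The new
  set is not in \<open>S\<close>: otherwise it would be weakly separated from the current member
  \<open>insert i (insert k X)\<close>.\<close>

lemma lowering_chain_separated:
  assumes "lowering_chain A S G m" "max_weak n A"
  shows "max_weak n G \<and> S \<subseteq> Pow {1..n} \<and> card S = card A + m \<and>
    (\<forall>Y\<in>S. \<forall>Z\<in>G. (card Y \<le> card Z \<longrightarrow> weakly_separated Y Z) \<and> chord_separated Y Z) \<and>
    (\<forall>Y\<in>S. \<forall>Z\<in>S. chord_separated Y Z)"
  using assms
proof (induction rule: lowering_chain.induct)
  case start
  then show ?case using max_weakD[OF start] max_weak_sub[OF start] weakly_imp_chord_separated by auto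
next
  case (step S G m G')
  then have G: "max_weak n G" and S: "S \<subseteq> Pow {1..n}" and cS: "card S = card A + m"
    and R: "\<And>Y Z. Y \<in> S \<Longrightarrow> Z \<in> G \<Longrightarrow> card Y \<le> card Z \<Longrightarrow> weakly_separated Y Z"
    and Rc: "\<And>Y Z. Y \<in> S \<Longrightarrow> Z \<in> G \<Longrightarrow> chord_separated Y Z"
    and C: "\<And>Y Z. Y \<in> S \<Longrightarrow> Z \<in> S \<Longrightarrow> chord_separated Y Z" by blast+
  have GS: "G \<subseteq> S" using lowering_chain_sub[OF step.hyps(1)] by blast
  obtain X i j k where s: "flip_site G X i j k" and ik: "insert i (insert k X) \<in> G"
    and G': "G' = insert (insert j X) (G - {insert i (insert k X)})"
    using step.hyps(2) unfolding lowers_def by blast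
  have mG': "max_weak n G'" using max_weak_exchange(1)[OF G s _ ik, of "insert j X"] G' by blast
  have Gsub: "G \<subseteq> Pow {1..n}" using S GS by blast
  note sub = flip_site_sub[OF s Gsub]
  have finX: "finite X" using sub(1) by (rule finite_subset) simp
  have h: "i < j" "j < k" "i \<notin> X" "j \<notin> X" "k \<notin> X" and
    m: "insert i X \<in> G" "insert k X \<in> G" "insert i (insert j X) \<in> G" "insert j (insert k X) \<in> G"
    using s unfolding flip_site_def by auto
  have cards: "card (insert i X) = Suc (card X)" "card (insert j X) = Suc (card X)" "card (insert k X) = Suc (card X)"
    "card (insert i (insert j X)) = Suc (Suc (card X))" "card (insert j (insert k X)) = Suc (Suc (card X))"
    "card (insert i (insert k X)) = Suc (Suc (card X))"
    using finX h by auto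
  have new: "insert j X \<notin> S"
  proof
    assume "insert j X \<in> S"
    then have "weakly_separated (insert j X) (insert i (insert k X))" using R[OF _ ik] cards by simp
    then show False using not_weakly_separated_flip[OF finX h] by blast
  qed
  have key: "(card Y \<le> card (insert j X) \<longrightarrow> weakly_separated Y (insert j X)) \<and> chord_separated Y (insert j X)"
    if Y: "Y \<in> S" for Y
  proof (cases "card Y \<le> Suc (card X)")
    case True
    have Yn: "Y \<subseteq> {1..n}" using S Y by blast
    have "weakly_separated Y (insert i X)" "weakly_separated Y (insert k X)"
      "weakly_separated Y (insert i (insert j X))" "weakly_separated Y (insert j (insert k X))"
      using R[OF Y] m cards True by auto
    from flip_separated(1)[OF sub(1) Yn sub(2-4) h this]
    have "Y = insert i (insert k X) \<or> weakly_separated Y (insert j X)" .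
    then have "weakly_separated Y (insert j X)" using cards True by auto
    then show ?thesis using weakly_imp_chord_separated by blast
  next
    case False
    have finY: "finite Y" using S Y by (meson Pow_iff finite_atLeastAtMost finite_subset subsetD)
    have "noncrossing Y (insert i X)" "noncrossing Y (insert k X)"
      "noncrossing Y (insert i (insert j X))" "noncrossing Y (insert j (insert k X))"
      using Rc[OF Y] m chord_separated_iff_noncrossing by blast+
    then have "noncrossing Y (insert j X)" using flip_chord_separated[OF finX finY _ h] False by simp
    then show ?thesis using False cards chord_separated_iff_noncrossing by simp
  qed
  have SG': "S \<union> G' = insert (insert j X) S" using G' GS by blast
  have finS: "finite S" using S by (meson finite_Pow_iff finite_atLeastAtMost finite_subset)
  have rS: "(card Y \<le> card Z \<longrightarrow> weakly_separated Y Z) \<and> chord_separated Y Z" if Y: "Y \<in> insert (insert j X) S" and Z: "Z \<in> G'" for Y Z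
  proof (cases "Y = insert j X")
    case True
    then have "Y \<in> G'" using G' by blast
    then show ?thesis using max_weakD[OF mG'] Z weakly_imp_chord_separated by blast
  next
    case False
    then have "Y \<in> S" using Y by blast
    then show ?thesis using key[of Y] R[of Y Z] Rc[of Y Z] Z G' by blast
  qed
  have cc: "chord_separated Y Z" if "Y \<in> insert (insert j X) S" "Z \<in> insert (insert j X) S" for Y Z
    using that key C chord_separated_sym weakly_imp_chord_separated[OF weakly_separated_refl] by (metis insertE)
  have "card (S \<union> G') = card A + Suc m" unfolding SG' using finS new cS by simp
  moreover have "S \<union> G' \<subseteq> Pow {1..n}" unfolding SG' using S sub by blast
  moreover have "\<forall>Y\<in>S \<union> G'. \<forall>Z\<in>G'. (card Y \<le> card Z \<longrightarrow> weakly_separated Y Z) \<and> chord_separated Y Z"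
    unfolding SG' by (intro ballI) (rule rS)
  moreover have "\<forall>Y\<in>S \<union> G'. \<forall>Z\<in>S \<union> G'. chord_separated Y Z"
    unfolding SG' by (intro ballI) (rule cc)
  ultimately show ?case using mG' by (intro conjI)
qed

text \<open>In the first collection every member surrounds \<open>Z\<close>. When a flip adds
  \<open>insert j X\<close> with the size of \<open>Z\<close>, weak and chord separation coincide.
  When it is smaller, the sides of the square are at most as large as \<open>Z\<close>, hence weakly
  separated from it, and the exception in \<open>flip_separated\<close> would be that
  \<open>Z\<close> is the removed set, which lies in \<open>S\<close>.\<close>

lemma lowering_chain_persist:
  assumes "lowering_chain A S G m" "max_weak n A" and A: "\<And>Y. Y \<in> A \<Longrightarrow> convex_nat ({1..n} - Y)"
    and Z: "Z \<subseteq> {1..n}" and "Z \<notin> S" "\<And>Y. Y \<in> S \<Longrightarrow> chord_separated Y Z" "Y \<in> G" "card Y \<le> card Z"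
  shows "weakly_separated Y Z"
  using assms(1,2,5-)
proof (induction arbitrary: Y rule: lowering_chain.induct)
  case start
  have "surrounds Y Z"
    unfolding surrounds_def using convex_natD[OF A[OF start(4)]] Z by blast
  then show ?case using start(5) unfolding weakly_separated_def by blast
next
  case (step S G m G')
  have G: "max_weak n G" using lowering_chain_separated[OF step.hyps(1) step.prems(1)] by blast
  have GS: "G \<subseteq> S" using lowering_chain_sub[OF step.hyps(1)] by blast
  obtain X i j k where s: "flip_site G X i j k" and ik: "insert i (insert k X) \<in> G"
    and G': "G' = insert (insert j X) (G - {insert i (insert k X)})"
    using step.hyps(2) unfolding lowers_def by blast
  have IH: "weakly_separated V Z" if "V \<in> G" "card V \<le> card Z" for V
    using step.IH[OF step.prems(1) _ _ that] step.prems(2,3) by blast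
  then have IH': "weakly_separated Z V" if "V \<in> G" "card V \<le> card Z" for V
    using that weakly_separated_sym by blast
  show ?case
  proof (cases "Y \<in> G")
    case True then show ?thesis using IH step.prems by blast
  next
    case False
    then have Y: "Y = insert j X" using step.prems(4) G' by blast
    have Gsub: "G \<subseteq> Pow {1..n}" using max_weak_sub[OF G] by blast
    note sub = flip_site_sub[OF s Gsub]
    have finX: "finite X" using sub(1) by (rule finite_subset) simp
    have h: "i < j" "j < k" "i \<notin> X" "j \<notin> X" "k \<notin> X" and
      m: "insert i X \<in> G" "insert k X \<in> G" "insert i (insert j X) \<in> G" "insert j (insert k X) \<in> G"
      using s unfolding flip_site_def by auto
    have cards: "card (insert i X) = Suc (card X)" "card (insert j X) = Suc (card X)" "card (insert k X) = Suc (card X)"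
      "card (insert i (insert j X)) = Suc (Suc (card X))" "card (insert j (insert k X)) = Suc (Suc (card X))"
      using finX h by auto
    have cZ: "chord_separated (insert j X) Z" using step.prems(3)[of Y] step.prems(4) Y by blast
    have "card Z = Suc (card X) \<or> Suc (Suc (card X)) \<le> card Z" using step.prems(5) Y cards by auto
    then show ?thesis
    proof
      assume "card Z = Suc (card X)"
      then show ?thesis using cZ weakly_separated_card_eq[of "insert j X" Z] Y cards by simp
    next
      assume c: "Suc (Suc (card X)) \<le> card Z"
      have "weakly_separated Z (insert i X)" "weakly_separated Z (insert k X)"
        "weakly_separated Z (insert i (insert j X))" "weakly_separated Z (insert j (insert k X))"
        using IH' m cards c by auto
      from flip_separated(1)[OF sub(1) Z sub(2-4) h this]
      show ?thesis using ik GS step.prems(2) Y weakly_separated_sym by blast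
    qed
  qed
qed

lemma lowering_chain_max_chord:
  assumes ch: "lowering_chain A S G m" and mA: "max_weak n A" and A: "\<And>Y. Y \<in> A \<Longrightarrow> convex_nat ({1..n} - Y)"
    and G: "\<And>Y. Y \<in> G \<Longrightarrow> convex_nat Y"
  shows "maximal_separated_collection chord_separated n S"
proof -
  have mG: "max_weak n G" and S: "S \<subseteq> Pow {1..n}" and C: "\<And>Y Z. Y \<in> S \<Longrightarrow> Z \<in> S \<Longrightarrow> chord_separated Y Z"
    using lowering_chain_separated[OF ch mA] by blast+
  have GS: "G \<subseteq> S" using lowering_chain_sub[OF ch] by blast
  have convG: "I \<in> G" if I: "convex_nat I" "I \<subseteq> {1..n}" for I
  proof (rule max_weak_mem[OF mG I(2)])
    fix Y assume "Y \<in> G"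
    then have "surrounds Y I" "surrounds I Y" using surrounds_convex I(1) G by blast+
    then show "weakly_separated Y I" unfolding weakly_separated_def using linear by blast
  qed
  have "Z \<in> S" if Z: "Z \<subseteq> {1..n}" "\<forall>Y\<in>S. Y \<noteq> Z \<longrightarrow> chord_separated Y Z" for Z
  proof (rule ccontr)
    assume ZS: "Z \<notin> S"
    then have "\<not> convex_nat Z" using convG Z(1) GS by blast
    then obtain i j k where g: "i \<in> Z" "k \<in> Z" "i < j" "j < k" "j \<notin> Z" unfolding convex_nat_def by blast
    have finZ: "finite Z" using Z(1) by (rule finite_subset) simp
    have "{i, k} \<subseteq> Z" using g by blast
    then have "card {i, k} \<le> card Z" using finZ by (rule card_mono[rotated])
    then have c: "card {j} < card Z" using g by simp
    have "j \<in> {1..n}" using g(1-4) Z(1) by auto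
    then have "{j} \<in> G" using convG[of "{j}"] unfolding convex_nat_def by auto
    then have "weakly_separated {j} Z"
      using lowering_chain_persist[OF ch mA A Z(1) ZS _ _, of "{j}"] Z(2) ZS c by (metis less_imp_le)
    then have "surrounds {j} Z" using weakly_separated_card_less[OF c] by blast
    then show False using surroundsD[of "{j}" Z i k j] g by auto
  qed
  then have 1: "\<forall>Z. Z \<subseteq> {1..n} \<longrightarrow> (\<forall>Y\<in>S. Y \<noteq> Z \<longrightarrow> chord_separated Y Z) \<longrightarrow> Z \<in> S" by blast
  have 2: "\<forall>Y\<in>S. \<forall>Z\<in>S. Y \<noteq> Z \<longrightarrow> chord_separated Y Z" using C by blast
  show ?thesis unfolding max_chord_iff pairwise_def using S 2 1 by (intro conjI)
qed

section \<open>Flips in the form used by the algorithm\<close>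

definition toggle :: "nat set \<Rightarrow> nat set \<Rightarrow> nat set" where
  "toggle Z D = (Z - D) \<union> (D - Z)"

text \<open>\<open>u\<close> selects lowering flips. Relative to the set \<open>Z\<close> to be
  replaced, the four sides and the replacement are the same symmetric differences in both
  directions, so one program serves for both.\<close>

definition can_flip :: "nat \<Rightarrow> bool \<Rightarrow> nat set set \<Rightarrow> nat set \<Rightarrow> nat \<Rightarrow> nat \<Rightarrow> nat \<Rightarrow> bool" where
  "can_flip n u G Z i j k \<longleftrightarrow> Z \<in> G \<and> 1 \<le> i \<and> i < j \<and> j < k \<and> k \<le> n \<and>
     (i \<in> Z) = u \<and> (k \<in> Z) = u \<and> (j \<in> Z) = (\<not> u) \<and>
     toggle Z {i} \<in> G \<and> toggle Z {i, j} \<in> G \<and> toggle Z {j, k} \<in> G \<and> toggle Z {k} \<in> G"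

lemma can_flip_lower:
  assumes "can_flip n True G Z i j k"
  shows "flip_site G (Z - {i, k}) i j k" "Z = insert i (insert k (Z - {i, k}))" "toggle Z {i, j, k} = insert j (Z - {i, k})"
proof -
  have h: "1 \<le> i" "i < j" "j < k" "i \<in> Z" "k \<in> Z" "j \<notin> Z" and m: "toggle Z {i} \<in> G" "toggle Z {i, j} \<in> G"
    "toggle Z {j, k} \<in> G" "toggle Z {k} \<in> G" using assms unfolding can_flip_def by auto
  have "toggle Z {i} = insert k (Z - {i, k})" "toggle Z {k} = insert i (Z - {i, k})"
    "toggle Z {i, j} = insert j (insert k (Z - {i, k}))" "toggle Z {j, k} = insert i (insert j (Z - {i, k}))"
    using h unfolding toggle_def by auto
  then show "flip_site G (Z - {i, k}) i j k" using h m unfolding flip_site_def by auto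
  show "Z = insert i (insert k (Z - {i, k}))" "toggle Z {i, j, k} = insert j (Z - {i, k})"
    using h unfolding toggle_def by auto
qed

lemma can_flip_raise:
  assumes "can_flip n False G Z i j k"
  shows "flip_site G (Z - {j}) i j k" "Z = insert j (Z - {j})" "toggle Z {i, j, k} = insert i (insert k (Z - {j}))"
proof -
  have h: "1 \<le> i" "i < j" "j < k" "i \<notin> Z" "k \<notin> Z" "j \<in> Z" and m: "toggle Z {i} \<in> G" "toggle Z {i, j} \<in> G"
    "toggle Z {j, k} \<in> G" "toggle Z {k} \<in> G" using assms unfolding can_flip_def by auto
  have "toggle Z {i} = insert i (insert j (Z - {j}))" "toggle Z {k} = insert j (insert k (Z - {j}))"
    "toggle Z {i, j} = insert i (Z - {j})" "toggle Z {j, k} = insert k (Z - {j})"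
    using h unfolding toggle_def by auto
  then show "flip_site G (Z - {j}) i j k" using h m unfolding flip_site_def by auto
  show "Z = insert j (Z - {j})" "toggle Z {i, j, k} = insert i (insert k (Z - {j}))"
    using h unfolding toggle_def by auto
qed

lemma no_can_flip_lower:
  assumes W: "max_weak n W" and n: "\<And>Z i j k. \<not> can_flip n True W Z i j k" and A: "A \<in> W"
  shows "convex_nat A"
proof (rule ccontr)
  assume "\<not> ?thesis"
  then obtain X i j k where s: "flip_site W X i j k" "insert i (insert k X) \<in> W" using lowering_flip_exists[OF W A] by blast
  have h: "i < j" "j < k" "i \<notin> X" "j \<notin> X" "k \<notin> X" and
    m: "insert i X \<in> W" "insert k X \<in> W" "insert i (insert j X) \<in> W" "insert j (insert k X) \<in> W"
    using s unfolding flip_site_def by auto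
  let ?Z = "insert i (insert k X)"
  have "toggle ?Z {i} = insert k X" "toggle ?Z {k} = insert i X"
    "toggle ?Z {i, j} = insert j (insert k X)" "toggle ?Z {j, k} = insert i (insert j X)"
    using h unfolding toggle_def by auto
  moreover have "1 \<le> i" "k \<le> n" using max_weak_sub[OF W s(2)] by auto
  ultimately have "can_flip n True W ?Z i j k" unfolding can_flip_def using s(2) h m by auto
  then show False using n by blast
qed

lemma no_can_flip_raise:
  assumes W: "max_weak n W" and n: "\<And>Z i j k. \<not> can_flip n False W Z i j k" and A: "A \<in> W"
  shows "convex_nat ({1..n} - A)"
proof (rule ccontr)
  assume "\<not> ?thesis"
  then obtain X i j k where s: "flip_site W X i j k" "insert j X \<in> W" using raising_flip_exists[OF W A] by blast
  have h: "i < j" "j < k" "i \<notin> X" "j \<notin> X" "k \<notin> X" and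
    m: "insert i X \<in> W" "insert k X \<in> W" "insert i (insert j X) \<in> W" "insert j (insert k X) \<in> W"
    using s unfolding flip_site_def by auto
  let ?Z = "insert j X"
  have "toggle ?Z {i} = insert i (insert j X)" "toggle ?Z {k} = insert j (insert k X)"
    "toggle ?Z {i, j} = insert i X" "toggle ?Z {j, k} = insert k X"
    using h unfolding toggle_def by auto
  moreover have "1 \<le> i" "k \<le> n" using max_weak_sub[OF W m(1)] max_weak_sub[OF W m(2)] by auto
  ultimately have "can_flip n False W ?Z i j k" unfolding can_flip_def using s(2) h m by auto
  then show False using n by blast
qed

lemma can_flip_max_weak:
  assumes W: "max_weak n W" and f: "can_flip n u W Z i j k"
  shows "max_weak n (insert (toggle Z {i, j, k}) (W - {Z}))" "toggle Z {i, j, k} \<notin> W"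
proof -
  have Z: "Z \<in> W" using f unfolding can_flip_def by blast
  have "max_weak n (insert (toggle Z {i, j, k}) (W - {Z})) \<and> toggle Z {i, j, k} \<notin> W"
  proof (cases u)
    case True
    note c = can_flip_lower[OF f[unfolded True eqTrueI[OF True]]]
    show ?thesis using max_weak_exchange[OF W c(1) _ Z, of "toggle Z {i, j, k}"] c(2,3) by blast
  next
    case False
    then have "can_flip n False W Z i j k" using f by simp
    note c = can_flip_raise[OF this]
    show ?thesis using max_weak_exchange[OF W c(1) _ Z, of "toggle Z {i, j, k}"] c(2,3) by blast
  qed
  then show "max_weak n (insert (toggle Z {i, j, k}) (W - {Z}))" "toggle Z {i, j, k} \<notin> W" by blast+
qed

inductive flips :: "nat \<Rightarrow> bool \<Rightarrow> nat set set \<Rightarrow> nat set list \<Rightarrow> nat set set \<Rightarrow> bool" for n u W where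
  none: "flips n u W [] W"
| more: "flips n u W xs G \<Longrightarrow> can_flip n u G Z i j k \<Longrightarrow>
    flips n u W (xs @ [toggle Z {i, j, k}]) (insert (toggle Z {i, j, k}) (G - {Z}))"

lemma flips_max_weak: "flips n u W xs G \<Longrightarrow> max_weak n W \<Longrightarrow> max_weak n G \<and> card G = card W"
proof (induction rule: flips.induct)
  case (more xs G Z i j k)
  then have G: "max_weak n G" "card G = card W" by blast+
  have "Z \<in> G" using more.hyps(2) unfolding can_flip_def by blast
  then have "Suc (card (G - {Z})) = card G" using max_weak_finite[OF G(1)] by (simp only: card_Suc_Diff1)
  then have "card (insert (toggle Z {i, j, k}) (G - {Z})) = card G"
    using can_flip_max_weak(2)[OF G(1) more.hyps(2)] max_weak_finite[OF G(1)] by simp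
  then show ?case using can_flip_max_weak(1)[OF G(1) more.hyps(2)] G(2) by simp
qed simp

lemma flips_lowering_chain:
  "flips n True W xs G \<Longrightarrow> lowering_chain W (W \<union> set xs) G (length xs)"
proof (induction rule: flips.induct)
  case none
  then show ?case using lowering_chain.start by simp
next
  case (more xs G Z i j k)
  let ?G = "insert (toggle Z {i, j, k}) (G - {Z})"
  have "Z \<in> G" using more.hyps(2) unfolding can_flip_def by blast
  then have "lowers G ?G" unfolding lowers_def using can_flip_lower[OF more.hyps(2)] by (metis (no_types, lifting))
  from lowering_chain.step[OF more.IH this]
  have "lowering_chain W (W \<union> set xs \<union> ?G) ?G (Suc (length xs))" .
  moreover have "W \<union> set xs \<union> ?G = W \<union> set (xs @ [toggle Z {i, j, k}])"
    using lowering_chain_sub[OF more.IH] by auto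
  ultimately show ?case by simp
qed

text \<open>Read backwards, raising flips from \<open>W\<close> are a lowering chain that ends in
  \<open>W\<close>, to which the lowering flips from \<open>W\<close> can be attached.\<close>

lemma flips_raising_chain:
  "flips n False W xs G \<Longrightarrow> max_weak n W \<Longrightarrow> lowering_chain G (W \<union> set xs) W (length xs)"
proof (induction rule: flips.induct)
  case none
  then show ?case using lowering_chain.start by simp
next
  case (more xs G Z i j k)
  let ?T = "toggle Z {i, j, k}"
  let ?G = "insert ?T (G - {Z})"
  have G: "max_weak n G" using flips_max_weak[OF more.hyps(1) more.prems] by blast
  have Z: "Z \<in> G" using more.hyps(2) unfolding can_flip_def by blast
  have T: "?T \<notin> G" using can_flip_max_weak(2)[OF G more.hyps(2)] .
  note c = can_flip_raise[OF more.hyps(2)]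
  have "flip_site ?G (Z - {j}) i j k"
  proof -
    have "x \<in> G \<Longrightarrow> x \<noteq> Z \<Longrightarrow> x \<in> ?G" for x by blast
    moreover have h: "i < j" "j < k" "i \<notin> Z" "k \<notin> Z" "j \<in> Z" using more.hyps(2) unfolding can_flip_def by auto
    moreover have "insert i (Z - {j}) \<noteq> Z" "insert k (Z - {j}) \<noteq> Z" "insert i (insert j (Z - {j})) \<noteq> Z" "insert j (insert k (Z - {j})) \<noteq> Z"
      using h by auto
    ultimately show ?thesis using c(1) unfolding flip_site_def by blast
  qed
  moreover have "G = insert (insert j (Z - {j})) (?G - {insert i (insert k (Z - {j}))})"
    using Z T c(2,3) by auto
  moreover have "insert i (insert k (Z - {j})) \<in> ?G" using c(3) by auto
  ultimately have "lowers ?G G" unfolding lowers_def by blast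
  from lowering_chain.step[OF lowering_chain.start this] have "lowering_chain ?G (?G \<union> G) G 1" by simp
  from lowering_chain_trans[OF more.IH[OF more.prems] this]
  have "lowering_chain ?G (?G \<union> G \<union> (W \<union> set xs)) W (1 + length xs)" .
  moreover have "?G \<union> G \<union> (W \<union> set xs) = W \<union> set (xs @ [?T])"
    using lowering_chain_sub[OF more.IH[OF more.prems]] by auto
  ultimately show ?case by simp
qed

text \<open>The whole chain runs from \<open>H\<close> through \<open>W\<close> to \<open>G\<close>.
  The cardinality of its union is \<open>card H\<close> plus the number of flips, which is the
  length of the output list, so the list has no repetitions.\<close>

lemma flips_max_chord:
  assumes W: "max_weak n W" and Ws: "distinct Ws" "set Ws = W"
    and L: "flips n True W ls G" "\<And>Z i j k. \<not> can_flip n True G Z i j k"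
    and R: "flips n False W rs H" "\<And>Z i j k. \<not> can_flip n False H Z i j k"
  shows "maximal_separated_collection chord_separated n (set (Ws @ ls @ rs))" "distinct (Ws @ ls @ rs)"
proof -
  have mG: "max_weak n G" and mH: "max_weak n H" and cH: "card H = card W"
    using flips_max_weak L(1) R(1) W by blast+
  have ch: "lowering_chain H (W \<union> set rs \<union> (W \<union> set ls)) G (length rs + length ls)"
    using lowering_chain_trans[OF flips_lowering_chain[OF L(1)] flips_raising_chain[OF R(1) W]] .
  have eq: "W \<union> set rs \<union> (W \<union> set ls) = set (Ws @ ls @ rs)" using Ws(2) by auto
  show "maximal_separated_collection chord_separated n (set (Ws @ ls @ rs))"
    using lowering_chain_max_chord[OF ch mH no_can_flip_raise[OF mH R(2)] no_can_flip_lower[OF mG L(2)]] eq by simp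
  have "card (set (Ws @ ls @ rs)) = card H + (length rs + length ls)"
    using lowering_chain_separated[OF ch mH] eq by simp
  also have "card H = length Ws" using cH Ws distinct_card by fastforce
  finally have "card (set (Ws @ ls @ rs)) = length (Ws @ ls @ rs)" by simp
  then show "distinct (Ws @ ls @ rs)" by (rule card_distinct)
qed

definition potential :: "nat \<Rightarrow> bool \<Rightarrow> nat set set \<Rightarrow> nat" where
  "potential n u G = (\<Sum>X\<in>G. if u then card X else n - card X)"

lemma potential_flip:
  assumes G: "max_weak n G" and f: "can_flip n u G Z i j k"
  shows "potential n u G = Suc (potential n u (insert (toggle Z {i, j, k}) (G - {Z})))"
proof -
  let ?T = "toggle Z {i, j, k}"
  have Z: "Z \<in> G" using f unfolding can_flip_def by blast
  have finG: "finite G" using max_weak_finite[OF G] .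
  have T: "?T \<notin> G" "max_weak n (insert ?T (G - {Z}))" using can_flip_max_weak[OF G f] by auto
  have Tn: "?T \<subseteq> {1..n}" "Z \<subseteq> {1..n}" using max_weak_sub[OF T(2), of ?T] max_weak_sub[OF G Z] by auto
  have fin: "finite Z" using Tn(2) by (rule finite_subset) simp
  have ijk: "i < j" "j < k" using f unfolding can_flip_def by auto
  have "(if u then card Z else n - card Z) = Suc (if u then card ?T else n - card ?T)"
  proof (cases u)
    case True
    then have c: "can_flip n True G Z i j k" using f by simp
    have "i \<in> Z" "k \<in> Z" "j \<notin> Z" using c unfolding can_flip_def by auto
    then have "card (Z - {i, k}) + 2 = card Z"
      using fin ijk card_Diff_subset[of "{i, k}" Z] card_mono[OF fin, of "{i, k}"] by auto
    moreover have "card ?T = Suc (card (Z - {i, k}))" unfolding can_flip_lower(3)[OF c] using fin \<open>j \<notin> Z\<close> by simp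
    ultimately show ?thesis using True by simp
  next
    case False
    then have c: "can_flip n False G Z i j k" using f by simp
    have m: "i \<notin> Z" "k \<notin> Z" "j \<in> Z" using c unfolding can_flip_def by auto
    have "card ?T = Suc (Suc (card (Z - {j})))" unfolding can_flip_raise(3)[OF c] using fin m ijk by simp
    moreover have "Suc (card (Z - {j})) = card Z" using m fin by (simp only: card_Suc_Diff1)
    ultimately show ?thesis using False card_sub_le[OF Tn(1)] by simp
  qed
  then show ?thesis
    unfolding potential_def sum.remove[OF finG Z] using finG T(1) by simp
qed

lemma potential_le: "max_weak n G \<Longrightarrow> potential n u G \<le> card G * n"
  unfolding potential_def using sum_bounded_above[of G "\<lambda>X. if u then card X else n - card X" n]
    max_weak_sub card_sub_le by (auto simp: mult.commute)

lemma flips_length: "flips n u W xs G \<Longrightarrow> max_weak n W \<Longrightarrow> length xs + potential n u G = potential n u W"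
proof (induction rule: flips.induct)
  case (more xs G Z i j k)
  then show ?case using potential_flip[OF _ more.hyps(2)] flips_max_weak[OF more.hyps(1)] by simp
qed simp

section \<open>Weakly separated collections have polynomial size\<close>

text \<open>If \<open>B\<close> surrounds the set with \<open>Suc n\<close>, then
  \<open>Suc n\<close> as right end forces \<open>B - A\<close> to lie to the left of
  \<open>A - B\<close>. After the deletion each set surrounds the other, so the change of size does
  no harm.\<close>

lemma weakly_separated_delete:
  assumes n: "A \<subseteq> {1..n}" "B \<subseteq> {1..n}" and w: "weakly_separated (insert (Suc n) A) B"
  shows "weakly_separated A B"
proof -
  have sA: "Suc n \<notin> A" "Suc n \<notin> B" using n by auto
  have fin: "finite A" using n(1) by (rule finite_subset) simp
  then have c: "card (insert (Suc n) A) = Suc (card A)" using sA by simp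
  from w consider "card (insert (Suc n) A) \<le> card B" "surrounds (insert (Suc n) A) B" | "surrounds B (insert (Suc n) A)"
    unfolding weakly_separated_def by blast
  then show ?thesis
  proof cases
    case 1
    then have "surrounds A B" using sA unfolding surrounds_def by (metis DiffE DiffI insertCI insertE)
    then show ?thesis using 1(1) c unfolding weakly_separated_def by simp
  next
    case 2
    have no: False if "i \<in> A" "i \<notin> B" "j \<in> B" "j \<notin> A" "i < j" for i j
      using surroundsD[OF 2, of i "Suc n" j] that sA n(2) by force
    have "surrounds A B" "surrounds B A" unfolding surrounds_def using no by blast+
    then show ?thesis unfolding weakly_separated_def using linear by blast
  qed
qed

lemma weakly_separated_delete_both:
  assumes n: "A \<subseteq> {1..n}" "B \<subseteq> {1..n}" and w: "weakly_separated (insert (Suc n) A) (insert (Suc n) B)"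
  shows "weakly_separated A B"
proof -
  have sA: "Suc n \<notin> A" "Suc n \<notin> B" using n by auto
  have fin: "finite A" "finite B" using n by (auto intro: finite_subset)
  have d: "insert (Suc n) A - insert (Suc n) B = A - B" "insert (Suc n) B - insert (Suc n) A = B - A" using sA by auto
  have "surrounds (insert (Suc n) A) (insert (Suc n) B) = surrounds A B" "surrounds (insert (Suc n) B) (insert (Suc n) A) = surrounds B A"
    unfolding surrounds_def d by blast+
  then show ?thesis using w fin sA unfolding weakly_separated_def by simp
qed

text \<open>Distinct sets of equal size have elements \<open>x\<close> in \<open>A - B\<close> and
  \<open>y\<close> in \<open>B - A\<close>. Either order of them, with \<open>Suc n\<close> as the
  third point, violates one of the two \<open>surrounds\<close>.\<close>

lemma weakly_separated_cross_insert:
  assumes n: "A \<subseteq> {1..n}" "B \<subseteq> {1..n}" and c: "card A = card B"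
    and w: "weakly_separated (insert (Suc n) A) B" "weakly_separated (insert (Suc n) B) A"
  shows "A = B"
proof (rule ccontr)
  assume ne: "A \<noteq> B"
  have fin: "finite A" "finite B" using n by (auto intro: finite_subset)
  have sA: "Suc n \<notin> A" "Suc n \<notin> B" using n by auto
  have "card (A - B) = card (B - A)" using card_Diff_swap[OF fin] c by simp
  moreover have "A - B \<noteq> {} \<or> B - A \<noteq> {}" using ne by blast
  ultimately have "A - B \<noteq> {}" "B - A \<noteq> {}" using fin by (metis card_0_eq finite_Diff)+
  then obtain x y where xy: "x \<in> A" "x \<notin> B" "y \<in> B" "y \<notin> A" by blast
  have xn: "x < Suc n" "y < Suc n" using xy n by auto
  have "card B < card (insert (Suc n) A)" "card A < card (insert (Suc n) B)" using fin sA c by auto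
  then have s: "surrounds B (insert (Suc n) A)" "surrounds A (insert (Suc n) B)"
    using w weakly_separated_card_less weakly_separated_sym by blast+
  have "x \<noteq> y" using xy by blast
  then consider "x < y" | "y < x" by linarith
  then show False
  proof cases
    case 1 then show ?thesis using surroundsD[OF s(1), of x "Suc n" y] xy sA xn by blast
  next
    case 2 then show ?thesis using surroundsD[OF s(2), of y "Suc n" x] xy sA xn by blast
  qed
qed

text \<open>Deleting the largest point identifies two members only when the result lies in both
  \<open>F1\<close> and \<open>F2\<close>. Such sets are determined by their sizes, so there are at
  most \<open>n + 1\<close> of them.\<close>

lemma card_weakly_separated:
  "F \<subseteq> Pow {1..n} \<Longrightarrow> (\<And>A B. A \<in> F \<Longrightarrow> B \<in> F \<Longrightarrow> weakly_separated A B) \<Longrightarrow> card F \<le> 1 + n * n"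
proof (induction n arbitrary: F)
  case 0
  then have "F \<subseteq> {{}}" by auto
  then show ?case using card_mono[of "{{}}" F] by simp
next
  case (Suc n)
  let ?m = "Suc n"
  have finF: "finite F" using Suc.prems(1) by (meson finite_Pow_iff finite_atLeastAtMost finite_subset)
  define F1 where "F1 = {A\<in>F. ?m \<notin> A}"
  define F2 where "F2 = {A. A \<subseteq> {1..n} \<and> insert ?m A \<in> F}"
  have sub1: "A \<subseteq> {1..n}" if "A \<in> F1" for A
  proof
    fix x assume "x \<in> A"
    have "x \<in> {1..?m}" "x \<noteq> ?m" using \<open>x \<in> A\<close> that Suc.prems(1) unfolding F1_def by blast+
    then show "x \<in> {1..n}" by auto
  qed
  have nm: "?m \<notin> A" if "A \<in> F1 \<union> F2" for A using that sub1 unfolding F2_def by fastforce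
  have F: "F = F1 \<union> insert ?m ` F2"
  proof
    show "F1 \<union> insert ?m ` F2 \<subseteq> F" unfolding F1_def F2_def by blast
    show "F \<subseteq> F1 \<union> insert ?m ` F2"
    proof
      fix A assume A: "A \<in> F"
      show "A \<in> F1 \<union> insert ?m ` F2"
      proof (cases "?m \<in> A")
        case True
        have "A - {?m} \<subseteq> {1..n}"
        proof
          fix x assume "x \<in> A - {?m}"
          then have "x \<in> {1..?m}" "x \<noteq> ?m" using A Suc.prems(1) by blast+
          then show "x \<in> {1..n}" by auto
        qed
        moreover have "insert ?m (A - {?m}) = A" using True by blast
        ultimately show ?thesis using A unfolding F2_def by (metis (mono_tags, lifting) UnI2 image_eqI mem_Collect_eq)
      next
        case False then show ?thesis using A unfolding F1_def by blast
      qed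
    qed
  qed
  have fin: "finite F1" "finite F2" using finF unfolding F1_def F2_def by auto
  have "inj_on (insert ?m) F2" using nm unfolding inj_on_def by (metis Un_iff insert_ident)
  then have "card F \<le> card F1 + card F2" unfolding F using card_Un_le card_image by metis
  also have "\<dots> = card (F1 \<union> F2) + card (F1 \<inter> F2)" using card_Un_Int[OF fin] .
  also have "card (F1 \<union> F2) \<le> 1 + n * n"
  proof (rule Suc.IH)
    show "F1 \<union> F2 \<subseteq> Pow {1..n}" using sub1 unfolding F2_def by blast
    fix A B assume AB: "A \<in> F1 \<union> F2" "B \<in> F1 \<union> F2"
    then have s: "A \<subseteq> {1..n}" "B \<subseteq> {1..n}" using sub1 unfolding F2_def by blast+
    consider "A \<in> F" "B \<in> F" | "insert ?m A \<in> F" "B \<in> F" | "A \<in> F" "insert ?m B \<in> F" | "insert ?m A \<in> F" "insert ?m B \<in> F"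
      using AB unfolding F1_def F2_def by blast
    then show "weakly_separated A B"
    proof cases
      case 1 then show ?thesis using Suc.prems(2) by blast
    next
      case 2 then show ?thesis using weakly_separated_delete[OF s] Suc.prems(2) by blast
    next
      case 3 then show ?thesis using weakly_separated_delete[OF s(2,1)] Suc.prems(2) weakly_separated_sym by blast
    next
      case 4 then show ?thesis using weakly_separated_delete_both[OF s] Suc.prems(2) by blast
    qed
  qed
  also have "card (F1 \<inter> F2) \<le> Suc n"
  proof -
    have "inj_on card (F1 \<inter> F2)"
      unfolding inj_on_def
    proof (intro ballI impI)
      fix A B assume "A \<in> F1 \<inter> F2" "B \<in> F1 \<inter> F2" "card A = card B"
      then show "A = B" using weakly_separated_cross_insert[of A n B] sub1 Suc.prems(2) unfolding F1_def F2_def by blast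
    qed
    moreover have "card ` (F1 \<inter> F2) \<subseteq> {0..n}" using sub1 card_sub_le by auto
    ultimately have "card (F1 \<inter> F2) \<le> card {0..n}" using card_inj_on_le by blast
    then show ?thesis by simp
  qed
  finally show ?case by simp
qed

lemma max_weak_card: "max_weak n W \<Longrightarrow> card W \<le> 1 + n * n"
  using card_weakly_separated[of W n] max_weak_sub max_weakD by blast

section \<open>Programs with time bounds\<close>

text \<open>Total correctness with a time bound. Runs are deterministic, so the existential
  statement speaks about the only terminating run.\<close>

definition wp :: "prog \<Rightarrow> nat \<Rightarrow> (state \<Rightarrow> bool) \<Rightarrow> state \<Rightarrow> bool" where
  "wp p T Q s \<longleftrightarrow> (\<exists>t s'. runs p s t s' \<and> t \<le> T \<and> Q s')"

lemma wp_mono: "wp p T Q s \<Longrightarrow> (\<And>s'. Q s' \<Longrightarrow> Q' s') \<Longrightarrow> T \<le> T' \<Longrightarrow> wp p T' Q' s"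
  unfolding wp_def by (meson le_trans)

lemma wp_Skip: "Q s \<Longrightarrow> 1 \<le> T \<Longrightarrow> wp Skip T Q s"
  unfolding wp_def using runs.Skip by blast

lemma wp_Write: "Q (s(a := (s a)(val e s := val f s))) \<Longrightarrow> 1 + expr_cost e + expr_cost f \<le> T \<Longrightarrow> wp (Write a e f) T Q s"
  unfolding wp_def using runs.Write by blast

lemma wp_Seq: "wp p T R s \<Longrightarrow> (\<And>s'. R s' \<Longrightarrow> wp q U Q s') \<Longrightarrow> T + U \<le> V \<Longrightarrow> wp (Seq p q) V Q s"
  unfolding wp_def by (meson add_mono le_trans runs.Seq)

text \<open>The bounds of the branches are added instead of taking their maximum, which keeps all
  bounds polynomial expressions.\<close>

lemma wp_Cond:
  "(val e s \<noteq> 0 \<Longrightarrow> wp p T Q s) \<Longrightarrow> (val e s = 0 \<Longrightarrow> wp q U Q s) \<Longrightarrow> 1 + expr_cost e + (T + U) \<le> V \<Longrightarrow>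
    wp (Cond e p q) V Q s"
proof (cases "val e s = 0")
  case True
  assume "val e s = 0 \<Longrightarrow> wp q U Q s" "1 + expr_cost e + (T + U) \<le> V"
  with True obtain t s' where h: "runs q s t s'" "t \<le> U" "Q s'" unfolding wp_def by blast
  have "runs (Cond e p q) s (1 + expr_cost e + t) s'" using runs.CondFalse[OF True h(1)] .
  moreover have "1 + expr_cost e + t \<le> V" using h(2) \<open>_ \<le> V\<close> by linarith
  ultimately show ?thesis unfolding wp_def using h(3) by blast
next
  case False
  assume "val e s \<noteq> 0 \<Longrightarrow> wp p T Q s" "1 + expr_cost e + (T + U) \<le> V"
  with False obtain t s' where h: "runs p s t s'" "t \<le> T" "Q s'" unfolding wp_def by blast
  have "runs (Cond e p q) s (1 + expr_cost e + t) s'" using runs.CondTrue[OF False h(1)] .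
  moreover have "1 + expr_cost e + t \<le> V" using h(2) \<open>_ \<le> V\<close> by linarith
  ultimately show ?thesis unfolding wp_def using h(3) by blast
qed

lemma wp_While_False: "val e s = 0 \<Longrightarrow> Q s \<Longrightarrow> 1 + expr_cost e \<le> T \<Longrightarrow> wp (While e p) T Q s"
  unfolding wp_def using runs.WhileFalse by blast

lemma wp_While_True:
  assumes "val e s \<noteq> 0" "wp p T R s" "\<And>s'. R s' \<Longrightarrow> wp (While e p) U Q s'" "1 + expr_cost e + T + U \<le> V"
  shows "wp (While e p) V Q s"
proof -
  obtain t s' where h: "runs p s t s'" "t \<le> T" "R s'" using assms(2) unfolding wp_def by blast
  obtain u s'' where h': "runs (While e p) s' u s''" "u \<le> U" "Q s''" using assms(3)[OF h(3)] unfolding wp_def by blast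
  have "runs (While e p) s (1 + expr_cost e + t + u) s''" using runs.WhileTrue[OF assms(1) h(1) h'(1)] .
  moreover have "1 + expr_cost e + t + u \<le> V" using h(2) h'(2) assms(4) by linarith
  ultimately show ?thesis unfolding wp_def using h'(3) by blast
qed

text \<open>A scalar variable is the entry with index 0 of an array of its own.\<close>

abbreviation Var :: "nat \<Rightarrow> expr" where "Var v \<equiv> Read v (Const 0)"

abbreviation Assign :: "nat \<Rightarrow> expr \<Rightarrow> prog" where "Assign v e \<equiv> Write v (Const 0) e"

definition For :: "nat \<Rightarrow> expr \<Rightarrow> prog \<Rightarrow> prog" where
  "For v e p = Seq (Assign v (Const 0)) (While (Sub e (Var v)) (Seq p (Assign v (Add (Var v) (Const 1)))))"

text \<open>The counter is written outside the body, so the invariant must not depend on it.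
  \<open>N\<close> is the actual number of rounds, \<open>M\<close> a bound known beforehand. A
  round costs \<open>T\<close> for the body, \<open>4 + expr_cost e\<close> for the guard and 6 for
  the increment; the initial assignment costs 3 and the last guard again
  \<open>4 + expr_cost e\<close>.\<close>

lemma wp_For:
  assumes J0: "J 0 s" and ind: "\<And>i s x. J i s \<Longrightarrow> J i (s(v := x))"
    and bound: "\<And>i s. J i s \<Longrightarrow> val e s = N"
    and body: "\<And>i s. i < N \<Longrightarrow> J i s \<Longrightarrow> s v 0 = i \<Longrightarrow> wp p T (\<lambda>s'. s' v 0 = i \<and> J (Suc i) s') s"
    and NM: "N \<le> M" and V: "7 + expr_cost e + M * (T + 10 + expr_cost e) \<le> V"
  shows "wp (For v e p) V (J N) s"
proof -
  let ?c = "T + 10 + expr_cost e"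
  let ?w = "While (Sub e (Var v)) (Seq p (Assign v (Add (Var v) (Const 1))))"
  have loop: "wp ?w (d * ?c + (4 + expr_cost e)) (J N) s" if "J (N - d) s" "s v 0 = N - d" "d \<le> N" for d s
    using that
  proof (induction d arbitrary: s)
    case 0
    then show ?case using bound[OF 0(1)] by (intro wp_While_False) auto
  next
    case (Suc d)
    have lt: "N - Suc d < N" "Suc (N - Suc d) = N - d" using Suc.prems(3) by auto
    have step: "wp (Seq p (Assign v (Add (Var v) (Const 1)))) (T + 6) (\<lambda>s'. J (N - d) s' \<and> s' v 0 = N - d) s"
    proof (rule wp_Seq[OF body[OF lt(1) Suc.prems(1,2)]])
      fix s' assume s': "s' v 0 = N - Suc d \<and> J (Suc (N - Suc d)) s'"
      show "wp (Assign v (Add (Var v) (Const 1))) 6 (\<lambda>s'. J (N - d) s' \<and> s' v 0 = N - d) s'"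
      proof (rule wp_Write)
        show "J (N - d) (s'(v := (s' v)(val (Const 0) s' := val (Add (Var v) (Const 1)) s'))) \<and>
          (s'(v := (s' v)(val (Const 0) s' := val (Add (Var v) (Const 1)) s'))) v 0 = N - d"
          using s' lt ind[of "N - d" s'] by simp
      qed simp
    qed simp
    show ?case
    proof (rule wp_While_True[OF _ step])
      show "val (Sub e (Var v)) s \<noteq> 0" using bound[OF Suc.prems(1)] Suc.prems(2,3) by simp
      show "wp ?w (d * ?c + (4 + expr_cost e)) (J N) s'" if "J (N - d) s' \<and> s' v 0 = N - d" for s'
        using Suc.IH[of s'] that Suc.prems(3) by simp
      show "1 + expr_cost (Sub e (Var v)) + (T + 6) + (d * ?c + (4 + expr_cost e)) \<le> Suc d * ?c + (4 + expr_cost e)" by simp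
    qed
  qed
  have "N * ?c \<le> M * ?c" using NM by (rule mult_le_mono1)
  then have V': "3 + (N * ?c + (4 + expr_cost e)) \<le> V" using V by linarith
  show ?thesis unfolding For_def
  proof (rule wp_Seq[OF _ _ V'])
    show "wp (Assign v (Const 0)) 3 (\<lambda>s'. J 0 s' \<and> s' v 0 = 0) s" using J0 ind by (intro wp_Write) auto
    show "wp ?w (N * ?c + (4 + expr_cost e)) (J N) s'" if "J 0 s' \<and> s' v 0 = 0" for s'
      using loop[of N s'] that by simp
  qed
qed

text \<open>The loop has no exit: after a success the body is still executed, and
  \<open>stay\<close> says that this preserves the result.\<close>

lemma wp_search:
  assumes start: "Base s \<or> Done s"
    and ind: "\<And>s x. Base s \<Longrightarrow> Base (s(v := x))" "\<And>s x. Done s \<Longrightarrow> Done (s(v := x))"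
    and bound: "\<And>s. Base s \<Longrightarrow> val e s = N" "\<And>s. Done s \<Longrightarrow> val e s = N"
    and body: "\<And>i s. i < N \<Longrightarrow> Base s \<Longrightarrow> s v 0 = i \<Longrightarrow> wp p T (\<lambda>s'. s' v 0 = i \<and> ((Base s' \<and> \<not> \<phi> i) \<or> Done s')) s"
    and stay: "\<And>i s. i < N \<Longrightarrow> Done s \<Longrightarrow> s v 0 = i \<Longrightarrow> wp p T (\<lambda>s'. s' v 0 = i \<and> Done s') s"
    and NM: "N \<le> M" and V: "7 + expr_cost e + M * (T + 10 + expr_cost e) \<le> V"
  shows "wp (For v e p) V (\<lambda>s'. (Base s' \<and> (\<forall>i<N. \<not> \<phi> i)) \<or> Done s') s"
proof (rule wp_For[where J = "\<lambda>l s'. (Base s' \<and> (\<forall>i<l. \<not> \<phi> i)) \<or> Done s'" and N = N and M = M and T = T, OF _ _ _ _ NM V])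
  show "(Base s \<and> (\<forall>i<0. \<not> \<phi> i)) \<or> Done s" using start by simp
next
  fix i s assume i: "i < N" and h: "(Base s \<and> (\<forall>i'<i. \<not> \<phi> i')) \<or> Done s" and v: "s v 0 = i"
  from h show "wp p T (\<lambda>s'. s' v 0 = i \<and> ((Base s' \<and> (\<forall>i'<Suc i. \<not> \<phi> i')) \<or> Done s')) s"
  proof
    assume b: "Base s \<and> (\<forall>i'<i. \<not> \<phi> i')"
    show ?thesis by (rule wp_mono[OF body[OF i conjunct1[OF b] v]]) (use b in \<open>auto simp: less_Suc_eq\<close>)
  next
    assume d: "Done s"
    show ?thesis by (rule wp_mono[OF stay[OF i d v]]) auto
  qed
qed (use ind bound in blast)+

definition agree :: "nat set \<Rightarrow> state \<Rightarrow> state \<Rightarrow> bool" where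
  "agree V s s' \<longleftrightarrow> (\<forall>a. a \<notin> V \<longrightarrow> s' a = s a)"

lemma agreeD: "agree V s s' \<Longrightarrow> a \<notin> V \<Longrightarrow> s' a = s a" unfolding agree_def by blast

lemma agree_refl: "agree V s s" unfolding agree_def by blast

lemma agree_upd: "agree V s s' \<Longrightarrow> a \<in> V \<Longrightarrow> agree V s (s'(a := x))" unfolding agree_def by auto

lemma agree_trans: "agree V s s' \<Longrightarrow> agree V' s' s'' \<Longrightarrow> V \<subseteq> U \<Longrightarrow> V' \<subseteq> U \<Longrightarrow> agree U s s''"
  unfolding agree_def by (metis subsetD)

lemma wp_For_agree:
  assumes start: "agree V s s1" "L 0 s1" and v: "v \<in> V" and ind: "\<And>i s' x. L i s' \<Longrightarrow> L i (s'(v := x))"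
    and bound: "\<And>s'. agree V s s' \<Longrightarrow> val e s' = N"
    and body: "\<And>i s'. i < N \<Longrightarrow> agree V s s' \<Longrightarrow> L i s' \<Longrightarrow> s' v 0 = i \<Longrightarrow>
      wp p T (\<lambda>s''. s'' v 0 = i \<and> agree V s s'' \<and> L (Suc i) s'') s'"
    and NM: "N \<le> M" and U: "7 + expr_cost e + M * (T + 10 + expr_cost e) \<le> U"
  shows "wp (For v e p) U (\<lambda>s'. agree V s s' \<and> L N s') s1"
proof (rule wp_For[where J = "\<lambda>i s'. agree V s s' \<and> L i s'", OF _ _ _ _ NM U])
  show "agree V s s1 \<and> L 0 s1" using start by blast
  show "agree V s (s'(v := x)) \<and> L i (s'(v := x))" if "agree V s s' \<and> L i s'" for i s' x
    using that agree_upd v ind by blast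
  show "val e s' = N" if "agree V s s' \<and> L i s'" for i s' using that bound by blast
  show "wp p T (\<lambda>s''. s'' v 0 = i \<and> agree V s s'' \<and> L (Suc i) s'') s'"
    if "i < N" "agree V s s' \<and> L i s'" "s' v 0 = i" for i s' using that body by blast
qed

section \<open>The memory layout\<close>

text \<open>Array 1 holds the list of all collected sets in output format, array 2 marks the members of the
  current collection, array 3 holds the start positions of the incidence vectors, and array 4 is a scratch
  vector. Scalars: 5 = direction of the flips, 6 = whether a flip has been made, 7 to 10 = the
  loop indices \<open>m, i, j, k\<close>, 11 to 15 = local to a flip attempt, 16 = bound for \<open>m\<close>.\<close>

definition stores :: "nat \<Rightarrow> nat \<Rightarrow> nat set list \<Rightarrow> nat set \<Rightarrow> state \<Rightarrow> bool" where
  "stores n l rows A s \<longleftrightarrow> s 0 1 = l \<and> s 1 0 = n \<and> s 1 1 = length rows \<and>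
     (\<forall>m<length rows. \<forall>x<n. s 1 (2 + m * n + x) = of_bool (Suc x \<in> rows ! m)) \<and>
     (\<forall>m<length rows. s 2 m = of_bool (m \<in> A)) \<and>
     (\<forall>m\<le>length rows. s 3 m = 2 + m * n)"

definition collection :: "nat set list \<Rightarrow> nat set \<Rightarrow> nat set set" where
  "collection rows A = {rows ! m | m. m < length rows \<and> m \<in> A}"

definition target :: "nat \<Rightarrow> nat set \<Rightarrow> state \<Rightarrow> bool" where
  "target n Y s \<longleftrightarrow> (\<forall>x<n. s 4 x = of_bool (Suc x \<in> Y))"

lemma stores_cong: "stores n l rows A s \<Longrightarrow> agree V s s' \<Longrightarrow> V \<inter> {0, 1, 2, 3} = {} \<Longrightarrow> stores n l rows A s'"
proof -
  assume h: "stores n l rows A s" "agree V s s'" "V \<inter> {0, 1, 2, 3} = {}"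
  then have "s' 0 = s 0" "s' 1 = s 1" "s' 2 = s 2" "s' 3 = s 3" using agreeD[OF h(2)] by blast+
  then show ?thesis using h(1) unfolding stores_def by simp
qed

abbreviation size_expr :: expr where "size_expr \<equiv> Read 1 (Const 0)"
abbreviation count_expr :: expr where "count_expr \<equiv> Read 1 (Const 1)"
abbreviation entry :: "nat \<Rightarrow> nat \<Rightarrow> expr" where "entry m x \<equiv> Read 1 (Add (Read 3 (Var m)) (Var x))"
abbreviation neq :: "expr \<Rightarrow> expr \<Rightarrow> expr" where "neq e f \<equiv> Add (Sub e f) (Sub f e)"

lemma val_entry:
  assumes "stores n l rows A s" "s m 0 < length rows" "s x 0 < n"
  shows "val (entry m x) s = of_bool (Suc (s x 0) \<in> rows ! s m 0)"
  using assms unfolding stores_def by simp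

lemma val_neq: "val (neq e f) s = 0 \<longleftrightarrow> val e s = val f s" by auto

section \<open>Routines for a single candidate set\<close>

definition fill :: prog where "fill = For 15 size_expr (Write 4 (Var 15) (entry 7 15))"

lemma wp_fill:
  assumes st: "stores n l rows A s" and m: "s 7 0 = m" "m < length rows"
  shows "wp fill (10 + 30 * n) (\<lambda>s'. agree {4, 15} s s' \<and> target n (rows ! m) s') s"
  unfolding fill_def target_def
proof (rule wp_For_agree[where V = "{4, 15}" and N = n and M = n and T = 10])
  fix i s' assume i: "i < n" and ag: "agree {4, 15} s s'" and J: "\<forall>x<i. s' 4 x = of_bool (Suc x \<in> rows ! m)" and v: "s' 15 0 = i"
  have st': "stores n l rows A s'" by (rule stores_cong[OF st ag]) simp
  have m': "s' 7 0 = m" using agreeD[OF ag, of 7] m by simp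
  have e: "val (entry 7 15) s' = of_bool (Suc i \<in> rows ! m)" using val_entry[OF st', of 7 15] m' m v i by simp
  show "wp (Write 4 (Var 15) (entry 7 15)) 10 (\<lambda>s'. s' 15 0 = i \<and> agree {4, 15} s s' \<and> (\<forall>x<Suc i. s' 4 x = of_bool (Suc x \<in> rows ! m))) s'"
  proof (rule wp_Write)
    show "(s'(4 := (s' 4)(val (Var 15) s' := val (entry 7 15) s'))) 15 0 = i \<and> agree {4, 15} s (s'(4 := (s' 4)(val (Var 15) s' := val (entry 7 15) s'))) \<and>
      (\<forall>x<Suc i. (s'(4 := (s' 4)(val (Var 15) s' := val (entry 7 15) s'))) 4 x = of_bool (Suc x \<in> rows ! m))"
      unfolding e using J v agree_upd[OF ag, of 4] by (auto simp: less_Suc_eq)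
  qed simp
next
  fix s' assume "agree {4, 15} s s'"
  then have "s' 1 = s 1" by (rule agreeD) simp
  then show "val size_expr s' = n" using st unfolding stores_def by simp
qed (simp_all add: agree_refl)

definition toggle_target :: "nat \<Rightarrow> prog" where
  "toggle_target v = Write 4 (Var v) (Sub (Const 1) (Read 4 (Var v)))"

lemma wp_toggle_target:
  assumes "target n Y s" "s v 0 = x" "x < n"
  shows "wp (toggle_target v) 8 (\<lambda>s'. agree {4} s s' \<and> target n (toggle Y {Suc x}) s') s"
  unfolding toggle_target_def
  by (rule wp_Write) (use assms in \<open>auto simp: target_def toggle_def agree_def\<close>)

definition compare :: prog where
  "compare = For 15 size_expr (Cond (neq (Read 4 (Var 15)) (entry 14 15)) (Assign 13 (Const 0)) Skip)"

lemma wp_compare: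
  assumes st: "stores n l rows A s" and Y: "target n Y s" and r: "s 14 0 = r" "r < length rows" and b: "s 13 0 = 1"
  shows "wp compare (9 + 40 * n) (\<lambda>s'. agree {13, 15} s s' \<and> s' 13 0 = of_bool (\<forall>x<n. (Suc x \<in> Y) = (Suc x \<in> rows ! r))) s"
  unfolding compare_def
proof (rule wp_For_agree[where V = "{13, 15}" and N = n and M = n and T = 28 and
      L = "\<lambda>i s'. s' 13 0 = of_bool (\<forall>x<i. (Suc x \<in> Y) = (Suc x \<in> rows ! r))"])
  fix i s' assume i: "i < n" and ag: "agree {13, 15} s s'"
    and J: "s' 13 0 = of_bool (\<forall>x<i. (Suc x \<in> Y) = (Suc x \<in> rows ! r))" and v: "s' 15 0 = i"
  have st': "stores n l rows A s'" by (rule stores_cong[OF st ag]) simp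
  have r': "s' 14 0 = r" "s' 4 = s 4" using agreeD[OF ag, of 14] agreeD[OF ag, of 4] r by simp_all
  have e: "val (entry 14 15) s' = of_bool (Suc i \<in> rows ! r)" using val_entry[OF st', of 14 15] r' r v i by simp
  have e': "val (Read 4 (Var 15)) s' = of_bool (Suc i \<in> Y)" using Y r' v i unfolding target_def by simp
  have eq: "val (neq (Read 4 (Var 15)) (entry 14 15)) s' = 0 \<longleftrightarrow> (Suc i \<in> Y) = (Suc i \<in> rows ! r)"
    unfolding val_neq e e' by simp
  let ?Q = "\<lambda>s'. s' 15 0 = i \<and> agree {13, 15} s s' \<and> s' 13 0 = of_bool (\<forall>x<Suc i. (Suc x \<in> Y) = (Suc x \<in> rows ! r))"
  show "wp (Cond (neq (Read 4 (Var 15)) (entry 14 15)) (Assign 13 (Const 0)) Skip) 28 ?Q s'"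
  proof (rule wp_Cond[where T = 3 and U = 1])
    assume "val (neq (Read 4 (Var 15)) (entry 14 15)) s' \<noteq> 0"
    then have "(Suc i \<in> Y) \<noteq> (Suc i \<in> rows ! r)" unfolding eq .
    then show "wp (Assign 13 (Const 0)) 3 ?Q s'"
      using J v agree_upd[OF ag, of 13] by (intro wp_Write) (auto simp: less_Suc_eq)
  next
    assume "val (neq (Read 4 (Var 15)) (entry 14 15)) s' = 0"
    then have "(Suc i \<in> Y) = (Suc i \<in> rows ! r)" unfolding eq .
    then show "wp Skip 1 ?Q s'" using J v ag by (intro wp_Skip) (auto simp: less_Suc_eq)
  qed simp
next
  fix s' assume "agree {13, 15} s s'"
  then have "s' 1 = s 1" by (rule agreeD) simp
  then show "val size_expr s' = n" using st unfolding stores_def by simp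
qed (simp_all add: agree_refl b)

definition scan_row :: prog where
  "scan_row = Cond (Read 2 (Var 14))
     (Seq (Assign 13 (Const 1)) (Seq compare (Cond (Var 13) (Assign 12 (Const 1)) Skip))) Skip"

definition find :: prog where
  "find = Seq (Assign 12 (Const 0)) (For 14 count_expr scan_row)"

lemma wp_find:
  assumes st: "stores n l rows A s" and Y: "target n Y s" "Y \<subseteq> {1..n}" and rows: "set rows \<subseteq> Pow {1..n}"
    and M: "length rows \<le> M"
  shows "wp find (12 + M * (40 + 40 * n)) (\<lambda>s'. agree {12, 13, 14, 15} s s' \<and> s' 12 0 = of_bool (Y \<in> collection rows A)) s"
proof -
  define f where "f = (\<lambda>r. r \<in> A \<and> (\<forall>x<n. (Suc x \<in> Y) = (Suc x \<in> rows ! r)))"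
  have fe: "(\<exists>r<length rows. f r) = (Y \<in> collection rows A)"
  proof -
    have "(\<forall>x<n. (Suc x \<in> Y) = (Suc x \<in> rows ! r)) = (Y = rows ! r)" if "r < length rows" for r
    proof
      assume h: "\<forall>x<n. (Suc x \<in> Y) = (Suc x \<in> rows ! r)"
      have R: "rows ! r \<subseteq> {1..n}" using rows that nth_mem by blast
      have "(y \<in> Y) = (y \<in> rows ! r)" for y
      proof (cases "y \<in> {1..n}")
        case True
        then have "y - 1 < n" "Suc (y - 1) = y" by auto
        then show ?thesis using h by metis
      next
        case False then show ?thesis using R Y(2) by blast
      qed
      then show "Y = rows ! r" by blast
    qed simp
    then show ?thesis unfolding f_def collection_def by blast
  qed
  let ?V = "{12, 13, 14, 15} :: nat set"
  let ?J = "\<lambda>r s'. agree ?V s s' \<and> s' 12 0 = of_bool (\<exists>r'<r. f r')"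
  have loop: "wp (For 14 count_expr scan_row) (9 + M * (40 + 40 * n)) (?J (length rows)) s1"
    if s1: "?J 0 s1" for s1
  proof (rule wp_For_agree[where V = ?V and N = "length rows" and M = M and T = "24 + 40 * n" and
        L = "\<lambda>r s'. s' 12 0 = of_bool (\<exists>r'<r. f r')"])
    fix r s' assume r: "r < length rows" and ag: "agree ?V s s'" and J': "s' 12 0 = of_bool (\<exists>r'<r. f r')" and v: "s' 14 0 = r"
    have J: "?J r s'" using ag J' by blast
    have st': "stores n l rows A s'" by (rule stores_cong[OF st ag]) simp
    have Y': "target n Y s'" using Y(1) agreeD[of ?V s s' 4] J unfolding target_def by simp
    have al: "val (Read 2 (Var 14)) s' = of_bool (r \<in> A)" using st' r v unfolding stores_def by simp
    let ?Q = "\<lambda>s'. s' 14 0 = r \<and> ?J (Suc r) s'"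
    show "wp scan_row (24 + 40 * n) ?Q s'"
    unfolding scan_row_def
    proof (rule wp_Cond[where T = "19 + 40 * n" and U = 1])
      assume "val (Read 2 (Var 14)) s' \<noteq> 0"
      then have rA: "r \<in> A" using al by auto
      let ?s2 = "s'(13 := (s' 13)(0 := 1))"
      show "wp (Seq (Assign 13 (Const 1)) (Seq compare (Cond (Var 13) (Assign 12 (Const 1)) Skip))) (19 + 40 * n) ?Q s'"
      proof (rule wp_Seq[where T = 3 and U = "16 + 40 * n" and R = "\<lambda>x. x = ?s2"])
        show "wp (Assign 13 (Const 1)) 3 (\<lambda>x. x = ?s2) s'" by (intro wp_Write) simp_all
      next
        fix x assume "x = ?s2"
        have ag: "agree {13} s' ?s2" unfolding agree_def by simp
        have st2: "stores n l rows A ?s2" using stores_cong[OF st' ag] by simp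
        have Y2: "target n Y ?s2" using Y' unfolding target_def by simp
        have "wp (Seq compare (Cond (Var 13) (Assign 12 (Const 1)) Skip)) (16 + 40 * n) ?Q ?s2"
        proof (rule wp_Seq[where U = 7])
          show "wp compare (9 + 40 * n) (\<lambda>x. agree {13, 15} ?s2 x \<and> x 13 0 = of_bool (\<forall>x<n. (Suc x \<in> Y) = (Suc x \<in> rows ! r))) ?s2"
            using wp_compare[OF st2 Y2] v r by simp
        next
          fix s3 assume s3: "agree {13, 15} ?s2 s3 \<and> s3 13 0 = of_bool (\<forall>x<n. (Suc x \<in> Y) = (Suc x \<in> rows ! r))"
          have fr: "s3 13 0 = of_bool (f r)" using s3 rA unfolding f_def by simp
          have ag2: "agree ?V s ?s2" using J agree_upd[of ?V s s' 13] by simp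
          have ag3: "agree ?V s s3" using agree_trans[OF ag2 conjunct1[OF s3], of ?V] by simp
          have v3: "s3 14 0 = r" "s3 12 0 = of_bool (\<exists>r'<r. f r')"
            using agreeD[OF conjunct1[OF s3], of 14] agreeD[OF conjunct1[OF s3], of 12] v J by simp_all
          show "wp (Cond (Var 13) (Assign 12 (Const 1)) Skip) 7 ?Q s3"
          proof (rule wp_Cond[where T = 3 and U = 1])
            assume "val (Var 13) s3 \<noteq> 0"
            then have "f r" using fr by auto
            then show "wp (Assign 12 (Const 1)) 3 ?Q s3" using ag3 v3 agree_upd[of ?V s s3 12] by (intro wp_Write) (auto simp: less_Suc_eq)
          next
            assume "val (Var 13) s3 = 0"
            then have "\<not> f r" using fr by auto
            then show "wp Skip 1 ?Q s3" using ag3 v3 by (intro wp_Skip) (auto simp: less_Suc_eq)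
          qed simp
        qed simp
        then show "wp (Seq compare (Cond (Var 13) (Assign 12 (Const 1)) Skip)) (16 + 40 * n) ?Q x" using \<open>x = ?s2\<close> by simp
      qed simp
    next
      assume "val (Read 2 (Var 14)) s' = 0"
      then have "\<not> f r" using al unfolding f_def by auto
      then show "wp Skip 1 ?Q s'" using J v by (intro wp_Skip) (auto simp: less_Suc_eq)
    qed simp
  next
    show "9 + M * (40 + 40 * n) \<ge> 7 + expr_cost count_expr + M * (24 + 40 * n + 10 + expr_cost count_expr)"
      by (simp add: algebra_simps)
  next
    fix s' assume "agree ?V s s'"
    then have "s' 1 = s 1" by (rule agreeD) simp
    then show "val count_expr s' = length rows" using st unfolding stores_def by simp
  qed (use s1 M in simp_all)
  show ?thesis unfolding find_def
  proof (rule wp_Seq[where T = 3 and R = "?J 0"])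
    show "wp (Assign 12 (Const 0)) 3 (?J 0) s" using agree_upd[OF agree_refl] by (intro wp_Write) auto
    show "wp (For 14 count_expr scan_row)
        (9 + M * (40 + 40 * n)) (\<lambda>s'. agree ?V s s' \<and> s' 12 0 = of_bool (Y \<in> collection rows A)) s'" if "?J 0 s'" for s'
      using loop[OF that] unfolding fe .
  qed simp
qed

definition check :: prog where "check = Seq find (Cond (Var 12) Skip (Assign 11 (Const 0)))"

text \<open>The replaced row loses its mark but stays in the list, as it is part of the output. The
  count is raised only after the writes that use it as an address. The next start position is
  obtained by addition, the machine having no multiplication.\<close>

definition register_row :: prog where
  "register_row =
     Seq (Write 2 (Var 7) (Const 0))
    (Seq (Write 2 count_expr (Const 1))
    (Seq (Write 3 (Add count_expr (Const 1)) (Add (Read 3 count_expr) size_expr))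
    (Seq (Write 1 (Const 1) (Add count_expr (Const 1)))
         (Assign 6 (Const 1)))))"

definition append_target :: prog where
  "append_target =
     Seq (For 15 size_expr (Write 1 (Add (Read 3 count_expr) (Var 15)) (Read 4 (Var 15))))
    register_row"

lemma wp_append_target:
  assumes st: "stores n l rows A s" and Y: "target n Y s" and m: "s 7 0 = m" "m < length rows"
  shows "wp append_target (40 + 22 * n) (\<lambda>s'. agree {1, 2, 3, 6, 15} s s' \<and>
     stores n l (rows @ [Y]) (insert (length rows) (A - {m})) s' \<and> s' 6 0 = 1) s"
proof -
  let ?c = "length rows"
  let ?b = "2 + ?c * n"
  let ?J = "\<lambda>i s'. agree {1, 15} s s' \<and> (\<forall>a<?b. s' 1 a = s 1 a) \<and> (\<forall>x<i. s' 1 (?b + x) = of_bool (Suc x \<in> Y))"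
  have s1: "s 1 0 = n" "s 1 1 = ?c" "s 3 ?c = ?b" using st unfolding stores_def by auto
  have loop: "wp (For 15 size_expr (Write 1 (Add (Read 3 count_expr) (Var 15)) (Read 4 (Var 15)))) (9 + 22 * n) (?J n) s"
  proof (rule wp_For[where N = n and M = n and T = 10 and J = ?J])
    fix i s' assume i: "i < n" and J: "?J i s'" and v: "s' 15 0 = i"
    have e: "s' 1 1 = ?c" "s' 3 = s 3" "s' 4 = s 4" using J s1 agreeD[OF conjunct1[OF J], of 3] agreeD[OF conjunct1[OF J], of 4] by auto
    have a: "val (Add (Read 3 count_expr) (Var 15)) s' = ?b + i" using e s1 v by simp
    have b: "val (Read 4 (Var 15)) s' = of_bool (Suc i \<in> Y)" using e v Y i unfolding target_def by simp
    show "wp (Write 1 (Add (Read 3 count_expr) (Var 15)) (Read 4 (Var 15))) 10 (\<lambda>s'. s' 15 0 = i \<and> ?J (Suc i) s') s'"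
    proof (rule wp_Write)
      show "(s'(1 := (s' 1)(val (Add (Read 3 count_expr) (Var 15)) s' := val (Read 4 (Var 15)) s'))) 15 0 = i \<and>
        ?J (Suc i) (s'(1 := (s' 1)(val (Add (Read 3 count_expr) (Var 15)) s' := val (Read 4 (Var 15)) s')))"
        unfolding a b using J v agree_upd[of "{1, 15}" s s' 1] by (auto simp: less_Suc_eq)
    qed simp
  next
    show "?J i (s'(15 := x))" if "?J i s'" for i s' x
      using that agree_upd[of "{1, 15}" s s' 15 x] by simp
  qed (use s1 in \<open>auto simp: agree_refl\<close>)
  let ?u = "\<lambda>s'. s'(2 := (s' 2)(m := 0, ?c := 1), 3 := (s' 3)(Suc ?c := ?b + n), 1 := (s' 1)(1 := Suc ?c), 6 := (s' 6)(0 := 1))"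
  have rest: "wp register_row 31 (\<lambda>x. x = ?u s') s'" if J: "?J n s'" for s'
  proof -
    have "s' 3 = s 3" "s' 7 = s 7" using agreeD[OF conjunct1[OF J]] by auto
    then have "s' 1 0 = n" "s' 1 1 = ?c" "s' 3 ?c = ?b" "s' 7 0 = m" using J s1 m by auto
    note e = this[unfolded One_nat_def]
    show ?thesis unfolding register_row_def
      apply (rule wp_Seq[where T = 4 and U = 27], rule wp_Write[where Q = "\<lambda>x. x = s'(2 := (s' 2)(m := 0))"])
         apply (simp_all add: e)
      apply (rule wp_Seq[where T = 4 and U = 23], rule wp_Write[where Q = "\<lambda>x. x = s'(2 := (s' 2)(m := 0, ?c := 1))"])
         apply (simp_all add: e)
      apply (rule wp_Seq[where T = 11 and U = 12], rule wp_Write[where Q = "\<lambda>x. x = s'(2 := (s' 2)(m := 0, ?c := 1), 3 := (s' 3)(Suc ?c := ?b + n))"])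
         apply (simp_all add: e)
      apply (rule wp_Seq[where T = 6 and U = 6], rule wp_Write[where Q = "\<lambda>x. x = s'(2 := (s' 2)(m := 0, ?c := 1), 3 := (s' 3)(Suc ?c := ?b + n), 1 := (s' 1)(1 := Suc ?c))"])
         apply (simp_all add: e)
      apply (rule wp_Write)
       apply (simp_all add: e)
      done
  qed
  show ?thesis unfolding append_target_def
  proof (rule wp_Seq[OF loop, where U = 31])
    fix s' assume J: "?J n s'"
    show "wp register_row 31 (\<lambda>s'. agree {1, 2, 3, 6, 15} s s' \<and>
     stores n l (rows @ [Y]) (insert (length rows) (A - {m})) s' \<and> s' 6 0 = 1) s'"
    proof (rule wp_mono[OF rest[OF J]])
      fix x assume x: "x = ?u s'"
      have ag: "agree {1, 15} s s'" and lo: "\<And>a. a < ?b \<Longrightarrow> s' 1 a = s 1 a" and hi: "\<And>x. x < n \<Longrightarrow> s' 1 (?b + x) = of_bool (Suc x \<in> Y)"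
        using J by auto
      have oth: "s' 0 = s 0" "s' 2 = s 2" "s' 3 = s 3" using agreeD[OF ag] by auto
      have "agree {1, 2, 3, 6, 15} s x" using ag unfolding x agree_def by auto
      moreover have "stores n l (rows @ [Y]) (insert ?c (A - {m})) x"
        unfolding stores_def
      proof (intro conjI allI impI)
        show "x 0 1 = l" "x 1 0 = n" "x 1 1 = length (rows @ [Y])"
          using st oth lo[of 0] unfolding x stores_def by auto
      next
        fix m' y assume m': "m' < length (rows @ [Y])" and y: "y < n"
        show "x 1 (2 + m' * n + y) = of_bool (Suc y \<in> (rows @ [Y]) ! m')"
        proof (cases "m' < ?c")
          case True
          then have "m' * n + n \<le> ?c * n" using mult_le_mono1[of "Suc m'" ?c n] by simp
          then have "2 + m' * n + y < ?b" using y by linarith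
          then show ?thesis using lo st True y unfolding x stores_def by (simp add: nth_append)
        next
          case False
          then have "m' = ?c" using m' by simp
          then show ?thesis using hi[OF y] unfolding x by (simp add: nth_append)
        qed
      next
        fix m' assume m': "m' < length (rows @ [Y])"
        show "x 2 m' = of_bool (m' \<in> insert ?c (A - {m}))"
          using st oth m' m(2) unfolding x stores_def by (auto simp: less_Suc_eq)
      next
        fix m' assume "m' \<le> length (rows @ [Y])"
        then show "x 3 m' = 2 + m' * n" using st oth unfolding x stores_def by (auto simp: le_Suc_eq)
      qed
      moreover have "x 6 0 = 1" unfolding x by simp
      ultimately show "agree {1, 2, 3, 6, 15} s x \<and> stores n l (rows @ [Y]) (insert (length rows) (A - {m})) x \<and> x 6 0 = 1" by blast
    qed simp
  qed simp
qed

section \<open>The flip loop\<close>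

lemma wp_check:
  assumes st: "stores n l rows A s" and Y: "target n Y s" "Y \<subseteq> {1..n}" and rows: "set rows \<subseteq> Pow {1..n}"
    and M: "length rows \<le> M" and ok: "s 11 0 = of_bool ok"
  shows "wp check (20 + M * (40 + 40 * n)) (\<lambda>s'. agree {11, 12, 13, 14, 15} s s' \<and> s' 11 0 = of_bool (ok \<and> Y \<in> collection rows A)) s"
  unfolding check_def
proof (rule wp_Seq[OF wp_find[OF st Y rows M], where U = 8])
  fix s' assume s': "agree {12, 13, 14, 15} s s' \<and> s' 12 0 = of_bool (Y \<in> collection rows A)"
  have ag: "agree {11, 12, 13, 14, 15} s s'" using s' unfolding agree_def by auto
  have ok': "s' 11 0 = of_bool ok" using agreeD[OF conjunct1[OF s'], of 11] ok by simp
  show "wp (Cond (Var 12) Skip (Assign 11 (Const 0))) 8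
     (\<lambda>s'. agree {11, 12, 13, 14, 15} s s' \<and> s' 11 0 = of_bool (ok \<and> Y \<in> collection rows A)) s'"
  proof (rule wp_Cond[where T = 1 and U = 3])
    assume "val (Var 12) s' \<noteq> 0"
    then show "wp Skip 1 (\<lambda>s'. agree {11, 12, 13, 14, 15} s s' \<and> s' 11 0 = of_bool (ok \<and> Y \<in> collection rows A)) s'"
      using s' ag ok' by (intro wp_Skip) auto
  next
    assume "val (Var 12) s' = 0"
    then show "wp (Assign 11 (Const 0)) 3 (\<lambda>s'. agree {11, 12, 13, 14, 15} s s' \<and> s' 11 0 = of_bool (ok \<and> Y \<in> collection rows A)) s'"
      using s' agree_upd[OF ag, of 11] by (intro wp_Write) auto
  qed simp
qed simp

definition triple :: "(state \<Rightarrow> bool) \<Rightarrow> prog \<Rightarrow> nat \<Rightarrow> (state \<Rightarrow> bool) \<Rightarrow> bool" where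
  "triple P p T Q \<longleftrightarrow> (\<forall>s. P s \<longrightarrow> wp p T Q s)"

lemma triple_Seq: "triple P p T R \<Longrightarrow> triple R q U Q \<Longrightarrow> triple P (Seq p q) (T + U) Q"
  unfolding triple_def using wp_Seq by blast

text \<open>One toggle at a time, the difference from \<open>Z\<close> runs through
  \<open>{i}\<close>, \<open>{i, j}\<close>, \<open>{j}\<close>, \<open>{j, k}\<close>,
  \<open>{k}\<close>, \<open>{i, k}\<close>, \<open>{i, j, k}\<close>. The four sides of the square
  are checked on the way, and the scratch vector ends as the replacement.\<close>

definition flip_program :: prog where
  "flip_program =
     Seq (Assign 11 (Const 1)) (Seq fill
    (Seq (toggle_target 8) (Seq check
    (Seq (toggle_target 9) (Seq check
    (Seq (toggle_target 8) (Seq (toggle_target 10) (Seq check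
    (Seq (toggle_target 9) (Seq check
    (Seq (toggle_target 8) (Seq (toggle_target 9)
       (Cond (Var 11) append_target Skip)))))))))))))"

abbreviation scratch :: "nat set" where "scratch \<equiv> {4, 11, 12, 13, 14, 15}"

lemma toggle_sub: "Y \<subseteq> {1..n} \<Longrightarrow> x < n \<Longrightarrow> toggle Y {Suc x} \<subseteq> {1..n}"
  unfolding toggle_def by auto

lemma toggle_path:
  assumes "i \<noteq> j" "i \<noteq> k" "j \<noteq> k"
  shows "toggle (toggle Z {i}) {j} = toggle Z {i, j}"
    "toggle (toggle (toggle Z {i, j}) {i}) {k} = toggle Z {j, k}"
    "toggle (toggle Z {j, k}) {j} = toggle Z {k}"
    "toggle (toggle (toggle Z {k}) {i}) {j} = toggle Z {i, j, k}"
  using assms unfolding toggle_def by auto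

lemma wp_flip_program:
  assumes st: "stores n l rows A s" and rows: "set rows \<subseteq> Pow {1..n}" and M: "length rows \<le> M"
    and m: "s 7 0 = m" "m < length rows" and x: "s 8 0 = i" "s 9 0 = j" "s 10 0 = k" "i < j" "j < k" "k < n"
  defines "Z \<equiv> rows ! m" and "G \<equiv> collection rows A" and "D \<equiv> {Suc i, Suc j, Suc k}"
  defines "ok \<equiv> toggle Z {Suc i} \<in> G \<and> toggle Z {Suc i, Suc j} \<in> G \<and> toggle Z {Suc j, Suc k} \<in> G \<and> toggle Z {Suc k} \<in> G"
  shows "wp flip_program (200 + 60 * n + 4 * (M * (40 + 40 * n)))
    (\<lambda>s'. (\<not> ok \<and> agree scratch s s') \<or>
      (ok \<and> agree (scratch \<union> {1, 2, 3, 6}) s s' \<and> stores n l (rows @ [toggle Z D]) (insert (length rows) (A - {m})) s' \<and> s' 6 0 = 1)) s"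
proof -
  define Kp where "Kp = (\<lambda>Y b s'. agree scratch s s' \<and> target n Y s' \<and> Y \<subseteq> {1..n} \<and> s' 11 0 = of_bool b)"
  have Zn: "Z \<subseteq> {1..n}" using rows nth_mem[OF m(2)] unfolding Z_def by blast
  have stK: "stores n l rows A s'" if "agree scratch s s'" for s' by (rule stores_cong[OF st that]) simp
  have idx: "s' 7 0 = m" "s' 8 0 = i" "s' 9 0 = j" "s' 10 0 = k" if "agree scratch s s'" for s'
    using agreeD[OF that, of 7] agreeD[OF that, of 8] agreeD[OF that, of 9] agreeD[OF that, of 10] m x by simp_all
  have tog: "triple (Kp Y b) (toggle_target v) 8 (Kp (toggle Y {Suc y}) b)"
    if v: "v = 8 \<and> y = i \<or> v = 9 \<and> y = j \<or> v = 10 \<and> y = k" for v y Y b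
    unfolding triple_def
  proof (intro allI impI)
    fix s' assume K: "Kp Y b s'"
    then have ag: "agree scratch s s'" unfolding Kp_def by blast
    have y: "s' v 0 = y" "y < n" using v idx[OF ag] x by auto
    have Y: "target n Y s'" "Y \<subseteq> {1..n}" "s' 11 0 = of_bool b" using K unfolding Kp_def by auto
    show "wp (toggle_target v) 8 (Kp (toggle Y {Suc y}) b) s'"
    proof (rule wp_mono[OF wp_toggle_target[OF Y(1) y]])
      fix s'' assume h: "agree {4} s' s'' \<and> target n (toggle Y {Suc y}) s''"
      have "agree scratch s s''" by (rule agree_trans[OF ag conjunct1[OF h]]) auto
      moreover have "s'' 11 0 = of_bool b" using agreeD[OF conjunct1[OF h], of 11] Y(3) by simp
      ultimately show "Kp (toggle Y {Suc y}) b s''" unfolding Kp_def using h toggle_sub[OF Y(2) y(2)] by blast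
    qed simp
  qed
  have t8: "triple (Kp Y b) (toggle_target 8) 8 (Kp (toggle Y {Suc i}) b)"
    and t9: "triple (Kp Y b) (toggle_target 9) 8 (Kp (toggle Y {Suc j}) b)"
    and t10: "triple (Kp Y b) (toggle_target 10) 8 (Kp (toggle Y {Suc k}) b)" for Y b
    using tog by simp_all
  have chk: "triple (Kp Y b) check (20 + M * (40 + 40 * n)) (Kp Y (b \<and> Y \<in> G))" for Y b
    unfolding triple_def
  proof (intro allI impI)
    fix s' assume K: "Kp Y b s'"
    then have ag: "agree scratch s s'" and Y: "target n Y s'" "Y \<subseteq> {1..n}" "s' 11 0 = of_bool b" unfolding Kp_def by auto
    show "wp check (20 + M * (40 + 40 * n)) (Kp Y (b \<and> Y \<in> G)) s'"
    proof (rule wp_mono[OF wp_check[OF stK[OF ag] Y(1,2) rows M Y(3)]])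
      fix s'' assume h: "agree {11, 12, 13, 14, 15} s' s'' \<and> s'' 11 0 = of_bool (b \<and> Y \<in> collection rows A)"
      have "agree scratch s s''" by (rule agree_trans[OF ag conjunct1[OF h]]) auto
      moreover have "target n Y s''" using Y(1) agreeD[OF conjunct1[OF h], of 4] unfolding target_def by simp
      ultimately show "Kp Y (b \<and> Y \<in> G) s''" unfolding Kp_def G_def using h Y(2) by blast
    qed simp
  qed
  have start: "triple (\<lambda>s'. s' = s) (Assign 11 (Const 1)) 3 (\<lambda>s'. agree {11} s s' \<and> s' 11 0 = 1)"
    unfolding triple_def using agree_upd[OF agree_refl] by (intro allI impI wp_Write) auto
  have fl: "triple (\<lambda>s'. agree {11} s s' \<and> s' 11 0 = 1) fill (10 + 30 * n) (Kp Z True)"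
    unfolding triple_def
  proof (intro allI impI)
    fix s' assume h: "agree {11} s s' \<and> s' 11 0 = 1"
    have st': "stores n l rows A s'" by (rule stores_cong[OF st conjunct1[OF h]]) simp
    have m': "s' 7 0 = m" using agreeD[OF conjunct1[OF h], of 7] m by simp
    show "wp fill (10 + 30 * n) (Kp Z True) s'"
    proof (rule wp_mono[OF wp_fill[OF st' m' m(2)]])
      fix s'' assume g: "agree {4, 15} s' s'' \<and> target n (rows ! m) s''"
      have "agree scratch s s''" by (rule agree_trans[OF conjunct1[OF h] conjunct1[OF g]]) auto
      moreover have "s'' 11 0 = 1" using agreeD[OF conjunct1[OF g], of 11] h by simp
      ultimately show "Kp Z True s''" unfolding Kp_def using g Zn unfolding Z_def by simp
    qed simp
  qed
  let ?Q = "\<lambda>s'. (\<not> ok \<and> agree scratch s s') \<or>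
      (ok \<and> agree (scratch \<union> {1, 2, 3, 6}) s s' \<and> stores n l (rows @ [toggle Z D]) (insert (length rows) (A - {m})) s' \<and> s' 6 0 = 1)"
  have fin: "triple (Kp Y b) (Cond (Var 11) append_target Skip) (44 + 22 * n) ?Q"
    if "Y = toggle Z D" "b = ok" for Y b
    unfolding triple_def that
  proof (intro allI impI)
    fix s' assume K: "Kp (toggle Z D) ok s'"
    then have ag: "agree scratch s s'" and Y: "target n (toggle Z D) s'" "s' 11 0 = of_bool ok" unfolding Kp_def by auto
    show "wp (Cond (Var 11) append_target Skip) (44 + 22 * n) ?Q s'"
    proof (rule wp_Cond[where T = "40 + 22 * n" and U = 1])
      assume "val (Var 11) s' \<noteq> 0"
      then have ok: ok using Y(2) by auto
      show "wp append_target (40 + 22 * n) ?Q s'"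
      proof (rule wp_mono[OF wp_append_target[OF stK[OF ag] Y(1) idx(1)[OF ag] m(2)]])
        fix s'' assume h: "agree {1, 2, 3, 6, 15} s' s'' \<and> stores n l (rows @ [toggle Z D]) (insert (length rows) (A - {m})) s'' \<and> s'' 6 0 = 1"
        have "agree (scratch \<union> {1, 2, 3, 6}) s s''" by (rule agree_trans[OF ag conjunct1[OF h]]) auto
        then show "?Q s''" using h ok by blast
      qed simp
    next
      assume "val (Var 11) s' = 0"
      then have "\<not> ok" using Y(2) by auto
      then show "wp Skip 1 ?Q s'" using ag by (intro wp_Skip) auto
    qed simp
  qed
  have ne: "Suc i \<noteq> Suc j" "Suc i \<noteq> Suc k" "Suc j \<noteq> Suc k" using x by auto
  have D: "toggle (toggle (toggle (toggle (toggle (toggle (toggle Z {Suc i}) {Suc j}) {Suc i}) {Suc k}) {Suc j}) {Suc i}) {Suc j} = toggle Z D"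
    unfolding toggle_path[OF ne, of Z] D_def by (rule refl)
  have O: "((((True \<and> toggle Z {Suc i} \<in> G) \<and> toggle (toggle Z {Suc i}) {Suc j} \<in> G) \<and>
      toggle (toggle (toggle (toggle Z {Suc i}) {Suc j}) {Suc i}) {Suc k} \<in> G) \<and>
      toggle (toggle (toggle (toggle (toggle Z {Suc i}) {Suc j}) {Suc i}) {Suc k}) {Suc j} \<in> G) = ok"
    unfolding toggle_path[OF ne, of Z] ok_def by blast
  have "triple (\<lambda>s'. s' = s) flip_program (3 + (10 + 30 * n + (8 + (20 + M * (40 + 40 * n) + (8 + (20 + M * (40 + 40 * n) + (8 + (8 +
     (20 + M * (40 + 40 * n) + (8 + (20 + M * (40 + 40 * n) + (8 + (8 + (44 + 22 * n)))))))))))))) ?Q"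
    unfolding flip_program_def
    by (rule triple_Seq[OF start triple_Seq[OF fl triple_Seq[OF t8 triple_Seq[OF chk triple_Seq[OF t9 triple_Seq[OF chk
       triple_Seq[OF t8 triple_Seq[OF t10 triple_Seq[OF chk triple_Seq[OF t9 triple_Seq[OF chk triple_Seq[OF t8
       triple_Seq[OF t9 fin[OF D O]]]]]]]]]]]]]])
  then have "wp flip_program (3 + (10 + 30 * n + (8 + (20 + M * (40 + 40 * n) + (8 + (20 + M * (40 + 40 * n) + (8 + (8 +
     (20 + M * (40 + 40 * n) + (8 + (20 + M * (40 + 40 * n) + (8 + (8 + (44 + 22 * n)))))))))))))) ?Q s"
    unfolding triple_def by blast
  then show ?thesis by (rule wp_mono) simp_all
qed

section \<open>The search for a flip\<close>

fun guarded :: "expr list \<Rightarrow> prog \<Rightarrow> prog" where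
  "guarded [] p = p"
| "guarded (e # es) p = Cond e (guarded es p) Skip"

lemma wp_guarded:
  assumes "(\<And>e. e \<in> set es \<Longrightarrow> val e s \<noteq> 0) \<Longrightarrow> wp p T Q s" "\<And>e. e \<in> set es \<Longrightarrow> val e s = 0 \<Longrightarrow> Q s"
    and "(\<Sum>e\<leftarrow>es. 2 + expr_cost e) + T \<le> V"
  shows "wp (guarded es p) V Q s"
  using assms
proof (induction es arbitrary: V)
  case Nil
  then show ?case using wp_mono by fastforce
next
  case (Cons e es)
  show ?case unfolding guarded.simps
  proof (rule wp_Cond[where U = 1])
    assume "val e s \<noteq> 0"
    then show "wp (guarded es p) ((\<Sum>e\<leftarrow>es. 2 + expr_cost e) + T) Q s" using Cons.prems(1,2) by (intro Cons.IH) auto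
  next
    assume "val e s = 0"
    then show "wp Skip 1 Q s" using Cons.prems(2) by (intro wp_Skip) auto
  qed (use Cons.prems(3) in simp)
qed

abbreviation equals :: "expr \<Rightarrow> expr \<Rightarrow> expr" where "equals e f \<equiv> Sub (Const 1) (neq e f)"

text \<open>Under truncated subtraction, \<open>Sub (Var 9) (Var 8)\<close> is the test
  \<open>i < j\<close>. The last three guards compare the membership of \<open>i, k, j\<close> in
  the row with the direction stored in 5.\<close>

definition attempt_guards :: "expr list" where
  "attempt_guards = [Read 2 (Var 7), Sub (Var 9) (Var 8), Sub (Var 10) (Var 9),
     equals (entry 7 8) (Var 5), equals (entry 7 10) (Var 5), neq (entry 7 9) (Var 5)]"

text \<open>Once a flip has been made, the rest of the pass is idle, since its search refers to the
  collection before the flip.\<close>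

definition attempt :: prog where
  "attempt = Cond (Var 6) Skip (guarded attempt_guards flip_program)"

definition attempt_time :: "nat \<Rightarrow> nat \<Rightarrow> nat" where
  "attempt_time n M = 300 + 60 * n + 4 * (M * (40 + 40 * n))"

text \<open>Loop indices start at 0, elements of the ground set at 1; this is the origin of the
  successors.\<close>

definition flips_at :: "nat \<Rightarrow> bool \<Rightarrow> nat set list \<Rightarrow> nat set \<Rightarrow> nat \<Rightarrow> nat \<Rightarrow> nat \<Rightarrow> nat \<Rightarrow> bool" where
  "flips_at n u rows A m i j k \<longleftrightarrow> m \<in> A \<and> can_flip n u (collection rows A) (rows ! m) (Suc i) (Suc j) (Suc k)"

lemma wp_attempt:
  assumes st: "stores n l rows A s" and rows: "set rows \<subseteq> Pow {1..n}" and M: "length rows \<le> M"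
    and u: "s 5 0 = of_bool u" and chg: "s 6 0 = 0"
    and m: "s 7 0 = m" "m < length rows" and x: "s 8 0 = i" "s 9 0 = j" "s 10 0 = k" "i < n" "j < n" "k < n"
  shows "wp attempt (attempt_time n M)
    (\<lambda>s'. (\<not> flips_at n u rows A m i j k \<and> agree scratch s s') \<or>
      (flips_at n u rows A m i j k \<and> agree (scratch \<union> {1, 2, 3, 6}) s s' \<and>
       stores n l (rows @ [toggle (rows ! m) {Suc i, Suc j, Suc k}]) (insert (length rows) (A - {m})) s' \<and> s' 6 0 = 1)) s"
  (is "wp _ _ ?Q s")
proof -
  let ?f = "flips_at n u rows A m i j k"
  let ?G = "collection rows A" and ?Z = "rows ! m"
  have al: "s 2 m = of_bool (m \<in> A)" using st m unfolding stores_def by blast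
  have e: "val (entry 7 8) s = of_bool (Suc i \<in> ?Z)" "val (entry 7 9) s = of_bool (Suc j \<in> ?Z)"
    "val (entry 7 10) s = of_bool (Suc k \<in> ?Z)"
    using val_entry[OF st, of 7 8] val_entry[OF st, of 7 9] val_entry[OF st, of 7 10] m x by simp_all
  have n5: "val (neq f (Var 5)) s = 0 \<longleftrightarrow> (b = u)" if "val f s = of_bool b" for f b
    unfolding val_neq that using u by simp
  have e5: "val (equals f g) s = 0 \<longleftrightarrow> val (neq f g) s \<noteq> 0" for f g by auto
  have vals: "(\<forall>e\<in>set attempt_guards. val e s \<noteq> 0) \<longleftrightarrow>
      m \<in> A \<and> i < j \<and> j < k \<and> (Suc i \<in> ?Z) = u \<and> (Suc k \<in> ?Z) = u \<and> (Suc j \<in> ?Z) = (\<not> u)"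
    unfolding attempt_guards_def list.set ball_simps e5 n5[OF e(1)] n5[OF e(2)] n5[OF e(3)]
    using al m x by auto
  have zG: "?Z \<in> ?G" if "m \<in> A" using that m unfolding collection_def by blast
  have f: "?f \<longleftrightarrow> (\<forall>e\<in>set attempt_guards. val e s \<noteq> 0) \<and> toggle ?Z {Suc i} \<in> ?G \<and> toggle ?Z {Suc i, Suc j} \<in> ?G \<and>
      toggle ?Z {Suc j, Suc k} \<in> ?G \<and> toggle ?Z {Suc k} \<in> ?G"
    unfolding vals flips_at_def can_flip_def using zG x by auto
  show ?thesis unfolding attempt_def
  proof (rule wp_Cond[where T = 1 and U = "296 + 60 * n + 4 * (M * (40 + 40 * n))"])
    assume "val (Var 6) s \<noteq> 0"
    then show "wp Skip 1 ?Q s" using chg by simp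
  next
    show "wp (guarded attempt_guards flip_program) (296 + 60 * n + 4 * (M * (40 + 40 * n))) ?Q s"
    proof (rule wp_guarded[where T = "200 + 60 * n + 4 * (M * (40 + 40 * n))"])
      assume "\<And>e. e \<in> set attempt_guards \<Longrightarrow> val e s \<noteq> 0"
      then have g: "\<forall>e\<in>set attempt_guards. val e s \<noteq> 0" by blast
      then have ijk: "i < j" "j < k" unfolding vals by auto
      show "wp flip_program (200 + 60 * n + 4 * (M * (40 + 40 * n))) ?Q s"
        using wp_flip_program[OF st rows M m x(1-3) ijk x(6)] f g by simp
    next
      fix e assume "e \<in> set attempt_guards" "val e s = 0"
      then have "\<not> ?f" using f by blast
      then show "?Q s" using agree_refl by blast
    qed (simp add: attempt_guards_def)
  qed (simp add: attempt_time_def)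
qed

text \<open>\<open>E\<close> pins down the indices of the outer loops, which the inner loops must
  leave alone. The bound on \<open>expr_cost e\<close> gives every level the same recurrence
  \<open>30 + M * (30 + T)\<close> for its time.\<close>

lemma wp_search_nested:
  assumes E: "\<And>s x. E s \<Longrightarrow> E (s(v := x))"
    and ind: "\<And>s x. Base s \<Longrightarrow> Base (s(v := x))" "\<And>s x. Done s \<Longrightarrow> Done (s(v := x))"
    and bound: "\<And>s. E s \<Longrightarrow> Base s \<or> Done s \<Longrightarrow> val e s = N"
    and body: "\<And>i s. i < N \<Longrightarrow> E s \<Longrightarrow> s v 0 = i \<Longrightarrow> Base s \<Longrightarrow>
       wp p T (\<lambda>s'. (E s' \<and> s' v 0 = i) \<and> ((Base s' \<and> \<not> \<phi> i) \<or> Done s')) s"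
    and stay: "\<And>i s. i < N \<Longrightarrow> E s \<Longrightarrow> s v 0 = i \<Longrightarrow> Done s \<Longrightarrow> wp p T (\<lambda>s'. (E s' \<and> s' v 0 = i) \<and> Done s') s"
    and NM: "N \<le> M" and ce: "expr_cost e \<le> 20" and V: "V = 30 + M * (30 + T)"
  shows "E s \<Longrightarrow> Base s \<Longrightarrow> wp (For v e p) V (\<lambda>s'. E s' \<and> ((Base s' \<and> (\<forall>i<N. \<not> \<phi> i)) \<or> Done s')) s"
    and "E s \<Longrightarrow> Done s \<Longrightarrow> wp (For v e p) V (\<lambda>s'. E s' \<and> Done s') s"
proof -
  have "M * (T + 10 + expr_cost e) \<le> M * (30 + T)" using ce by (intro mult_le_mono2) simp
  moreover have "7 + expr_cost e \<le> 30" using ce by simp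
  ultimately have V: "7 + expr_cost e + M * (T + 10 + expr_cost e) \<le> V" unfolding V by (intro add_mono)
  have "wp (For v e p) V (\<lambda>s'. (E s' \<and> Base s' \<and> (\<forall>i<N. \<not> \<phi> i)) \<or> (E s' \<and> Done s')) s" if h: "E s" "Base s"
  proof (rule wp_mono[OF wp_search[where Base = "\<lambda>s'. E s' \<and> Base s'" and Done = "\<lambda>s'. E s' \<and> Done s'" and \<phi> = \<phi> and N = N and M = M and T = T]])
    fix i s assume i: "i < N" "E s \<and> Base s" "s v 0 = i"
    show "wp p T (\<lambda>s'. s' v 0 = i \<and> ((E s' \<and> Base s') \<and> \<not> \<phi> i \<or> E s' \<and> Done s')) s"
      by (rule wp_mono[OF body[OF i(1) conjunct1[OF i(2)] i(3) conjunct2[OF i(2)]]]) auto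
  next
    fix i s assume i: "i < N" "E s \<and> Done s" "s v 0 = i"
    show "wp p T (\<lambda>s'. s' v 0 = i \<and> E s' \<and> Done s') s"
      by (rule wp_mono[OF stay[OF i(1) conjunct1[OF i(2)] i(3) conjunct2[OF i(2)]]]) auto
  qed (use h E ind bound NM V in auto)
  then show "E s \<Longrightarrow> Base s \<Longrightarrow> wp (For v e p) V (\<lambda>s'. E s' \<and> ((Base s' \<and> (\<forall>i<N. \<not> \<phi> i)) \<or> Done s')) s"
    by (rule wp_mono) auto
  show "wp (For v e p) V (\<lambda>s'. E s' \<and> Done s') s" if h: "E s" "Done s"
  proof (rule wp_For[where J = "\<lambda>_ s'. E s' \<and> Done s'" and N = N and M = M and T = T])
    fix i s assume i: "i < N" "E s \<and> Done s" "s v 0 = i"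
    show "wp p T (\<lambda>s'. s' v 0 = i \<and> E s' \<and> Done s') s"
      by (rule wp_mono[OF stay[OF i(1) conjunct1[OF i(2)] i(3) conjunct2[OF i(2)]]]) auto
  qed (use h E ind bound NM V in auto)
qed

text \<open>\<open>For\<close> evaluates its bound in every round, and a flip raises the number of
  rows; the outer bound is therefore frozen in 16.\<close>

definition pass :: prog where
  "pass = Seq (Assign 16 count_expr)
    (For 7 (Var 16) (For 8 size_expr (For 9 size_expr (For 10 size_expr attempt))))"

definition pass_time :: "nat \<Rightarrow> nat \<Rightarrow> nat" where
  "pass_time n M = 40 + M * (60 + n * (60 + n * (60 + n * (30 + attempt_time n M))))"

definition flipped :: "nat \<Rightarrow> nat \<Rightarrow> bool \<Rightarrow> nat set list \<Rightarrow> nat set \<Rightarrow> state \<Rightarrow> bool" where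
  "flipped n l u rows A s \<longleftrightarrow> (\<exists>m i j k. m < length rows \<and> flips_at n u rows A m i j k \<and>
     stores n l (rows @ [toggle (rows ! m) {Suc i, Suc j, Suc k}]) (insert (length rows) (A - {m})) s)"

lemma wp_pass:
  assumes st: "stores n l rows A s" and rows: "set rows \<subseteq> Pow {1..n}" and M: "length rows \<le> M"
    and u: "s 5 0 = of_bool u" and chg: "s 6 0 = 0"
  shows "wp pass (pass_time n M)
    (\<lambda>s'. s' 5 0 = of_bool u \<and> ((stores n l rows A s' \<and> s' 6 0 = 0 \<and>
        (\<forall>m<length rows. \<forall>i<n. \<forall>j<n. \<forall>k<n. \<not> flips_at n u rows A m i j k)) \<or>
      (flipped n l u rows A s' \<and> s' 6 0 = 1))) s"
proof -
  let ?c = "length rows"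
  define Base where "Base = (\<lambda>s'. stores n l rows A s' \<and> s' 5 0 = of_bool u \<and> s' 6 0 = 0 \<and> s' 16 0 = ?c)"
  define Done where "Done = (\<lambda>s'. flipped n l u rows A s' \<and> s' 5 0 = of_bool u \<and> s' 6 0 = 1 \<and> s' 16 0 = ?c)"
  have st_upd: "stores n l R B (s(v := x))" if "stores n l R B s" "v \<in> {7, 8, 9, 10}" for R B s v x
    by (rule stores_cong[OF that(1), of "{v}"]) (use that in \<open>auto simp: agree_def\<close>)
  have indB: "Base (s(v := x))" if "Base s" "v \<in> {7, 8, 9, 10}" for s v x
    using that st_upd unfolding Base_def by auto
  have indD: "Done (s(v := x))" if "Done s" "v \<in> {7, 8, 9, 10}" for s v x
  proof -
    have "flipped n l u rows A s" using that(1) unfolding Done_def by simp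
    then obtain m i j k where h: "m < length rows" "flips_at n u rows A m i j k"
      "stores n l (rows @ [toggle (rows ! m) {Suc i, Suc j, Suc k}]) (insert (length rows) (A - {m})) s"
      unfolding flipped_def by auto
    have "flipped n l u rows A (s(v := x))" unfolding flipped_def using h(1,2) st_upd[OF h(3) that(2)] by blast
    then show ?thesis using that unfolding Done_def by auto
  qed
  have size: "val size_expr s = n" if "Base s \<or> Done s" for s
    using that unfolding Base_def Done_def flipped_def stores_def by auto
  have count: "val (Var 16) s = ?c" if "Base s \<or> Done s" for s
    using that unfolding Base_def Done_def by auto
  define E7 where "E7 = (\<lambda>m (s'::state). s' 7 0 = m)"
  define E8 where "E8 = (\<lambda>m i (s'::state). s' 7 0 = m \<and> s' 8 0 = i)"
  define E9 where "E9 = (\<lambda>m i j (s'::state). s' 7 0 = m \<and> s' 8 0 = i \<and> s' 9 0 = j)"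
  have A1: "wp attempt (attempt_time n M) (\<lambda>s'. (E9 m i j s' \<and> s' 10 0 = k) \<and> ((Base s' \<and> \<not> flips_at n u rows A m i j k) \<or> Done s')) s"
    if b: "m < ?c" "i < n" "j < n" "k < n" "E9 m i j s" "s 10 0 = k" "Base s" for m i j k s
  proof -
    have B: "stores n l rows A s" "s 5 0 = of_bool u" "s 6 0 = 0" "s 16 0 = ?c" using b(7) unfolding Base_def by auto
    have v: "s 7 0 = m" "s 8 0 = i" "s 9 0 = j" using b(5) unfolding E9_def by auto
    show ?thesis
    proof (rule wp_mono[OF wp_attempt[OF B(1) rows M B(2,3) v(1) b(1) v(2,3) b(6) b(2-4)]], elim disjE)
      fix s' assume h: "\<not> flips_at n u rows A m i j k \<and> agree scratch s s'"
      have "stores n l rows A s'" by (rule stores_cong[OF B(1) conjunct2[OF h]]) simp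
      moreover have "s' 5 = s 5" "s' 6 = s 6" "s' 7 = s 7" "s' 8 = s 8" "s' 9 = s 9" "s' 10 = s 10" "s' 16 = s 16"
        using agreeD[OF conjunct2[OF h]] by auto
      ultimately show "(E9 m i j s' \<and> s' 10 0 = k) \<and> ((Base s' \<and> \<not> flips_at n u rows A m i j k) \<or> Done s')"
        using h B v b(6) unfolding E9_def Base_def by simp
    next
      fix s' assume h: "flips_at n u rows A m i j k \<and> agree (scratch \<union> {1, 2, 3, 6}) s s' \<and>
       stores n l (rows @ [toggle (rows ! m) {Suc i, Suc j, Suc k}]) (insert ?c (A - {m})) s' \<and> s' 6 0 = 1"
      then have "flipped n l u rows A s'" unfolding flipped_def using b(1) by blast
      moreover have "s' 5 = s 5" "s' 7 = s 7" "s' 8 = s 8" "s' 9 = s 9" "s' 10 = s 10" "s' 16 = s 16"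
        using agreeD[of "scratch \<union> {1, 2, 3, 6}" s s'] h by auto
      ultimately show "(E9 m i j s' \<and> s' 10 0 = k) \<and> ((Base s' \<and> \<not> flips_at n u rows A m i j k) \<or> Done s')"
        using h B v b(6) unfolding E9_def Done_def by simp
    qed simp
  qed
  have A2: "wp attempt (attempt_time n M) (\<lambda>s'. (E9 m i j s' \<and> s' 10 0 = k) \<and> Done s') s"
    if "E9 m i j s" "s 10 0 = k" "Done s" for m i j k s
    unfolding attempt_def
  proof (rule wp_Cond[where T = 1 and U = 0])
    show "wp Skip 1 (\<lambda>s'. (E9 m i j s' \<and> s' 10 0 = k) \<and> Done s') s" using that by (intro wp_Skip) auto
  qed (use that in \<open>auto simp: Done_def attempt_time_def\<close>)
  let ?T9 = "30 + n * (30 + attempt_time n M)"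
  let ?T8 = "30 + n * (30 + ?T9)"
  let ?T7 = "30 + n * (30 + ?T8)"
  have B: "wp (For 10 size_expr attempt) ?T9 (\<lambda>s'. E9 m i j s' \<and> ((Base s' \<and> (\<forall>k<n. \<not> flips_at n u rows A m i j k)) \<or> Done s')) s"
    if "m < ?c" "i < n" "j < n" "E9 m i j s" "Base s" for m i j s
  proof (rule wp_search_nested(1)[where N = n and M = n and T = "attempt_time n M"])
  qed (use that indB indD size A1 A2 in \<open>auto simp: E9_def\<close>)
  have B': "wp (For 10 size_expr attempt) ?T9 (\<lambda>s'. E9 m i j s' \<and> Done s') s"
    if "m < ?c" "i < n" "j < n" "E9 m i j s" "Done s" for m i j s
  proof (rule wp_search_nested(2)[where N = n and M = n and T = "attempt_time n M" and Base = Base and \<phi> = "\<lambda>k. flips_at n u rows A m i j k"])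
  qed (use that indB indD size A1 A2 in \<open>auto simp: E9_def\<close>)
  have E89: "E9 m i j s \<longleftrightarrow> E8 m i s \<and> s 9 0 = j" for m i j s unfolding E8_def E9_def by blast
  have C: "wp (For 9 size_expr (For 10 size_expr attempt)) ?T8
      (\<lambda>s'. E8 m i s' \<and> ((Base s' \<and> (\<forall>j<n. \<not> (\<exists>k<n. flips_at n u rows A m i j k))) \<or> Done s')) s"
    if "m < ?c" "i < n" "E8 m i s" "Base s" for m i s
  proof (rule wp_search_nested(1)[where N = n and M = n and T = ?T9])
  qed (use that indB indD size B B' in \<open>auto simp: E8_def E89\<close>)
  have C': "wp (For 9 size_expr (For 10 size_expr attempt)) ?T8 (\<lambda>s'. E8 m i s' \<and> Done s') s"
    if "m < ?c" "i < n" "E8 m i s" "Done s" for m i s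
  proof (rule wp_search_nested(2)[where N = n and M = n and T = ?T9 and Base = Base and \<phi> = "\<lambda>j. \<exists>k<n. flips_at n u rows A m i j k"])
  qed (use that indB indD size B B' in \<open>auto simp: E8_def E89\<close>)
  have E78: "E8 m i s \<longleftrightarrow> E7 m s \<and> s 8 0 = i" for m i s unfolding E8_def E7_def by blast
  have D: "wp (For 8 size_expr (For 9 size_expr (For 10 size_expr attempt))) ?T7
      (\<lambda>s'. E7 m s' \<and> ((Base s' \<and> (\<forall>i<n. \<not> (\<exists>j<n. \<exists>k<n. flips_at n u rows A m i j k))) \<or> Done s')) s"
    if "m < ?c" "E7 m s" "Base s" for m s
  proof (rule wp_search_nested(1)[where N = n and M = n and T = ?T8])
  qed (use that indB indD size C C' in \<open>auto simp: E7_def E78\<close>)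
  have D': "wp (For 8 size_expr (For 9 size_expr (For 10 size_expr attempt))) ?T7 (\<lambda>s'. E7 m s' \<and> Done s') s"
    if "m < ?c" "E7 m s" "Done s" for m s
  proof (rule wp_search_nested(2)[where N = n and M = n and T = ?T8 and Base = Base and \<phi> = "\<lambda>i. \<exists>j<n. \<exists>k<n. flips_at n u rows A m i j k"])
  qed (use that indB indD size C C' in \<open>auto simp: E7_def E78\<close>)
  have F: "wp (For 7 (Var 16) (For 8 size_expr (For 9 size_expr (For 10 size_expr attempt)))) (30 + M * (30 + ?T7))
      (\<lambda>s'. True \<and> ((Base s' \<and> (\<forall>m<?c. \<not> (\<exists>i<n. \<exists>j<n. \<exists>k<n. flips_at n u rows A m i j k))) \<or> Done s')) s"
    if "Base s" for s
  proof (rule wp_search_nested(1)[where N = ?c and M = M and T = ?T7 and E = "\<lambda>_. True"])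
  qed (use that indB indD count D D' M in \<open>auto simp: E7_def\<close>)
  have s16: "wp (Assign 16 count_expr) 4 Base s"
  proof (rule wp_Write)
    have "stores n l rows A (s(16 := (s 16)(0 := ?c)))" by (rule stores_cong[OF st, of "{16}"]) (auto simp: agree_def)
    moreover have "val count_expr s = ?c" using st unfolding stores_def by simp
    ultimately show "Base (s(16 := (s 16)(val (Const 0) s := val count_expr s)))" unfolding Base_def using u chg by simp
  qed simp
  have "wp pass (4 + (30 + M * (30 + ?T7)))
      (\<lambda>s'. True \<and> ((Base s' \<and> (\<forall>m<?c. \<not> (\<exists>i<n. \<exists>j<n. \<exists>k<n. flips_at n u rows A m i j k))) \<or> Done s')) s"
    unfolding pass_def by (rule wp_Seq[OF s16 F]) simp_all
  then show ?thesis
    by (rule wp_mono) (auto simp: Base_def Done_def pass_time_def algebra_simps)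
qed

text \<open>Injectivity on the marked rows ensures that unmarking one index removes exactly one set
  from the collection.\<close>

definition progress :: "nat \<Rightarrow> bool \<Rightarrow> nat set set \<Rightarrow> nat set list \<Rightarrow> nat set list \<Rightarrow> nat set \<Rightarrow> bool" where
  "progress n u W rows0 rows A \<longleftrightarrow> (\<exists>xs. rows = rows0 @ xs \<and> flips n u W xs (collection rows A)) \<and>
     A \<subseteq> {..<length rows} \<and> inj_on ((!) rows) A \<and> set rows \<subseteq> Pow {1..n}"

lemma collection_image: "A \<subseteq> {..<length rows} \<Longrightarrow> collection rows A = (!) rows ` A"
  unfolding collection_def by auto

lemma progress_flip:
  assumes W: "max_weak n W" and p: "progress n u W rows0 rows A" and f: "flips_at n u rows A m i j k"
  defines "T \<equiv> toggle (rows ! m) {Suc i, Suc j, Suc k}"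
  defines "rows' \<equiv> rows @ [T]" and "A' \<equiv> insert (length rows) (A - {m})"
  shows "progress n u W rows0 rows' A'"
    "potential n u (collection rows A) = Suc (potential n u (collection rows' A'))"
proof -
  let ?G = "collection rows A"
  obtain xs where xs: "rows = rows0 @ xs" "flips n u W xs ?G" and A: "A \<subseteq> {..<length rows}"
    and inj: "inj_on ((!) rows) A" and rn: "set rows \<subseteq> Pow {1..n}" using p unfolding progress_def by blast
  have m: "m \<in> A" and c: "can_flip n u ?G (rows ! m) (Suc i) (Suc j) (Suc k)" using f unfolding flips_at_def by auto
  have G: "max_weak n ?G" using flips_max_weak[OF xs(2) W] by blast
  note cm = can_flip_max_weak[OF G c, folded T_def]
  have A': "A' \<subseteq> {..<length rows'}" using A unfolding A'_def rows'_def by auto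
  have same: "rows' ! x = rows ! x" if "x \<in> A" for x using that A unfolding rows'_def by (auto simp: nth_append)
  have last: "rows' ! length rows = T" unfolding rows'_def by simp
  have "collection rows' A' = insert T ((!) rows' ` (A - {m}))"
    using collection_image[OF A'] last unfolding A'_def by simp
  also have "(!) rows' ` (A - {m}) = (!) rows ` (A - {m})" using same by (intro image_cong) auto
  also have "\<dots> = (!) rows ` A - (!) rows ` {m}" using inj_on_image_set_diff[OF inj, of A "{m}"] m by blast
  also have "\<dots> = ?G - {rows ! m}" using collection_image[OF A] by simp
  finally have coll: "collection rows' A' = insert T (?G - {rows ! m})" .
  have fl: "flips n u W (xs @ [T]) (collection rows' A')"
    unfolding coll T_def by (rule flips.more[OF xs(2) c])
  have Tn: "T \<subseteq> {1..n}" using max_weak_sub[OF cm(1), of T] by blast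
  have "inj_on ((!) rows') A'"
    unfolding A'_def
  proof (rule inj_on_insert[THEN iffD2], intro conjI)
    show "inj_on ((!) rows') (A - {m})"
      using inj same unfolding inj_on_def by auto
    have "(!) rows' ` (A - {m} - {length rows}) \<subseteq> ?G" using same collection_image[OF A] by auto
    then show "rows' ! length rows \<notin> (!) rows' ` (A - {m} - {length rows})" using last cm(2) by auto
  qed
  moreover have "set rows' \<subseteq> Pow {1..n}" using rn Tn unfolding rows'_def by simp
  moreover have "rows' = rows0 @ (xs @ [T])" unfolding rows'_def xs(1) by simp
  ultimately show "progress n u W rows0 rows' A'" unfolding progress_def using fl A' by blast
  show "potential n u ?G = Suc (potential n u (collection rows' A'))"
    unfolding coll using potential_flip[OF G c] unfolding T_def .
qed

definition flip_loop :: prog where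
  "flip_loop = While (Var 6) (Seq (Assign 6 (Const 0)) pass)"

text \<open>Every pass except the last makes one flip, which adds a row and lowers the potential by
  one. So \<open>length rows + p\<close> is constant, and \<open>M\<close> bounds the number of rows
  throughout.\<close>

lemma wp_flip_loop:
  assumes W: "max_weak n W"
  shows "\<lbrakk>progress n u W rows0 rows A; stores n l rows A s; s 5 0 = of_bool u; s 6 0 = 1;
    potential n u (collection rows A) = p; length rows + p \<le> M\<rbrakk> \<Longrightarrow>
    wp flip_loop (4 + Suc p * (pass_time n M + 10)) (\<lambda>s'. \<exists>rows' A'. progress n u W rows0 rows' A' \<and>
      stores n l rows' A' s' \<and> (\<forall>Z i j k. \<not> can_flip n u (collection rows' A') Z i j k)) s"
  (is "_ \<Longrightarrow> _ \<Longrightarrow> _ \<Longrightarrow> _ \<Longrightarrow> _ \<Longrightarrow> _ \<Longrightarrow> wp _ _ ?Q s")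
proof (induction p arbitrary: rows A s rule: less_induct)
  case (less p)
  have pr: "progress n u W rows0 rows A" and st: "stores n l rows A s" and u: "s 5 0 = of_bool u" and c: "s 6 0 = 1"
    and p: "potential n u (collection rows A) = p" and M: "length rows + p \<le> M" using less.prems by auto
  have rn: "set rows \<subseteq> Pow {1..n}" using pr unfolding progress_def by blast
  let ?X = "pass_time n M + 10"
  let ?R = "\<lambda>s'. s' 5 0 = of_bool u \<and> ((stores n l rows A s' \<and> s' 6 0 = 0 \<and>
        (\<forall>m<length rows. \<forall>i<n. \<forall>j<n. \<forall>k<n. \<not> flips_at n u rows A m i j k)) \<or>
      (flipped n l u rows A s' \<and> s' 6 0 = 1))"
  have step: "wp (Seq (Assign 6 (Const 0)) pass) (3 + pass_time n M) ?R s"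
  proof (rule wp_Seq[where T = 3 and U = "pass_time n M" and R = "\<lambda>s'. s' = s(6 := (s 6)(0 := 0))"])
    show "wp (Assign 6 (Const 0)) 3 (\<lambda>s'. s' = s(6 := (s 6)(0 := 0))) s" by (intro wp_Write) simp_all
  next
    fix s' assume s': "s' = s(6 := (s 6)(0 := 0))"
    have "stores n l rows A s'" by (rule stores_cong[OF st, of "{6}"]) (auto simp: s' agree_def)
    then show "wp pass (pass_time n M) ?R s'" using wp_pass[of n l rows A s' M u] rn M u s' by simp
  qed simp
  show ?case unfolding flip_loop_def
  proof (rule wp_While_True[OF _ step, where U = "4 + p * ?X"])
    show "val (Var 6) s \<noteq> 0" using c by simp
    show "1 + expr_cost (Var 6) + (3 + pass_time n M) + (4 + p * ?X) \<le> 4 + Suc p * ?X" by simp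
  next
    fix s' assume R: "?R s'"
    show "wp (While (Var 6) (Seq (Assign 6 (Const 0)) pass)) (4 + p * ?X) ?Q s'"
    proof (cases "s' 6 0 = 0")
      case True
      then have n: "stores n l rows A s'" "\<forall>m<length rows. \<forall>i<n. \<forall>j<n. \<forall>k<n. \<not> flips_at n u rows A m i j k" using R by auto
      have no: "\<not> can_flip n u (collection rows A) Z i j k" for Z i j k
      proof
        assume f: "can_flip n u (collection rows A) Z i j k"
        then obtain m where m: "m < length rows" "m \<in> A" "Z = rows ! m" unfolding can_flip_def collection_def by blast
        have b: "1 \<le> i" "i < j" "j < k" "k \<le> n" using f unfolding can_flip_def by auto
        have "Suc (i - 1) = i" "Suc (j - 1) = j" "Suc (k - 1) = k" using b by auto
        then have "flips_at n u rows A m (i - 1) (j - 1) (k - 1)" unfolding flips_at_def using f m by simp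
        moreover have "i - 1 < n" "j - 1 < n" "k - 1 < n" using b by auto
        ultimately show False using n(2) m(1) by blast
      qed
      show ?thesis
        by (rule wp_While_False) (use True n(1) pr no in auto)
    next
      case False
      then have fl: "flipped n l u rows A s'" "s' 6 0 = 1" "s' 5 0 = of_bool u" using R by auto
      obtain m i j k where f: "m < length rows" "flips_at n u rows A m i j k"
        "stores n l (rows @ [toggle (rows ! m) {Suc i, Suc j, Suc k}]) (insert (length rows) (A - {m})) s'"
        using fl(1) unfolding flipped_def by auto
      let ?rows = "rows @ [toggle (rows ! m) {Suc i, Suc j, Suc k}]"
      let ?A = "insert (length rows) (A - {m})"
      note pf = progress_flip[OF W pr f(2)]
      have sp: "p = Suc (potential n u (collection ?rows ?A))" using pf(2) p by simp
      define p' where "p' = potential n u (collection ?rows ?A)"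
      have "wp flip_loop (4 + Suc p' * ?X) ?Q s'"
        by (rule less.IH[OF _ pf(1) f(3) fl(3,2)]) (use sp M in \<open>auto simp: p'_def\<close>)
      then show ?thesis unfolding flip_loop_def sp p'_def .
    qed
  qed
qed

text \<open>With truncated subtraction, \<open>1 - (1 - (l - i))\<close> is 1 if
  \<open>i < l\<close> and 0 otherwise. The number \<open>l\<close> is read from the input, and the
  first \<open>l\<close> rows are the input sets; the second phase thus starts again from
  \<open>W\<close> although the rows of the first phase remain stored.\<close>

definition revive :: prog where
  "revive = For 14 count_expr (Write 2 (Var 14) (Sub (Const 1) (Sub (Const 1) (Sub (Read 0 (Const 1)) (Var 14)))))"

lemma wp_revive:
  assumes st: "stores n l rows A s" and M: "length rows \<le> M"
  shows "wp revive (9 + 24 * M) (\<lambda>s'. agree {2, 14} s s' \<and> stores n l rows {..<l} s') s"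
proof -
  have "wp revive (9 + 24 * M) (\<lambda>s'. agree {2, 14} s s' \<and> (\<forall>m<length rows. s' 2 m = of_bool (m < l))) s"
    unfolding revive_def
  proof (rule wp_For_agree[where V = "{2, 14}" and N = "length rows" and M = M and T = 12])
    fix i s' assume i: "i < length rows" and ag: "agree {2, 14} s s'" and J: "\<forall>m<i. s' 2 m = of_bool (m < l)" and v: "s' 14 0 = i"
    have l: "s' 0 1 = l" using agreeD[OF ag, of 0] st unfolding stores_def by simp
    have e: "val (Sub (Const 1) (Sub (Const 1) (Sub (Read 0 (Const 1)) (Var 14)))) s' = of_bool (i < l)" using l v by simp
    show "wp (Write 2 (Var 14) (Sub (Const 1) (Sub (Const 1) (Sub (Read 0 (Const 1)) (Var 14))))) 12
       (\<lambda>s'. s' 14 0 = i \<and> agree {2, 14} s s' \<and> (\<forall>m<Suc i. s' 2 m = of_bool (m < l))) s'"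
    proof (rule wp_Write, unfold e)
      show "(s'(2 := (s' 2)(val (Var 14) s' := of_bool (i < l)))) 14 0 = i \<and> agree {2, 14} s (s'(2 := (s' 2)(val (Var 14) s' := of_bool (i < l)))) \<and>
        (\<forall>m<Suc i. (s'(2 := (s' 2)(val (Var 14) s' := of_bool (i < l)))) 2 m = of_bool (m < l))"
        using J v agree_upd[OF ag, of 2] by (auto simp: less_Suc_eq)
    qed simp
  next
    fix s' assume "agree {2, 14} s s'"
    then have "s' 1 = s 1" by (rule agreeD) simp
    then show "val count_expr s' = length rows" using st unfolding stores_def by simp
  qed (use M in \<open>simp_all add: agree_refl\<close>)
  then show ?thesis
  proof (rule wp_mono)
    fix s' assume h: "agree {2, 14} s s' \<and> (\<forall>m<length rows. s' 2 m = of_bool (m < l))"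
    have "s' 0 = s 0" "s' 1 = s 1" "s' 3 = s 3" using agreeD[OF conjunct1[OF h]] by auto
    then show "agree {2, 14} s s' \<and> stores n l rows {..<l} s'" using st h unfolding stores_def by simp
  qed simp
qed

definition phase :: prog where "phase = Seq revive (Seq (Assign 6 (Const 1)) flip_loop)"

definition phase_time :: "nat \<Rightarrow> nat \<Rightarrow> nat \<Rightarrow> nat" where
  "phase_time n M p = 20 + 24 * M + Suc p * (pass_time n M + 10)"

lemma wp_phase:
  assumes st: "stores n l rows A s" and u: "s 5 0 = of_bool u" and l: "l \<le> length rows"
    and W: "collection rows {..<l} = W" "max_weak n W" and inj: "inj_on ((!) rows) {..<l}" and rn: "set rows \<subseteq> Pow {1..n}"
    and M: "length rows + potential n u W \<le> M" and p: "potential n u W \<le> p"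
  shows "wp phase (phase_time n M p) (\<lambda>s'. \<exists>xs A' G. flips n u W xs G \<and> (\<forall>Z i j k. \<not> can_flip n u G Z i j k) \<and>
    stores n l (rows @ xs) A' s' \<and> set (rows @ xs) \<subseteq> Pow {1..n}) s"
proof -
  let ?Q = "\<lambda>s'. \<exists>xs A' G. flips n u W xs G \<and> (\<forall>Z i j k. \<not> can_flip n u G Z i j k) \<and>
    stores n l (rows @ xs) A' s' \<and> set (rows @ xs) \<subseteq> Pow {1..n}"
  have pr: "progress n u W rows rows {..<l}" unfolding progress_def using flips.none W(1) l inj rn by auto
  have le: "4 + Suc (potential n u W) * (pass_time n M + 10) \<le> 4 + Suc p * (pass_time n M + 10)" using p by simp
  show ?thesis unfolding phase_def
  proof (rule wp_Seq[OF wp_revive[OF st], where U = "3 + (4 + Suc p * (pass_time n M + 10))"])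
    show "length rows \<le> M" using M by simp
    show "9 + 24 * M + (3 + (4 + Suc p * (pass_time n M + 10))) \<le> phase_time n M p" unfolding phase_time_def by simp
  next
    fix s1 assume s1: "agree {2, 14} s s1 \<and> stores n l rows {..<l} s1"
    show "wp (Seq (Assign 6 (Const 1)) flip_loop) (3 + (4 + Suc p * (pass_time n M + 10))) ?Q s1"
    proof (rule wp_Seq[where T = 3 and U = "4 + Suc p * (pass_time n M + 10)" and R = "\<lambda>s'. s' = s1(6 := (s1 6)(0 := 1))"])
      show "wp (Assign 6 (Const 1)) 3 (\<lambda>s'. s' = s1(6 := (s1 6)(0 := 1))) s1" by (intro wp_Write) simp_all
    next
      fix s2 assume s2: "s2 = s1(6 := (s1 6)(0 := 1))"
      have st2: "stores n l rows {..<l} s2" by (rule stores_cong[OF conjunct2[OF s1], of "{6}"]) (auto simp: s2 agree_def)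
      have u2: "s2 5 0 = of_bool u" "s2 6 0 = 1" using agreeD[OF conjunct1[OF s1], of 5] u s2 by auto
      show "wp flip_loop (4 + Suc p * (pass_time n M + 10)) ?Q s2"
      proof (rule wp_mono[OF wp_flip_loop[OF W(2) pr st2 u2 refl] _ le[folded W(1)]])
        show "length rows + potential n u (collection rows {..<l}) \<le> M" using M W(1) by simp
      next
        fix s' assume "\<exists>rows' A'. progress n u W rows rows' A' \<and> stores n l rows' A' s' \<and>
          (\<forall>Z i j k. \<not> can_flip n u (collection rows' A') Z i j k)"
        then obtain rows' A' where h: "progress n u W rows rows' A'" "stores n l rows' A' s'"
          "\<forall>Z i j k. \<not> can_flip n u (collection rows' A') Z i j k" by blast
        obtain xs where xs: "rows' = rows @ xs" "flips n u W xs (collection rows' A')" "set rows' \<subseteq> Pow {1..n}"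
          using h(1) unfolding progress_def by blast
        have "stores n l (rows @ xs) A' s'" "set (rows @ xs) \<subseteq> Pow {1..n}" using h(2) xs(1,3) by simp_all
        then show "?Q s'" using xs(2) h(3) by blast
      qed
    qed simp
  qed
qed

section \<open>The algorithm\<close>

lemma nth_concat_map:
  assumes "\<And>X. length (f X) = n"
  shows "m < length Xs \<Longrightarrow> x < n \<Longrightarrow> concat (map f Xs) ! (m * n + x) = f (Xs ! m) ! x"
proof (induction Xs arbitrary: m)
  case (Cons X Xs)
  show ?case
  proof (cases m)
    case 0 then show ?thesis using assms Cons.prems by (simp add: nth_append)
  next
    case (Suc m')
    have "\<not> m * n + x < n" "m * n + x - n = m' * n + x" using Suc by auto
    then show ?thesis using Cons.IH[of m'] Cons.prems assms[of X] Suc by (simp add: nth_append)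
  qed
qed simp

lemma length_encode: "length (encode n Xs) = 2 + length Xs * n"
proof -
  have "length (concat (map (\<lambda>X. map (\<lambda>i. if i \<in> X then 1 else (0::nat)) [1..<Suc n]) Xs)) = length Xs * n"
    by (induction Xs) auto
  then show ?thesis unfolding encode_def by simp
qed

lemma nth_encode:
  assumes "m < length Xs" "x < n"
  shows "encode n Xs ! (2 + m * n + x) = of_bool (Suc x \<in> Xs ! m)"
proof -
  have "encode n Xs ! (2 + m * n + x) = concat (map (\<lambda>X. map (\<lambda>i. if i \<in> X then 1 else 0) [1..<Suc n]) Xs) ! (m * n + x)"
    unfolding encode_def by simp
  also have "\<dots> = map (\<lambda>i. if i \<in> Xs ! m then 1 else 0) [1..<Suc n] ! x"
    by (rule nth_concat_map[OF _ assms]) simp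
  also have "\<dots> = of_bool (Suc x \<in> Xs ! m)" using assms(2) by (simp del: upt_Suc)
  finally show ?thesis .
qed

lemma encode_position_less:
  fixes m x n c :: nat
  assumes "m < c" "x < n" shows "2 + m * n + x < 2 + c * n"
proof -
  have "Suc m * n \<le> c * n" using assms(1) by (intro mult_le_mono1) simp
  then show ?thesis using assms(2) by simp
qed

lemma input_state_encode:
  "input_state (encode n Ws) 0 0 = n" "input_state (encode n Ws) 0 1 = length Ws"
  "m < length Ws \<Longrightarrow> x < n \<Longrightarrow> input_state (encode n Ws) 0 (2 + m * n + x) = of_bool (Suc x \<in> Ws ! m)"
  "a \<noteq> 0 \<Longrightarrow> input_state (encode n Ws) a i = 0"
proof -
  show "input_state (encode n Ws) 0 0 = n" "input_state (encode n Ws) 0 1 = length Ws"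
    unfolding input_state_def encode_def by simp_all
  show "a \<noteq> 0 \<Longrightarrow> input_state (encode n Ws) a i = 0" unfolding input_state_def by simp
  show "input_state (encode n Ws) 0 (2 + m * n + x) = of_bool (Suc x \<in> Ws ! m)" if "m < length Ws" "x < n"
    using encode_position_less[OF that] nth_encode[OF that] length_encode[of n Ws] unfolding input_state_def by simp
qed

lemma outputs_stores:
  assumes st: "stores n l rows A s"
  shows "outputs s (encode n rows)"
  unfolding outputs_def
proof (intro allI impI)
  fix i assume i: "i < length (encode n rows)"
  show "s 1 i = encode n rows ! i"
  proof (cases "i < 2")
    case True
    then have "i = 0 \<or> i = 1" by auto
    then show ?thesis using st unfolding stores_def encode_def by auto
  next
    case False
    define m where "m = (i - 2) div n"
    define x where "x = (i - 2) mod n"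
    have lt: "i - 2 < length rows * n" using i False unfolding length_encode by linarith
    \<comment> \<open>For \<open>n = 0\<close> the encoding ends after its two header
      entries.\<close>
    then have n: "0 < n" by (cases n) auto
    have x: "x < n" using n unfolding x_def by simp
    have m: "m < length rows" using lt unfolding m_def by (simp add: less_mult_imp_div_less)
    have "i - 2 = m * n + x" unfolding m_def x_def by simp
    then have "i = 2 + m * n + x" using False by linarith
    then show ?thesis using st m x nth_encode[OF m x] unfolding stores_def by simp
  qed
qed

text \<open>Input and output have the same layout, so the same start position addresses both
  arrays.\<close>

definition copy_row :: prog where
  "copy_row = For 15 size_expr (Write 1 (Add (Read 3 (Var 7)) (Var 15)) (Read 0 (Add (Read 3 (Var 7)) (Var 15))))"

definition load_row :: prog where
  "load_row = Seq copy_row (Write 3 (Add (Var 7) (Const 1)) (Add (Read 3 (Var 7)) size_expr))"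

definition init :: prog where
  "init = Seq (Write 1 (Const 0) (Read 0 (Const 0)))
    (Seq (Write 1 (Const 1) (Read 0 (Const 1)))
    (Seq (Write 3 (Const 0) (Const 2))
    (For 7 (Read 0 (Const 1)) load_row)))"

lemma wp_copy_row:
  assumes m: "s 7 0 = m" "s 3 m = 2 + m * n" and n: "s 1 0 = n"
  shows "wp copy_row (9 + 26 * n) (\<lambda>s'. agree {1, 15} s s' \<and> (\<forall>a<2 + m * n. s' 1 a = s 1 a) \<and>
     (\<forall>x<n. s' 1 (2 + m * n + x) = s 0 (2 + m * n + x))) s"
  unfolding copy_row_def
proof (rule wp_For[where N = n and M = n and T = 14 and J = "\<lambda>i s'. agree {1, 15} s s' \<and> (\<forall>a<2 + m * n. s' 1 a = s 1 a) \<and>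
     (\<forall>x<i. s' 1 (2 + m * n + x) = s 0 (2 + m * n + x))"])
  fix i s' assume i: "i < n" and J: "agree {1, 15} s s' \<and> (\<forall>a<2 + m * n. s' 1 a = s 1 a) \<and>
     (\<forall>x<i. s' 1 (2 + m * n + x) = s 0 (2 + m * n + x))" and v: "s' 15 0 = i"
  have e: "s' 3 = s 3" "s' 7 = s 7" "s' 0 = s 0" using agreeD[OF conjunct1[OF J]] by auto
  have a: "val (Add (Read 3 (Var 7)) (Var 15)) s' = 2 + m * n + i" using e m v by simp
  have b: "val (Read 0 (Add (Read 3 (Var 7)) (Var 15))) s' = s 0 (2 + m * n + i)" using e m v by simp
  show "wp (Write 1 (Add (Read 3 (Var 7)) (Var 15)) (Read 0 (Add (Read 3 (Var 7)) (Var 15)))) 14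
    (\<lambda>s'. s' 15 0 = i \<and> agree {1, 15} s s' \<and> (\<forall>a<2 + m * n. s' 1 a = s 1 a) \<and> (\<forall>x<Suc i. s' 1 (2 + m * n + x) = s 0 (2 + m * n + x))) s'"
    by (rule wp_Write, unfold a b) (use J v agree_upd[OF conjunct1[OF J], of 1] in \<open>auto simp: less_Suc_eq\<close>)
next
  show "agree {1, 15} s (s'(15 := x)) \<and> (\<forall>a<2 + m * n. (s'(15 := x)) 1 a = s 1 a) \<and> (\<forall>y<i. (s'(15 := x)) 1 (2 + m * n + y) = s 0 (2 + m * n + y))"
    if "agree {1, 15} s s' \<and> (\<forall>a<2 + m * n. s' 1 a = s 1 a) \<and> (\<forall>x<i. s' 1 (2 + m * n + x) = s 0 (2 + m * n + x))" for i s' x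
    using that agree_upd[of "{1, 15}" s s' 15 x] by simp
qed (use n in \<open>auto simp: agree_refl\<close>)

text \<open>The set of marked rows is still empty; each phase begins by setting the marks.\<close>

lemma wp_init:
  assumes M: "length Ws \<le> M"
  shows "wp init (20 + M * (32 + 26 * n)) (stores n (length Ws) Ws {}) (input_state (encode n Ws))"
proof -
  let ?s = "input_state (encode n Ws)"
  let ?c = "length Ws"
  let ?L = "\<lambda>m s'. s' 1 0 = n \<and> s' 1 1 = ?c \<and> (\<forall>m'<m. \<forall>x<n. s' 1 (2 + m' * n + x) = of_bool (Suc x \<in> Ws ! m')) \<and> (\<forall>m'\<le>m. s' 3 m' = 2 + m' * n)"
  let ?V = "{1, 3, 7, 15} :: nat set"
  note inp = input_state_encode[where n = n and Ws = Ws]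
  have loop: "wp (For 7 (Read 0 (Const 1)) load_row)
     (9 + M * (32 + 26 * n)) (\<lambda>s'. agree ?V ?s s' \<and> ?L ?c s') s1" if s1: "agree ?V ?s s1" "?L 0 s1" for s1
  proof (rule wp_For_agree[where V = ?V and L = ?L and N = ?c and M = M and T = "20 + 26 * n"])
    fix m s' assume m: "m < ?c" and ag: "agree ?V ?s s'" and L: "?L m s'" and v: "s' 7 0 = m"
    have s3: "s' 3 m = 2 + m * n" and s0: "s' 0 = ?s 0" using L agreeD[OF ag, of 0] by auto
    show "wp load_row (20 + 26 * n)
      (\<lambda>s'. s' 7 0 = m \<and> agree ?V ?s s' \<and> ?L (Suc m) s') s'"
      unfolding load_row_def
    proof (rule wp_Seq[OF wp_copy_row[OF v s3 conjunct1[OF L]], where U = 11])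
      fix s2 assume s2: "agree {1, 15} s' s2 \<and> (\<forall>a<2 + m * n. s2 1 a = s' 1 a) \<and> (\<forall>x<n. s2 1 (2 + m * n + x) = s' 0 (2 + m * n + x))"
      have e: "s2 3 = s' 3" "s2 7 = s' 7" using agreeD[OF conjunct1[OF s2]] by auto
      have lo: "s2 1 a = s' 1 a" if "a < 2 + m * n" for a using s2 that by blast
      have h1: "s2 1 0 = n" "s2 1 1 = ?c" using L lo[of 0] lo[of 1] by auto
      have bits: "s2 1 (2 + m' * n + x) = of_bool (Suc x \<in> Ws ! m')" if "m' < Suc m" "x < n" for m' x
      proof (cases "m' = m")
        case True
        then show ?thesis using s2 inp(3)[OF m that(2)] s0 that(2) by simp
      next
        case False
        then have "m' < m" using that by simp
        then show ?thesis using lo[OF encode_position_less[OF _ that(2)]] L that(2) by simp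
      qed
      have a: "val (Add (Var 7) (Const 1)) s2 = Suc m" using e v by simp
      have b: "val (Add (Read 3 (Var 7)) size_expr) s2 = 2 + Suc m * n" using e v s3 h1 by simp
      have ag2: "agree ?V ?s s2" by (rule agree_trans[OF ag conjunct1[OF s2]]) auto
      show "wp (Write 3 (Add (Var 7) (Const 1)) (Add (Read 3 (Var 7)) size_expr)) 11 (\<lambda>s'. s' 7 0 = m \<and> agree ?V ?s s' \<and> ?L (Suc m) s') s2"
      proof (rule wp_Write, unfold a b)
        show "(s2(3 := (s2 3)(Suc m := 2 + Suc m * n))) 7 0 = m \<and> agree ?V ?s (s2(3 := (s2 3)(Suc m := 2 + Suc m * n))) \<and>
          ?L (Suc m) (s2(3 := (s2 3)(Suc m := 2 + Suc m * n)))"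
          using e v ag2 agree_upd[OF ag2, of 3] h1 bits L by (auto simp: le_Suc_eq)
      qed simp
    qed simp
  next
    fix s' assume "agree ?V ?s s'"
    then have "s' 0 = ?s 0" by (rule agreeD) simp
    then show "val (Read 0 (Const 1)) s' = ?c" using inp(2) by simp
  next
    show "7 + expr_cost (Read 0 (Const 1)) + M * (20 + 26 * n + 10 + expr_cost (Read 0 (Const 1))) \<le> 9 + M * (32 + 26 * n)" by simp
  qed (use s1 M in auto)
  have fin: "stores n ?c Ws {} s'" if "agree ?V ?s s' \<and> ?L ?c s'" for s'
  proof -
    have "s' 0 = ?s 0" "s' 2 = ?s 2" using agreeD[OF conjunct1[OF that]] by auto
    then show ?thesis using that inp(2) inp(4)[of 2] unfolding stores_def by simp
  qed
  let ?s1 = "?s(1 := (?s 1)(0 := n))" and ?s2 = "?s(1 := (?s 1)(0 := n, 1 := ?c))"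
  let ?s3 = "?s(1 := (?s 1)(0 := n, 1 := ?c), 3 := (?s 3)(0 := 2))"
  show ?thesis unfolding init_def
  proof (rule wp_Seq[where T = 4 and U = "16 + M * (32 + 26 * n)" and R = "\<lambda>s'. s' = ?s1"])
    show "wp (Write 1 (Const 0) (Read 0 (Const 0))) 4 (\<lambda>s'. s' = ?s1) ?s" using inp(1) by (intro wp_Write) simp_all
  next
    fix x assume x: "x = ?s1"
    show "wp (Seq (Write 1 (Const 1) (Read 0 (Const 1))) (Seq (Write 3 (Const 0) (Const 2))
      (For 7 (Read 0 (Const 1)) load_row)))
      (16 + M * (32 + 26 * n)) (stores n ?c Ws {}) x"
    proof (rule wp_Seq[where T = 4 and U = "12 + M * (32 + 26 * n)" and R = "\<lambda>s'. s' = ?s2"])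
      show "wp (Write 1 (Const 1) (Read 0 (Const 1))) 4 (\<lambda>s'. s' = ?s2) x" using inp(2) x by (intro wp_Write) simp_all
    next
      fix y assume y: "y = ?s2"
      show "wp (Seq (Write 3 (Const 0) (Const 2))
        (For 7 (Read 0 (Const 1)) load_row))
        (12 + M * (32 + 26 * n)) (stores n ?c Ws {}) y"
      proof (rule wp_Seq[where T = 3 and U = "9 + M * (32 + 26 * n)" and R = "\<lambda>s'. s' = ?s3"])
        show "wp (Write 3 (Const 0) (Const 2)) 3 (\<lambda>s'. s' = ?s3) y" using y by (intro wp_Write) simp_all
      next
        fix z assume z: "z = ?s3"
        have "agree ?V ?s z" "?L 0 z" unfolding z by (auto simp: agree_def)
        from loop[OF this] show "wp (For 7 (Read 0 (Const 1)) load_row)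
          (9 + M * (32 + 26 * n)) (stores n ?c Ws {}) z"
        proof (rule wp_mono)
          show "stores n ?c Ws {} s'" if "agree ?V ?s s' \<and> ?L ?c s'" for s' using that by (rule fin)
        qed simp
      qed simp
    qed simp
  qed simp
qed

definition extend_weak_to_chord :: prog where
  "extend_weak_to_chord = Seq init (Seq (Assign 5 (Const 1)) (Seq phase (Seq (Assign 5 (Const 0)) phase)))"

text \<open>A bound for the potential, hence for the flips of one phase: at most
  \<open>1 + n * n\<close> members, each contributing at most \<open>n\<close>.\<close>

definition flip_bound :: "nat \<Rightarrow> nat" where "flip_bound n = (1 + n * n) * n"

text \<open>The input sets and the sets produced by the two phases.\<close>

definition row_bound :: "nat \<Rightarrow> nat" where "row_bound n = 1 + n * n + 2 * flip_bound n"

definition total_time :: "nat \<Rightarrow> nat" where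
  "total_time n = 30 + row_bound n * (32 + 26 * n) + 2 * phase_time n (row_bound n) (flip_bound n)"

lemma wp_extend_weak_to_chord:
  assumes W: "max_weak n W" and Ws: "distinct Ws" "set Ws = W"
  shows "wp extend_weak_to_chord (total_time n)
    (\<lambda>s'. \<exists>rows. outputs s' (encode n rows) \<and> distinct rows \<and> W \<subseteq> set rows \<and>
       maximal_separated_collection chord_separated n (set rows)) (input_state (encode n Ws))"
proof -
  let ?M = "row_bound n" and ?p = "flip_bound n" and ?l = "length Ws"
  let ?P = "phase_time n ?M ?p"
  have lW: "?l \<le> 1 + n * n" using max_weak_card[OF W] distinct_card[OF Ws(1)] Ws(2) by simp
  have pot: "potential n u W \<le> ?p" for u
  proof -
    have "potential n u W \<le> card W * n" using potential_le[OF W] .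
    also have "\<dots> \<le> (1 + n * n) * n" using max_weak_card[OF W] by (rule mult_le_mono1)
    finally show ?thesis unfolding flip_bound_def .
  qed
  have WsP: "set Ws \<subseteq> Pow {1..n}" using Ws(2) max_weak_sub[OF W] by blast
  have coll: "collection (Ws @ xs) {..<?l} = W" for xs
  proof -
    have "collection (Ws @ xs) {..<?l} = (!) (Ws @ xs) ` {..<?l}" by (rule collection_image) simp
    also have "\<dots> = (!) Ws ` {..<?l}" by (intro image_cong) (auto simp: nth_append)
    also have "\<dots> = W" using Ws(2) by (auto simp: set_conv_nth image_def)
    finally show ?thesis .
  qed
  have inj: "inj_on ((!) (Ws @ xs)) {..<?l}" for xs
    using inj_on_nth[OF Ws(1), of "{..<?l}"] unfolding inj_on_def by (simp add: nth_append)
  have set5: "wp (Assign 5 (Const c)) 3 (\<lambda>s'. stores n ?l rows A s' \<and> s' 5 0 = c) s" if "stores n ?l rows A s" for rows A s c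
  proof (rule wp_Write)
    have "stores n ?l rows A (s(5 := (s 5)(0 := c)))" by (rule stores_cong[OF that, of "{5}"]) (auto simp: agree_def)
    then show "stores n ?l rows A (s(5 := (s 5)(val (Const 0) s := val (Const c) s))) \<and> (s(5 := (s 5)(val (Const 0) s := val (Const c) s))) 5 0 = c"
      by simp
  qed simp
  let ?Q = "\<lambda>s'. \<exists>rows. outputs s' (encode n rows) \<and> distinct rows \<and> W \<subseteq> set rows \<and>
       maximal_separated_collection chord_separated n (set rows)"
  show ?thesis unfolding extend_weak_to_chord_def
  proof (rule wp_Seq[OF wp_init[where Ws = Ws and M = ?M], where U = "6 + 2 * ?P"])
    show "?l \<le> ?M" using lW unfolding row_bound_def by simp
    show "20 + ?M * (32 + 26 * n) + (6 + 2 * ?P) \<le> total_time n" unfolding total_time_def by simp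
  next
    fix s1 assume s1: "stores n ?l Ws {} s1"
    show "wp (Seq (Assign 5 (Const 1)) (Seq phase (Seq (Assign 5 (Const 0)) phase))) (6 + 2 * ?P) ?Q s1"
    proof (rule wp_Seq[OF set5[OF s1], where U = "3 + 2 * ?P"])
      fix s2 assume s2: "stores n ?l Ws {} s2 \<and> s2 5 0 = 1"
      show "wp (Seq phase (Seq (Assign 5 (Const 0)) phase)) (3 + 2 * ?P) ?Q s2"
      proof (rule wp_Seq[OF wp_phase[OF conjunct1[OF s2], where u = True and W = W and M = ?M and p = ?p], where U = "3 + ?P"])
        show "s2 5 0 = of_bool True" using s2 by simp
        show "collection Ws {..<?l} = W" "inj_on ((!) Ws) {..<?l}" using coll[of "[]"] inj[of "[]"] by simp_all
        show "?l + potential n True W \<le> ?M" using lW pot[of True] unfolding row_bound_def by simp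
      next
        fix s3 assume "\<exists>xs A' G. flips n True W xs G \<and> (\<forall>Z i j k. \<not> can_flip n True G Z i j k) \<and>
          stores n ?l (Ws @ xs) A' s3 \<and> set (Ws @ xs) \<subseteq> Pow {1..n}"
        then obtain ls A1 G where L: "flips n True W ls G" "\<forall>Z i j k. \<not> can_flip n True G Z i j k"
          "stores n ?l (Ws @ ls) A1 s3" "set (Ws @ ls) \<subseteq> Pow {1..n}" by auto
        show "wp (Seq (Assign 5 (Const 0)) phase) (3 + ?P) ?Q s3"
        proof (rule wp_Seq[OF set5[OF L(3)], where U = ?P])
          fix s4 assume s4: "stores n ?l (Ws @ ls) A1 s4 \<and> s4 5 0 = 0"
          have "length ls \<le> ?p" using flips_length[OF L(1) W] pot[of True] by simp
          then have len: "length (Ws @ ls) + potential n False W \<le> ?M"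
            using lW pot[of False] unfolding row_bound_def by simp
          show "wp phase ?P ?Q s4"
          proof (rule wp_mono[OF wp_phase[OF conjunct1[OF s4] _ _ coll W inj L(4) len pot]])
            show "s4 5 0 = of_bool False" using s4 by simp
            show "?l \<le> length (Ws @ ls)" by simp
          next
            fix s' assume "\<exists>xs A' G. flips n False W xs G \<and> (\<forall>Z i j k. \<not> can_flip n False G Z i j k) \<and>
              stores n ?l ((Ws @ ls) @ xs) A' s' \<and> set ((Ws @ ls) @ xs) \<subseteq> Pow {1..n}"
            then obtain rs A2 H where R: "flips n False W rs H" "\<forall>Z i j k. \<not> can_flip n False H Z i j k"
              "stores n ?l (Ws @ ls @ rs) A2 s'" by auto
            have "maximal_separated_collection chord_separated n (set (Ws @ ls @ rs))" "distinct (Ws @ ls @ rs)"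
              using flips_max_chord[OF W Ws L(1) _ R(1)] L(2) R(2) by blast+
            moreover have "W \<subseteq> set (Ws @ ls @ rs)" using Ws(2) by auto
            ultimately show "?Q s'" using outputs_stores[OF R(3)] by blast
          qed simp
        qed simp
      qed (use W WsP pot in auto)
    qed simp
  qed
qed

section \<open>Polynomial bounds for the running time\<close>

definition poly_bounded :: "(nat \<Rightarrow> nat) \<Rightarrow> bool" where
  "poly_bounded f \<longleftrightarrow> (\<exists>q :: nat poly. \<forall>n. f n \<le> poly q n)"

lemma poly_bounded_const: "poly_bounded (\<lambda>_. c)"
  unfolding poly_bounded_def by (intro exI[of _ "[:c:]"]) simp

lemma poly_bounded_id: "poly_bounded (\<lambda>n. n)"
  unfolding poly_bounded_def by (intro exI[of _ "[:0, 1:]"]) simp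

lemma poly_bounded_add: "poly_bounded f \<Longrightarrow> poly_bounded g \<Longrightarrow> poly_bounded (\<lambda>n. f n + g n)"
  unfolding poly_bounded_def by (metis add_mono poly_add)

lemma poly_bounded_mult: "poly_bounded f \<Longrightarrow> poly_bounded g \<Longrightarrow> poly_bounded (\<lambda>n. f n * g n)"
  unfolding poly_bounded_def by (metis mult_le_mono poly_mult)

lemma poly_bounded_total_time: "poly_bounded total_time"
  unfolding total_time_def phase_time_def pass_time_def attempt_time_def row_bound_def flip_bound_def Suc_eq_plus1
  by (intro poly_bounded_add poly_bounded_mult poly_bounded_const poly_bounded_id)

theorem theorem7p1:
  "\<exists>(p :: prog) (q :: nat poly). \<forall>(n :: nat) (W :: nat set set) (xs :: nat list).
     maximal_separated_collection weakly_separated n W \<and> represents n xs W \<longrightarrow>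
     (\<exists>t s C ys. runs p (input_state xs) t s \<and> t \<le> poly q n \<and>
        outputs s ys \<and> represents n ys C \<and>
        maximal_separated_collection chord_separated n C \<and> W \<subseteq> C)"
proof -
  obtain q :: "nat poly" where q: "\<And>n. total_time n \<le> poly q n"
    using poly_bounded_total_time unfolding poly_bounded_def by blast
  show ?thesis
  proof (intro exI[of _ extend_weak_to_chord] exI[of _ q] allI impI)
    fix n :: nat and W :: "nat set set" and xs :: "nat list"
    assume h: "maximal_separated_collection weakly_separated n W \<and> represents n xs W"
    then obtain Ws where Ws: "distinct Ws" "set Ws = W" "xs = encode n Ws" unfolding represents_def by blast
    obtain t s rows where r: "runs extend_weak_to_chord (input_state xs) t s" "t \<le> total_time n"
      "outputs s (encode n rows)" "distinct rows" "W \<subseteq> set rows"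
      "maximal_separated_collection chord_separated n (set rows)"
      using wp_extend_weak_to_chord[OF conjunct1[OF h] Ws(1,2)] unfolding wp_def Ws(3) by blast
    have "t \<le> poly q n" using r(2) q[of n] by linarith
    moreover have "represents n (encode n rows) (set rows)" unfolding represents_def using r(4) by blast
    ultimately show "\<exists>t s C ys. runs extend_weak_to_chord (input_state xs) t s \<and> t \<le> poly q n \<and>
        outputs s ys \<and> represents n ys C \<and> maximal_separated_collection chord_separated n C \<and> W \<subseteq> C"
      using r by blast
  qed
qed

end
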